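(* Let $m\in\mathbb{N}\cup\{\infty\}$ and let $J=\bigcup_{0\le j<m}[a_j+b_j,\,a_{j+1}+b_j)$ be a union of segments of total measure one, where $(a_j)$ and $(b_j)$ are as described in the context. If there exists a real number $\beta\ge 1$ such that $\frac{b_k}{\beta}\in\mathbb{Z}$ for all $k$, then, for this $\beta$, the set $\mathcal{B}^*=\{e^{2\pi i x(n+\delta_n^* )}\}_{n\in\mathbb{Z}}$, where $$\delta_n^*=\begin{cases}\frac{\lfloor \beta n\rfloor+1}{\beta}-n & \text{if } \{\beta n\}\ge \frac12,\\ \frac{\lfloor \beta n\rfloor}{\beta}-n & \text{if } \{\beta n\}<\frac12,\end{cases}$$ is an exponential basis for $L^2(J)$.
   Context: The sequence $0=a_0<a_1<\dots$ in $[0,1]$ is such that the intervals $I_j=[a_j,a_{j+1})$, $0\le j<m$, partition $I=[0,1)$: if $m$ is finite, $0=a_0<a_1<\dots<a_{m-1}<a_m=1$; if $m=\infty$, $(a_j)_{j\ge0}$ is strictly increasing in $[0,1)$ with limit $1$. The sequence $0=b_0<b_1<\dots$ (indices $0\le j<m$) is a strictly increasing sequence of real numbers. For real $x$, $\lfloor x\rfloor$ is the largest integer $\le x$ and $\{x\}=x-\lfloor x\rfloor$. For measurable $D\subset\mathbb{R}$, an exponential basis for $L^2(D)$ is an unconditional Schauder basis of $L^2(D)$ consisting of functions $e^{2\pi i\lambda x}$ with real $\lambda$ (for sets of finite measure, equivalently, a Riesz basis of $L^2(D)$ consisting of such exponentials). *)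

theory Defs
  imports "HOL-Analysis.Analysis" "HOL-Library.Extended_Nat"
begin

text \<open>
  Elements of \<open>L\<^sup>2(D)\<close> are represented by square-integrable functions rather than by classes modulo
  null sets; identification almost everywhere is accounted for by measuring convergence in the
  \<open>L\<^sup>2\<close> norm only.
\<close>

definition L2_space :: "real set \<Rightarrow> (real \<Rightarrow> complex) set" where
  "L2_space D = {f \<in> borel_measurable (lebesgue_on D). integrable (lebesgue_on D) (\<lambda>x. (norm (f x))\<^sup>2)}"

definition L2_nrm :: "real set \<Rightarrow> (real \<Rightarrow> complex) \<Rightarrow> real" where
  "L2_nrm D f = sqrt (\<integral>x. (norm (f x))\<^sup>2 \<partial>lebesgue_on D)"

definition L2_sums :: "real set \<Rightarrow> (nat \<Rightarrow> real \<Rightarrow> complex) \<Rightarrow> (real \<Rightarrow> complex) \<Rightarrow> bool" where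
  "L2_sums D g f \<longleftrightarrow> (\<lambda>N. L2_nrm D (\<lambda>x. f x - (\<Sum>n<N. g n x))) \<longlonglongrightarrow> 0"

definition schauder_basis_L2 :: "real set \<Rightarrow> (nat \<Rightarrow> real \<Rightarrow> complex) \<Rightarrow> bool" where
  "schauder_basis_L2 D e \<longleftrightarrow>
     (\<forall>n. e n \<in> L2_space D) \<and>
     (\<forall>f\<in>L2_space D. \<exists>!c :: nat \<Rightarrow> complex. L2_sums D (\<lambda>n x. c n * e n x) f)"

text \<open>
  A set \<open>B\<close> carries no order, so unconditionality reads: every enumeration of \<open>B\<close> without repetition
  is a Schauder basis. The first conjunct (\<open>B\<close> is countably infinite) prevents the second one from
  holding vacuously; it excludes only the trivial space \<open>L\<^sup>2(D) = 0\<close> of a null set \<open>D\<close>.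
\<close>

definition unconditional_basis_L2 :: "real set \<Rightarrow> (real \<Rightarrow> complex) set \<Rightarrow> bool" where
  "unconditional_basis_L2 D B \<longleftrightarrow>
     (\<exists>e :: nat \<Rightarrow> real \<Rightarrow> complex. bij_betw e UNIV B) \<and>
     (\<forall>e :: nat \<Rightarrow> real \<Rightarrow> complex. bij_betw e UNIV B \<longrightarrow> schauder_basis_L2 D e)"

definition expfun :: "real \<Rightarrow> real \<Rightarrow> complex" where
  "expfun \<omega> x = exp (2 * of_real pi * \<i> * of_real (\<omega> * x))"

definition exponential_basis :: "real set \<Rightarrow> (real \<Rightarrow> complex) set \<Rightarrow> bool" where
  "exponential_basis D B \<longleftrightarrow> B \<subseteq> range expfun \<and> unconditional_basis_L2 D B"

text \<open>
  Only the values \<open>a j\<close> with \<open>j \<le> m\<close> (\<open>j\<close> finite) and \<open>b j\<close> with \<open>j < m\<close> are constrained; the case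
  \<open>m = 0\<close> is ruled out by \<open>a 0 = 0\<close> and \<open>a m = 1\<close>. For \<open>m = \<infinity>\<close>, monotonicity together with the
  limit \<open>1\<close> forces all \<open>a j\<close> to lie in \<open>[0,1)\<close>.
\<close>

definition unit_partition :: "enat \<Rightarrow> (nat \<Rightarrow> real) \<Rightarrow> bool" where
  "unit_partition m a \<longleftrightarrow>
     a 0 = 0 \<and> (\<forall>j. enat j < m \<longrightarrow> a j < a (Suc j)) \<and>
     (case m of enat k \<Rightarrow> a k = 1 | \<infinity> \<Rightarrow> a \<longlonglongrightarrow> 1)"

definition shift_sequence :: "enat \<Rightarrow> (nat \<Rightarrow> real) \<Rightarrow> bool" where
  "shift_sequence m b \<longleftrightarrow> b 0 = 0 \<and> (\<forall>j. enat (Suc j) < m \<longrightarrow> b j < b (Suc j))"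

definition segment_union :: "enat \<Rightarrow> (nat \<Rightarrow> real) \<Rightarrow> (nat \<Rightarrow> real) \<Rightarrow> real set" where
  "segment_union m a b = (\<Union>j\<in>{j. enat j < m}. {a j + b j ..< a (Suc j) + b j})"

definition delta_star :: "real \<Rightarrow> int \<Rightarrow> real" where
  "delta_star \<beta> n =
     (if frac (\<beta> * of_int n) \<ge> 1 / 2
      then (of_int \<lfloor>\<beta> * of_int n\<rfloor> + 1) / \<beta> - of_int n
      else of_int \<lfloor>\<beta> * of_int n\<rfloor> / \<beta> - of_int n)"

end

theory Submission
  imports Defs
begin

text \<open>
  Write \<open>r(n)\<close> for the integer nearest to \<open>\<beta> n\<close>, halves rounded up. The frequencies
  \<open>n + \<delta>\<^sub>n\<close> are the numbers \<open>r(n) / \<beta>\<close>, so the exponentials all have period \<open>\<beta>\<close>. The shifts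
  \<open>b\<^sub>k\<close> are multiples of \<open>\<beta>\<close>; translating each segment of \<open>J\<close> back by \<open>b\<^sub>k\<close> is therefore a
  measure-preserving bijection onto \<open>[0,1)\<close> which the exponentials do not notice
  (\<open>unfold_measure\<close>, \<open>riesz_basis_transport\<close>). It remains to show that the exponentials with the
  frequencies \<open>r(n) / \<beta>\<close> form a Riesz basis of \<open>L\<^sup>2[0,1)\<close> (\<open>riesz_basis_unit_nearest\<close>): a Riesz
  basis is a Schauder basis in every order (\<open>riesz_basis_expansion\<close>).

  Since \<open>\<bar>\<delta>\<^sub>n\<bar> \<le> 1 / (2 \<beta>)\<close>, Kadec's quarter theorem (\<open>kadec\<close>) settles \<open>\<beta> > 2\<close>, and for
  \<open>\<beta> = 1\<close> and \<open>\<beta> = 2\<close> there is no perturbation at all. For \<open>1 < \<beta> < 2\<close> the bound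
  exceeds \<open>1/4\<close>, and one passes to the complement. On \<open>[0,\<beta>)\<close> the exponentials with frequencies
  \<open>k / \<beta>\<close>, \<open>k \<in> \<int>\<close>, are an orthogonal basis, and for any orthogonal basis \<open>E\<close> of
  \<open>L\<^sup>2(X)\<close> whose members have equal norms, if \<open>E \<setminus> \<Lambda>\<close> is a Riesz basis on \<open>X \<setminus> S\<close> then \<open>\<Lambda>\<close> is one on \<open>S\<close>
  (\<open>riesz_basis_complement\<close>). Here \<open>S = [0,1)\<close> and the complementary interval \<open>[1,\<beta>)\<close> has length
  \<open>\<beta> - 1\<close>. The integers that are not of the form \<open>r(n)\<close> are again obtained by rounding: they are the
  integers nearest to \<open>(n - 1/2) / \<alpha>\<close> with \<open>\<alpha> = 1 - 1/\<beta> < 1/2\<close> (\<open>bij_conearest\<close>). After rescaling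
  \<open>[1,\<beta>)\<close> to unit length these frequencies differ from \<open>n - 1/2\<close> by at most \<open>\<alpha> / 2 < 1/4\<close>, so
  that Kadec's theorem applies to the complement.

  Kadec's theorem is proved by Kadec's own argument. Expanding
  \<open>1 - exp(i\<delta>x)\<close> in the functions \<open>1\<close>, \<open>cos(kx)\<close> and \<open>sin((k - 1/2)x)\<close> gives coefficients
  whose absolute values increase with \<open>\<bar>\<delta>\<bar> \<le> 1/4\<close> and add up, by evaluation at an end point, to
  \<open>1 - cos(\<pi>\<delta>) + sin(\<pi>\<bar>\<delta>\<bar>)\<close>, which is less than 1 for \<open>\<bar>\<delta>\<bar> < 1/4\<close>. The two series come from a single
  cosine series (\<open>cos_fourier\<close>), which rests on the completeness of the trigonometric system
  (\<open>fourier_dense\<close>).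

  All estimates concern finite linear combinations, and the density of the spans of perturbed and of
  selected exponentials is obtained by iterating a contraction (\<open>dense_by_contraction\<close>).
\<close>

section \<open>Square-integrable functions over a measure\<close>

definition sqint :: "'a measure \<Rightarrow> ('a \<Rightarrow> complex) set" where
  "sqint M = {f \<in> borel_measurable M. integrable M (\<lambda>x. (norm (f x))\<^sup>2)}"

definition l2norm :: "'a measure \<Rightarrow> ('a \<Rightarrow> complex) \<Rightarrow> real" where
  "l2norm M f = sqrt (\<integral>x. (norm (f x))\<^sup>2 \<partial>M)"

definition l2inner :: "'a measure \<Rightarrow> ('a \<Rightarrow> complex) \<Rightarrow> ('a \<Rightarrow> complex) \<Rightarrow> complex" where
  "l2inner M f g = (\<integral>x. f x * cnj (g x) \<partial>M)"

lemma sqint_measurable: "f \<in> sqint M \<Longrightarrow> f \<in> borel_measurable M"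
  by (simp add: sqint_def)

lemma l2norm_nonneg [simp]: "0 \<le> l2norm M f"
  by (simp add: l2norm_def)

lemma l2norm_power2: "(l2norm M f)\<^sup>2 = (\<integral>x. (norm (f x))\<^sup>2 \<partial>M)"
  by (simp add: l2norm_def)

lemma sqint_bound:
  assumes "f \<in> sqint M" "g \<in> borel_measurable M" "\<And>x. x \<in> space M \<Longrightarrow> norm (g x) \<le> C * norm (f x)"
  shows "g \<in> sqint M"
proof -
  have I: "integrable M (\<lambda>x. C\<^sup>2 * (norm (f x))\<^sup>2)"
    using assms(1) by (simp add: sqint_def)
  have [measurable]: "g \<in> borel_measurable M" by fact
  have le: "(norm (g x))\<^sup>2 \<le> norm (C\<^sup>2 * (norm (f x))\<^sup>2)" if "x \<in> space M" for x
    using power_mono[OF assms(3)[OF that], of 2] by (simp add: power_mult_distrib)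
  have "integrable M (\<lambda>x. (norm (g x))\<^sup>2)"
  proof (rule Bochner_Integration.integrable_bound[OF I])
    show "AE x in M. norm ((norm (g x))\<^sup>2) \<le> norm (C\<^sup>2 * (norm (f x))\<^sup>2)"
      using le by (intro AE_I2) simp
  qed measurable
  then show ?thesis using assms(2) by (simp add: sqint_def)
qed

lemma sqint_mult_left [intro]:
  assumes "f \<in> sqint M" shows "(\<lambda>x. c * f x) \<in> sqint M"
  by (rule sqint_bound[OF assms, of _ "norm c"]) (use sqint_measurable[OF assms] in \<open>auto simp: norm_mult\<close>)

lemma sqint_add [intro]:
  assumes f: "f \<in> sqint M" and g: "g \<in> sqint M"
  shows "(\<lambda>x. f x + g x) \<in> sqint M"
proof -
  have [measurable]: "f \<in> borel_measurable M" "g \<in> borel_measurable M"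
    using f g by (auto simp: sqint_def)
  have le: "(norm (f x + g x))\<^sup>2 \<le> 2 * (norm (f x))\<^sup>2 + 2 * (norm (g x))\<^sup>2" for x
  proof -
    have "(norm (f x + g x))\<^sup>2 \<le> (norm (f x) + norm (g x))\<^sup>2"
      by (intro power_mono norm_triangle_ineq) auto
    also have "\<dots> \<le> 2 * (norm (f x))\<^sup>2 + 2 * (norm (g x))\<^sup>2"
      using sum_squares_bound[of "norm (f x)" "norm (g x)"] by (simp add: power2_sum)
    finally show ?thesis .
  qed
  have I: "integrable M (\<lambda>x. 2 * (norm (f x))\<^sup>2 + 2 * (norm (g x))\<^sup>2)"
    using f g by (simp add: sqint_def)
  have "integrable M (\<lambda>x. (norm (f x + g x))\<^sup>2)"
  proof (rule Bochner_Integration.integrable_bound[OF I])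
    show "AE x in M. norm ((norm (f x + g x))\<^sup>2) \<le> norm (2 * (norm (f x))\<^sup>2 + 2 * (norm (g x))\<^sup>2)"
      by (intro AE_I2 order_trans[OF _ abs_ge_self[folded real_norm_def]]) (simp add: le)
  qed measurable
  then show ?thesis by (simp add: sqint_def)
qed

lemma sqint_zero [simp]: "(\<lambda>x. 0) \<in> sqint M"
  by (simp add: sqint_def)

lemma sqint_uminus [intro]: "f \<in> sqint M \<Longrightarrow> (\<lambda>x. - f x) \<in> sqint M"
  using sqint_mult_left[of f M "-1"] by simp

lemma sqint_diff [intro]:
  assumes f: "f \<in> sqint M" and g: "g \<in> sqint M"
  shows "(\<lambda>x. f x - g x) \<in> sqint M"
  using sqint_add[OF f sqint_uminus[OF g]] by simp

lemma sqint_sum [intro]: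
  assumes "\<And>i. i \<in> F \<Longrightarrow> f i \<in> sqint M"
  shows "(\<lambda>x. \<Sum>i\<in>F. f i x) \<in> sqint M"
  using assms by (induction F rule: infinite_finite_induct) auto

lemma sqint_bounded:
  assumes "finite_measure M" "f \<in> borel_measurable M" "\<And>x. x \<in> space M \<Longrightarrow> norm (f x) \<le> C"
  shows "f \<in> sqint M"
proof (rule sqint_bound[of "\<lambda>_. 1" M f C])
  interpret finite_measure M by fact
  show "(\<lambda>_. 1) \<in> sqint M" by (simp add: sqint_def)
qed (use assms in auto)

lemma borel_measurable_cnj [measurable (raw)]:
  "f \<in> borel_measurable M \<Longrightarrow> (\<lambda>x. cnj (f x)) \<in> borel_measurable M"
  by (rule borel_measurable_continuous_on[of cnj]) (auto intro: continuous_intros)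

lemma l2inner_integrable:
  assumes f: "f \<in> sqint M" and g: "g \<in> sqint M"
  shows "integrable M (\<lambda>x. f x * cnj (g x))"
proof -
  have [measurable]: "f \<in> borel_measurable M" "g \<in> borel_measurable M"
    using f g by (auto simp: sqint_def)
  have I: "integrable M (\<lambda>x. (norm (f x))\<^sup>2 + (norm (g x))\<^sup>2)"
    using f g by (simp add: sqint_def)
  have le: "norm (f x * cnj (g x)) \<le> norm ((norm (f x))\<^sup>2 + (norm (g x))\<^sup>2)" for x
  proof -
    have "0 \<le> norm (f x) * norm (g x)" by simp
    then have "norm (f x) * norm (g x) \<le> (norm (f x))\<^sup>2 + (norm (g x))\<^sup>2"
      using sum_squares_bound[of "norm (f x)" "norm (g x)"] by linarith
    then show ?thesis by (simp add: norm_mult)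
  qed
  show ?thesis
    by (rule Bochner_Integration.integrable_bound[OF I]) (measurable, rule AE_I2, rule le)
qed

lemma l2inner_add_left:
  assumes "f \<in> sqint M" "g \<in> sqint M" "h \<in> sqint M"
  shows "l2inner M (\<lambda>x. f x + g x) h = l2inner M f h + l2inner M g h"
  unfolding l2inner_def using assms
  by (subst Bochner_Integration.integral_add[symmetric]) (auto intro: l2inner_integrable simp: algebra_simps)

lemma l2inner_mult_left: "l2inner M (\<lambda>x. c * f x) h = c * l2inner M f h"
  unfolding l2inner_def by (simp add: mult.assoc)

lemma l2inner_commute: "l2inner M f g = cnj (l2inner M g f)"
proof -
  have "cnj (l2inner M g f) = (\<integral>x. cnj (g x * cnj (f x)) \<partial>M)"
    unfolding l2inner_def by (rule Bochner_Integration.integral_cnj[symmetric])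
  then show ?thesis by (simp add: l2inner_def mult.commute)
qed

lemma l2inner_add_right:
  assumes "f \<in> sqint M" "g \<in> sqint M" "h \<in> sqint M"
  shows "l2inner M h (\<lambda>x. f x + g x) = l2inner M h f + l2inner M h g"
  unfolding l2inner_def using assms
  by (subst Bochner_Integration.integral_add[symmetric]) (auto intro: l2inner_integrable simp: algebra_simps)

lemma l2inner_mult_right: "l2inner M h (\<lambda>x. c * f x) = cnj c * l2inner M h f"
  by (subst l2inner_commute) (simp add: l2inner_mult_left l2inner_commute[of M h f])

lemma l2inner_sum_left:
  assumes "\<And>i. i \<in> F \<Longrightarrow> f i \<in> sqint M" "h \<in> sqint M"
  shows "l2inner M (\<lambda>x. \<Sum>i\<in>F. f i x) h = (\<Sum>i\<in>F. l2inner M (f i) h)"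
  using assms
proof (induction F rule: infinite_finite_induct)
  case (insert i F)
  then show ?case by (simp add: l2inner_add_left sqint_sum)
qed (auto simp: l2inner_def)

lemma l2inner_sum_right:
  assumes "\<And>i. i \<in> F \<Longrightarrow> f i \<in> sqint M" "h \<in> sqint M"
  shows "l2inner M h (\<lambda>x. \<Sum>i\<in>F. f i x) = (\<Sum>i\<in>F. l2inner M h (f i))"
proof -
  have "l2inner M h (\<lambda>x. \<Sum>i\<in>F. f i x) = cnj (\<Sum>i\<in>F. l2inner M (f i) h)"
    by (subst l2inner_commute) (simp add: assms l2inner_sum_left)
  also have "\<dots> = (\<Sum>i\<in>F. l2inner M h (f i))"
    unfolding cnj_sum by (rule sum.cong[OF refl]) (rule l2inner_commute[symmetric])
  finally show ?thesis .
qed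

lemma l2inner_self: "l2inner M f f = of_real ((l2norm M f)\<^sup>2)"
  by (simp add: l2inner_def l2norm_power2 complex_norm_square[symmetric] flip: integral_complex_of_real)

lemma l2norm_uminus: "l2norm M (\<lambda>x. - f x) = l2norm M f"
  by (simp add: l2norm_def)

lemma l2norm_diff_commute: "l2norm M (\<lambda>x. f x - g x) = l2norm M (\<lambda>x. g x - f x)"
  by (simp add: l2norm_def norm_minus_commute)

lemma l2norm_add_power2:
  assumes "f \<in> sqint M" "g \<in> sqint M"
  shows "(l2norm M (\<lambda>x. f x + g x))\<^sup>2 = (l2norm M f)\<^sup>2 + 2 * Re (l2inner M f g) + (l2norm M g)\<^sup>2"
proof -
  have s: "(\<lambda>x. f x + g x) \<in> sqint M" using assms by auto
  have "complex_of_real ((l2norm M (\<lambda>x. f x + g x))\<^sup>2)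
      = l2inner M f f + (l2inner M f g + cnj (l2inner M f g)) + l2inner M g g"
    unfolding l2inner_self[symmetric]
    by (simp add: l2inner_add_left l2inner_add_right assms s l2inner_commute[of M g f])
  then have "Re (complex_of_real ((l2norm M (\<lambda>x. f x + g x))\<^sup>2))
      = Re (l2inner M f f + (l2inner M f g + cnj (l2inner M f g)) + l2inner M g g)" by simp
  then show ?thesis by (simp add: l2inner_self)
qed

lemma l2norm_zero_AE:
  assumes "f \<in> sqint M" "l2norm M f = 0" shows "AE x in M. f x = 0"
proof -
  have "(\<integral>x. (norm (f x))\<^sup>2 \<partial>M) = 0"
    using assms(2) by (simp add: l2norm_def)
  then have "AE x in M. (norm (f x))\<^sup>2 = 0"
    using assms(1) by (subst integral_nonneg_eq_0_iff_AE[symmetric]) (auto simp: sqint_def)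
  then show ?thesis by auto
qed

lemma l2norm_cauchy_schwarz:
  assumes f: "f \<in> sqint M" and g: "g \<in> sqint M"
  shows "norm (l2inner M f g) \<le> l2norm M f * l2norm M g"
proof (cases "l2norm M f = 0 \<or> l2norm M g = 0")
  case True
  have [measurable]: "f \<in> borel_measurable M" "g \<in> borel_measurable M"
    using f g by (auto simp: sqint_def)
  have "AE x in M. f x * cnj (g x) = 0"
    using True l2norm_zero_AE[OF f] l2norm_zero_AE[OF g] by auto
  then have "l2inner M f g = 0"
    unfolding l2inner_def by (subst integral_cong_AE[where g = "\<lambda>_. 0"]) simp_all
  with True show ?thesis by auto
next
  case False
  then have pos: "l2norm M f > 0" "l2norm M g > 0"
    using l2norm_nonneg[of M f] l2norm_nonneg[of M g] by linarith+
  define s where "s = l2norm M g / l2norm M f"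
  have s: "s > 0" using pos by (simp add: s_def)
  have I: "integrable M (\<lambda>x. s / 2 * (norm (f x))\<^sup>2 + 1 / (2 * s) * (norm (g x))\<^sup>2)"
    using f g by (simp add: sqint_def)
  have "norm (l2inner M f g) \<le> (\<integral>x. norm (f x * cnj (g x)) \<partial>M)"
    unfolding l2inner_def by (rule integral_norm_bound)
  also have "\<dots> \<le> (\<integral>x. s / 2 * (norm (f x))\<^sup>2 + 1 / (2 * s) * (norm (g x))\<^sup>2 \<partial>M)"
  proof (rule integral_mono[OF integrable_norm[OF l2inner_integrable[OF f g]] I])
    fix x
    have "0 \<le> (s * norm (f x) - norm (g x))\<^sup>2 / (2 * s)" using s by simp
    also have "\<dots> = s / 2 * (norm (f x))\<^sup>2 + 1 / (2 * s) * (norm (g x))\<^sup>2 - norm (f x) * norm (g x)"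
      using s by (simp add: field_simps power2_eq_square)
    finally show "norm (f x * cnj (g x)) \<le> s / 2 * (norm (f x))\<^sup>2 + 1 / (2 * s) * (norm (g x))\<^sup>2"
      by (simp add: norm_mult)
  qed
  also have "\<dots> = s / 2 * (l2norm M f)\<^sup>2 + 1 / (2 * s) * (l2norm M g)\<^sup>2"
    using f g by (simp add: sqint_def l2norm_power2)
  also have "\<dots> = l2norm M f * l2norm M g"
    using pos by (simp add: s_def field_simps power2_eq_square)
  finally show ?thesis .
qed

lemma l2norm_triangle:
  assumes f: "f \<in> sqint M" and g: "g \<in> sqint M"
  shows "l2norm M (\<lambda>x. f x + g x) \<le> l2norm M f + l2norm M g"
proof (rule power2_le_imp_le)
  have "Re (l2inner M f g) \<le> l2norm M f * l2norm M g"
    using complex_Re_le_cmod l2norm_cauchy_schwarz[OF f g] order_trans by blast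
  then show "(l2norm M (\<lambda>x. f x + g x))\<^sup>2 \<le> (l2norm M f + l2norm M g)\<^sup>2"
    by (simp add: l2norm_add_power2[OF f g] power2_sum)
qed simp

lemma l2norm_triangle_diff:
  assumes f: "f \<in> sqint M" and g: "g \<in> sqint M"
  shows "l2norm M (\<lambda>x. f x - g x) \<le> l2norm M f + l2norm M g"
  using l2norm_triangle[OF f sqint_uminus[OF g]] by (simp add: l2norm_uminus)

lemma l2norm_triangle_mid:
  assumes "f \<in> sqint M" "g \<in> sqint M" "h \<in> sqint M"
  shows "l2norm M (\<lambda>x. f x - h x) \<le> l2norm M (\<lambda>x. f x - g x) + l2norm M (\<lambda>x. g x - h x)"
  using l2norm_triangle[OF sqint_diff[OF assms(1,2)] sqint_diff[OF assms(2,3)]] by simp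

lemma l2norm_sum_le:
  assumes "\<And>i. i \<in> F \<Longrightarrow> f i \<in> sqint M"
  shows "l2norm M (\<lambda>x. \<Sum>i\<in>F. f i x) \<le> (\<Sum>i\<in>F. l2norm M (f i))"
  using assms
proof (induction F rule: infinite_finite_induct)
  case (insert i F)
  then have "l2norm M (\<lambda>x. f i x + (\<Sum>i\<in>F. f i x)) \<le> l2norm M (f i) + l2norm M (\<lambda>x. \<Sum>i\<in>F. f i x)"
    by (intro l2norm_triangle) auto
  with insert.IH insert.prems insert.hyps show ?case by simp
qed (auto simp: l2norm_def)

lemma l2norm_le_mult:
  assumes f: "f \<in> sqint M" and g: "g \<in> borel_measurable M" and C: "0 \<le> C"
    and le: "\<And>x. x \<in> space M \<Longrightarrow> norm (g x) \<le> C * norm (f x)"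
  shows "l2norm M g \<le> C * l2norm M f"
proof -
  have gs: "g \<in> sqint M" by (rule sqint_bound[OF f g le])
  have "(\<integral>x. (norm (g x))\<^sup>2 \<partial>M) \<le> (\<integral>x. C\<^sup>2 * (norm (f x))\<^sup>2 \<partial>M)"
  proof (rule integral_mono)
    show "(norm (g x))\<^sup>2 \<le> C\<^sup>2 * (norm (f x))\<^sup>2" if "x \<in> space M" for x
      using power_mono[OF le[OF that], of 2] by (simp add: power_mult_distrib)
  qed (use f gs in \<open>auto simp: sqint_def\<close>)
  also have "\<dots> = (C * l2norm M f)\<^sup>2"
    using f by (simp add: power_mult_distrib l2norm_power2 sqint_def)
  finally have "(l2norm M g)\<^sup>2 \<le> (C * l2norm M f)\<^sup>2" by (simp add: l2norm_power2)
  then show ?thesis using C by (auto intro: power2_le_imp_le)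
qed

section \<open>Riesz bases\<close>

text \<open>
  Upper and lower estimates for finite combinations together with density of the span. This form
  refers to no ordering of the index set, and for \<open>L\<^sup>2\<close> over \<open>M\<close> it is equivalent to being the
  image of an orthonormal basis under an isomorphism.
\<close>

definition riesz_basis :: "'a measure \<Rightarrow> ('i \<Rightarrow> 'a \<Rightarrow> complex) \<Rightarrow> 'i set \<Rightarrow> bool" where
  "riesz_basis M e K \<longleftrightarrow>
     (\<forall>k\<in>K. e k \<in> sqint M) \<and>
     (\<exists>A>0. \<forall>F c. finite F \<longrightarrow> F \<subseteq> K \<longrightarrow>
        A * (\<Sum>k\<in>F. (norm (c k))\<^sup>2) \<le> (l2norm M (\<lambda>x. \<Sum>k\<in>F. c k * e k x))\<^sup>2) \<and>
     (\<exists>B. \<forall>F c. finite F \<longrightarrow> F \<subseteq> K \<longrightarrow>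
        (l2norm M (\<lambda>x. \<Sum>k\<in>F. c k * e k x))\<^sup>2 \<le> B * (\<Sum>k\<in>F. (norm (c k))\<^sup>2)) \<and>
     (\<forall>f\<in>sqint M. \<forall>\<epsilon>>0. \<exists>F c. finite F \<and> F \<subseteq> K \<and>
        l2norm M (\<lambda>x. f x - (\<Sum>k\<in>F. c k * e k x)) < \<epsilon>)"

lemma riesz_basisD:
  assumes "riesz_basis M e K"
  shows "\<And>k. k \<in> K \<Longrightarrow> e k \<in> sqint M"
    and "\<exists>A>0. \<forall>F c. finite F \<longrightarrow> F \<subseteq> K \<longrightarrow>
        A * (\<Sum>k\<in>F. (norm (c k))\<^sup>2) \<le> (l2norm M (\<lambda>x. \<Sum>k\<in>F. c k * e k x))\<^sup>2"
    and "\<exists>B. \<forall>F c. finite F \<longrightarrow> F \<subseteq> K \<longrightarrow>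
        (l2norm M (\<lambda>x. \<Sum>k\<in>F. c k * e k x))\<^sup>2 \<le> B * (\<Sum>k\<in>F. (norm (c k))\<^sup>2)"
    and "\<And>f \<epsilon>. f \<in> sqint M \<Longrightarrow> \<epsilon> > 0 \<Longrightarrow> \<exists>F c. finite F \<and> F \<subseteq> K \<and>
        l2norm M (\<lambda>x. f x - (\<Sum>k\<in>F. c k * e k x)) < \<epsilon>"
proof -
  note R = assms[unfolded riesz_basis_def]
  show "k \<in> K \<Longrightarrow> e k \<in> sqint M" for k
    using conjunct1[OF R] by blast
  show "\<exists>A>0. \<forall>F c. finite F \<longrightarrow> F \<subseteq> K \<longrightarrow>
        A * (\<Sum>k\<in>F. (norm (c k))\<^sup>2) \<le> (l2norm M (\<lambda>x. \<Sum>k\<in>F. c k * e k x))\<^sup>2"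
    by (rule conjunct1[OF conjunct2[OF R]])
  show "\<exists>B. \<forall>F c. finite F \<longrightarrow> F \<subseteq> K \<longrightarrow>
        (l2norm M (\<lambda>x. \<Sum>k\<in>F. c k * e k x))\<^sup>2 \<le> B * (\<Sum>k\<in>F. (norm (c k))\<^sup>2)"
    by (rule conjunct1[OF conjunct2[OF conjunct2[OF R]]])
  show "f \<in> sqint M \<Longrightarrow> \<epsilon> > 0 \<Longrightarrow> \<exists>F c. finite F \<and> F \<subseteq> K \<and>
        l2norm M (\<lambda>x. f x - (\<Sum>k\<in>F. c k * e k x)) < \<epsilon>" for f \<epsilon>
    using conjunct2[OF conjunct2[OF conjunct2[OF R]]] by simp
qed

lemma riesz_basisI:
  assumes "\<And>k. k \<in> K \<Longrightarrow> e k \<in> sqint M" "A > 0"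
    and "\<And>F c. finite F \<Longrightarrow> F \<subseteq> K \<Longrightarrow>
        A * (\<Sum>k\<in>F. (norm (c k))\<^sup>2) \<le> (l2norm M (\<lambda>x. \<Sum>k\<in>F. c k * e k x))\<^sup>2"
    and "\<And>F c. finite F \<Longrightarrow> F \<subseteq> K \<Longrightarrow>
        (l2norm M (\<lambda>x. \<Sum>k\<in>F. c k * e k x))\<^sup>2 \<le> B * (\<Sum>k\<in>F. (norm (c k))\<^sup>2)"
    and "\<And>f \<epsilon>. f \<in> sqint M \<Longrightarrow> \<epsilon> > 0 \<Longrightarrow> \<exists>F c. finite F \<and> F \<subseteq> K \<and>
        l2norm M (\<lambda>x. f x - (\<Sum>k\<in>F. c k * e k x)) < \<epsilon>"
  shows "riesz_basis M e K"
  unfolding riesz_basis_def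
proof (intro conjI)
  show "\<forall>k\<in>K. e k \<in> sqint M" by (simp add: assms(1))
  show "\<exists>A>0. \<forall>F c. finite F \<longrightarrow> F \<subseteq> K \<longrightarrow>
        A * (\<Sum>k\<in>F. (norm (c k))\<^sup>2) \<le> (l2norm M (\<lambda>x. \<Sum>k\<in>F. c k * e k x))\<^sup>2"
    by (rule exI[of _ A]) (simp add: assms(2,3))
  show "\<exists>B. \<forall>F c. finite F \<longrightarrow> F \<subseteq> K \<longrightarrow>
        (l2norm M (\<lambda>x. \<Sum>k\<in>F. c k * e k x))\<^sup>2 \<le> B * (\<Sum>k\<in>F. (norm (c k))\<^sup>2)"
    by (rule exI[of _ B]) (simp add: assms(4))
  show "\<forall>f\<in>sqint M. \<forall>\<epsilon>>0. \<exists>F c. finite F \<and> F \<subseteq> K \<and>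
        l2norm M (\<lambda>x. f x - (\<Sum>k\<in>F. c k * e k x)) < \<epsilon>"
    by (intro ballI allI impI assms(5))
qed

lemma riesz_basis_reindex:
  assumes R: "riesz_basis M e K" and g: "bij_betw g J K"
    and e': "\<And>j. j \<in> J \<Longrightarrow> e' j = e (g j)"
  shows "riesz_basis M e' J"
proof -
  have gJ: "g j \<in> K" if "j \<in> J" for j using g that by (auto simp: bij_betw_def)
  have inj: "inj_on g F" if "F \<subseteq> J" for F using g that by (meson bij_betw_def inj_on_subset)
  define h where "h = the_inv_into J g"
  have hg: "h (g j) = j" if "j \<in> J" for j
    unfolding h_def using g that by (simp add: bij_betw_def the_inv_into_f_f)
  have S: "(\<Sum>k\<in>g ` F. (norm (c (h k)))\<^sup>2) = (\<Sum>j\<in>F. (norm (c j))\<^sup>2)" if "F \<subseteq> J" for F and c :: "'c \<Rightarrow> complex"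
    using that by (subst sum.reindex[OF inj[OF that]]) (auto intro!: sum.cong simp: hg subset_iff)
  have T: "(\<Sum>k\<in>g ` F. c (h k) * e k x) = (\<Sum>j\<in>F. c j * e' j x)" if "F \<subseteq> J" for F c x
    using that by (subst sum.reindex[OF inj[OF that]]) (auto intro!: sum.cong simp: hg e' subset_iff)
  have im: "g ` F \<subseteq> K" if "F \<subseteq> J" for F using that gJ by auto
  obtain A where A: "A > 0" "\<And>F c. finite F \<Longrightarrow> F \<subseteq> K \<Longrightarrow>
        A * (\<Sum>k\<in>F. (norm (c k))\<^sup>2) \<le> (l2norm M (\<lambda>x. \<Sum>k\<in>F. c k * e k x))\<^sup>2"
    using riesz_basisD(2)[OF R] by auto
  obtain B where B: "\<And>F c. finite F \<Longrightarrow> F \<subseteq> K \<Longrightarrow>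
        (l2norm M (\<lambda>x. \<Sum>k\<in>F. c k * e k x))\<^sup>2 \<le> B * (\<Sum>k\<in>F. (norm (c k))\<^sup>2)"
    using riesz_basisD(3)[OF R] by auto
  show ?thesis
  proof (rule riesz_basisI)
    show "e' j \<in> sqint M" if "j \<in> J" for j using riesz_basisD(1)[OF R gJ[OF that]] e'[OF that] by simp
    show "A > 0" by fact
    show "A * (\<Sum>j\<in>F. (norm (c j))\<^sup>2) \<le> (l2norm M (\<lambda>x. \<Sum>j\<in>F. c j * e' j x))\<^sup>2"
      if "finite F" "F \<subseteq> J" for F c
      using A(2)[of "g ` F" "\<lambda>k. c (h k)"] that im[of F] by (simp add: S T)
    show "(l2norm M (\<lambda>x. \<Sum>j\<in>F. c j * e' j x))\<^sup>2 \<le> B * (\<Sum>j\<in>F. (norm (c j))\<^sup>2)"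
      if "finite F" "F \<subseteq> J" for F c
      using B[of "g ` F" "\<lambda>k. c (h k)"] that im[of F] by (simp add: S T)
    fix f and \<epsilon> :: real assume "f \<in> sqint M" "\<epsilon> > 0"
    then obtain F c where F: "finite F" "F \<subseteq> K" "l2norm M (\<lambda>x. f x - (\<Sum>k\<in>F. c k * e k x)) < \<epsilon>"
      using riesz_basisD(4)[OF R] by meson
    have "F \<subseteq> g ` J" using F(2) g by (auto simp: bij_betw_def)
    then obtain G where G: "G \<subseteq> J" "F = g ` G" "finite G"
      using finite_subset_image[OF F(1)] by blast
    have "(\<Sum>k\<in>F. c k * e k x) = (\<Sum>j\<in>G. c (g j) * e' j x)" for x
      unfolding G(2) using G(1) by (subst sum.reindex[OF inj[OF G(1)]]) (auto intro!: sum.cong simp: e' subset_iff)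
    then show "\<exists>F c. finite F \<and> F \<subseteq> J \<and> l2norm M (\<lambda>x. f x - (\<Sum>j\<in>F. c j * e' j x)) < \<epsilon>"
      using F(3) G by auto
  qed
qed

text \<open>
  Multiplication by \<open>w\<close> is unitary on \<open>L\<^sup>2\<close>, and the factors \<open>u k\<close> can be absorbed into the
  coefficients. This allows translations of the variable and of the frequencies to be ignored.
\<close>

lemma riesz_basis_unimodular:
  assumes R: "riesz_basis M e K" and u: "\<And>k. k \<in> K \<Longrightarrow> norm (u k) = 1"
    and w: "w \<in> borel_measurable M" "\<And>x. norm (w x) = 1"
  shows "riesz_basis M (\<lambda>k x. u k * (w x * e k x)) K"
proof -
  have T: "(\<Sum>k\<in>F. c k * (u k * (w x * e k x))) = w x * (\<Sum>k\<in>F. (c k * u k) * e k x)" for F c x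
    by (simp add: sum_distrib_left mult_ac)
  have N: "l2norm M (\<lambda>x. w x * f x) = l2norm M f" for f
    by (simp add: l2norm_def norm_mult w)
  have S: "(\<Sum>k\<in>F. (norm (c k * u k))\<^sup>2) = (\<Sum>k\<in>F. (norm (c k))\<^sup>2)" if "F \<subseteq> K" for F c
    using that by (intro sum.cong) (auto simp: norm_mult u subset_iff)
  obtain A where A: "A > 0" "\<And>F c. finite F \<Longrightarrow> F \<subseteq> K \<Longrightarrow>
        A * (\<Sum>k\<in>F. (norm (c k))\<^sup>2) \<le> (l2norm M (\<lambda>x. \<Sum>k\<in>F. c k * e k x))\<^sup>2"
    using riesz_basisD(2)[OF R] by auto
  obtain B where B: "\<And>F c. finite F \<Longrightarrow> F \<subseteq> K \<Longrightarrow>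
        (l2norm M (\<lambda>x. \<Sum>k\<in>F. c k * e k x))\<^sup>2 \<le> B * (\<Sum>k\<in>F. (norm (c k))\<^sup>2)"
    using riesz_basisD(3)[OF R] by auto
  show ?thesis
  proof (rule riesz_basisI)
    fix k assume k: "k \<in> K"
    show "(\<lambda>x. u k * (w x * e k x)) \<in> sqint M"
      by (rule sqint_bound[OF riesz_basisD(1)[OF R k], of _ 1])
        (use sqint_measurable[OF riesz_basisD(1)[OF R k]] w(1) in \<open>auto simp: norm_mult u k w(2)\<close>)
  next
    show "A > 0" by fact
    show "A * (\<Sum>k\<in>F. (norm (c k))\<^sup>2) \<le> (l2norm M (\<lambda>x. \<Sum>k\<in>F. c k * (u k * (w x * e k x))))\<^sup>2"
      if "finite F" "F \<subseteq> K" for F c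
      using A(2)[OF that, of "\<lambda>k. c k * u k"] that by (simp only: T N S)
    show "(l2norm M (\<lambda>x. \<Sum>k\<in>F. c k * (u k * (w x * e k x))))\<^sup>2 \<le> B * (\<Sum>k\<in>F. (norm (c k))\<^sup>2)"
      if "finite F" "F \<subseteq> K" for F c
      using B[OF that, of "\<lambda>k. c k * u k"] that by (simp only: T N S)
    fix f and \<epsilon> :: real assume f: "f \<in> sqint M" "\<epsilon> > 0"
    have w0: "cnj (w x) * w x = 1" for x
      using w(2)[of x] by (simp add: mult.commute complex_norm_square[symmetric])
    have "(\<lambda>x. cnj (w x) * f x) \<in> sqint M"
      by (rule sqint_bound[OF f(1), of _ 1])
        (use w(1) sqint_measurable[OF f(1)] in \<open>auto simp: norm_mult w(2)\<close>)
    then obtain F c where F: "finite F" "F \<subseteq> K"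
      "l2norm M (\<lambda>x. cnj (w x) * f x - (\<Sum>k\<in>F. c k * e k x)) < \<epsilon>"
      using riesz_basisD(4)[OF R _ f(2)] by meson
    have u0: "cnj (u k) * u k = 1" if "k \<in> K" for k
      using u[OF that] by (simp add: mult.commute complex_norm_square[symmetric])
    have "f x - (\<Sum>k\<in>F. (c k * cnj (u k)) * (u k * (w x * e k x)))
        = w x * (cnj (w x) * f x - (\<Sum>k\<in>F. c k * e k x))" for x
    proof -
      have "(\<Sum>k\<in>F. (c k * cnj (u k)) * (u k * (w x * e k x))) = w x * (\<Sum>k\<in>F. c k * e k x)"
        unfolding sum_distrib_left
      proof (rule sum.cong)
        fix k assume "k \<in> F"
        then have "cnj (u k) * u k = 1" using u0 F(2) by auto
        then show "(c k * cnj (u k)) * (u k * (w x * e k x)) = w x * (c k * e k x)"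
          by (metis (no_types, lifting) mult.assoc mult.left_commute mult_1)
      qed simp
      moreover have "w x * (cnj (w x) * f x) = f x"
        using w0[of x] by (metis mult.assoc mult.commute mult_1)
      ultimately show ?thesis by (simp add: right_diff_distrib)
    qed
    then have "l2norm M (\<lambda>x. f x - (\<Sum>k\<in>F. (c k * cnj (u k)) * (u k * (w x * e k x)))) < \<epsilon>"
      using F(3) by (simp only: N)
    with F show "\<exists>F c. finite F \<and> F \<subseteq> K \<and> l2norm M (\<lambda>x. f x - (\<Sum>k\<in>F. c k * (u k * (w x * e k x)))) < \<epsilon>"
      by (intro exI[of _ F] exI[of _ "\<lambda>k. c k * cnj (u k)"]) auto
  qed
qed

text \<open>
  Composition with \<open>\<psi>\<close> is, up to the factor \<open>sqrt c\<close>, an isometry of \<open>L\<^sup>2(N)\<close> into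
  \<open>L\<^sup>2(M)\<close>. Hence approximating \<open>f \<circ> \<psi>\<close> over \<open>M\<close> by combinations of
  the \<open>e k \<circ> \<psi>\<close> is the same as approximating \<open>f\<close> over \<open>N\<close> by combinations of the \<open>e k\<close>.
\<close>

lemma riesz_basis_transport:
  assumes R: "riesz_basis M (\<lambda>k x. e k (\<psi> x)) K" and e: "\<And>k. k \<in> K \<Longrightarrow> e k \<in> borel_measurable N"
    and \<psi>: "\<psi> \<in> measurable M N" and c: "c > 0"
    and d: "distr M N \<psi> = density N (\<lambda>_. ennreal c)"
  shows "riesz_basis N e K"
proof -
  have I: "integrable M (\<lambda>x. (cmod (f (\<psi> x)))\<^sup>2) \<longleftrightarrow> integrable N (\<lambda>x. (cmod (f x))\<^sup>2)"
    and L: "(\<integral>x. (cmod (f (\<psi> x)))\<^sup>2 \<partial>M) = c * (\<integral>x. (cmod (f x))\<^sup>2 \<partial>N)"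
    if [measurable]: "f \<in> borel_measurable N" for f
  proof -
    have m: "(\<lambda>x. (norm (f x))\<^sup>2) \<in> borel_measurable N" by measurable
    have "integrable M (\<lambda>x. (norm (f (\<psi> x)))\<^sup>2) \<longleftrightarrow> integrable (distr M N \<psi>) (\<lambda>x. (norm (f x))\<^sup>2)"
      by (rule integrable_distr_eq[OF \<psi> m, symmetric])
    also have "\<dots> \<longleftrightarrow> integrable N (\<lambda>x. c *\<^sub>R (norm (f x))\<^sup>2)"
      unfolding d using m c by (intro integrable_density) auto
    also have "\<dots> \<longleftrightarrow> integrable N (\<lambda>x. (norm (f x))\<^sup>2)" using c by simp
    finally show "integrable M (\<lambda>x. (norm (f (\<psi> x)))\<^sup>2) \<longleftrightarrow> integrable N (\<lambda>x. (norm (f x))\<^sup>2)" .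
    have "(\<integral>x. (norm (f (\<psi> x)))\<^sup>2 \<partial>M) = (\<integral>x. (norm (f x))\<^sup>2 \<partial>distr M N \<psi>)"
      by (rule integral_distr[OF \<psi> m, symmetric])
    also have "\<dots> = (\<integral>x. c *\<^sub>R (norm (f x))\<^sup>2 \<partial>N)"
      unfolding d using m c by (intro integral_density) auto
    finally show "(\<integral>x. (norm (f (\<psi> x)))\<^sup>2 \<partial>M) = c * (\<integral>x. (norm (f x))\<^sup>2 \<partial>N)" by simp
  qed
  have N: "l2norm M (\<lambda>x. f (\<psi> x)) = sqrt c * l2norm N f" if "f \<in> borel_measurable N" for f
    using L[OF that] by (simp add: l2norm_def real_sqrt_mult)
  have S: "(\<lambda>x. f (\<psi> x)) \<in> sqint M" if "f \<in> sqint N" for f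
    using that I[of f] by (auto simp: sqint_def intro: measurable_compose[OF \<psi>])
  have m: "(\<lambda>x. \<Sum>k\<in>F. a k * e k x) \<in> borel_measurable N" if "F \<subseteq> K" for F a
    using that e by (intro borel_measurable_sum borel_measurable_times) auto
  have N2: "(l2norm M (\<lambda>x. \<Sum>k\<in>F. a k * e k (\<psi> x)))\<^sup>2 = c * (l2norm N (\<lambda>x. \<Sum>k\<in>F. a k * e k x))\<^sup>2"
    if "F \<subseteq> K" for F a
    using N[OF m[OF that, of a]] c by (simp add: power_mult_distrib)
  obtain A where A: "A > 0" "\<And>F a. finite F \<Longrightarrow> F \<subseteq> K \<Longrightarrow>
        A * (\<Sum>k\<in>F. (norm (a k))\<^sup>2) \<le> (l2norm M (\<lambda>x. \<Sum>k\<in>F. a k * e k (\<psi> x)))\<^sup>2"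
    using riesz_basisD(2)[OF R] by auto
  obtain B where B: "\<And>F a. finite F \<Longrightarrow> F \<subseteq> K \<Longrightarrow>
        (l2norm M (\<lambda>x. \<Sum>k\<in>F. a k * e k (\<psi> x)))\<^sup>2 \<le> B * (\<Sum>k\<in>F. (norm (a k))\<^sup>2)"
    using riesz_basisD(3)[OF R] by auto
  show ?thesis
  proof (rule riesz_basisI)
    show "e k \<in> sqint N" if k: "k \<in> K" for k
      using riesz_basisD(1)[OF R k] I[OF e[OF k]] e[OF k] by (simp add: sqint_def)
    show "A / c > 0" using A c by simp
    show "A / c * (\<Sum>k\<in>F. (norm (a k))\<^sup>2) \<le> (l2norm N (\<lambda>x. \<Sum>k\<in>F. a k * e k x))\<^sup>2"
      if "finite F" "F \<subseteq> K" for F a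
      using A(2)[OF that, of a] c unfolding N2[OF that(2)] by (simp add: field_simps)
    show "(l2norm N (\<lambda>x. \<Sum>k\<in>F. a k * e k x))\<^sup>2 \<le> B / c * (\<Sum>k\<in>F. (norm (a k))\<^sup>2)"
      if "finite F" "F \<subseteq> K" for F a
      using B[OF that, of a] c unfolding N2[OF that(2)] by (simp add: field_simps)
    fix f and \<epsilon> :: real assume f: "f \<in> sqint N" "\<epsilon> > 0"
    have "sqrt c * \<epsilon> > 0" using c f(2) by simp
    then obtain F a where F: "finite F" "F \<subseteq> K"
      "l2norm M (\<lambda>x. f (\<psi> x) - (\<Sum>k\<in>F. a k * e k (\<psi> x))) < sqrt c * \<epsilon>"
      using riesz_basisD(4)[OF R S[OF f(1)]] by meson
    have "l2norm M (\<lambda>x. f (\<psi> x) - (\<Sum>k\<in>F. a k * e k (\<psi> x)))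
        = sqrt c * l2norm N (\<lambda>x. f x - (\<Sum>k\<in>F. a k * e k x))"
      using sqint_measurable[OF f(1)] m[OF F(2), of a] by (intro N) auto
    then have "l2norm N (\<lambda>x. f x - (\<Sum>k\<in>F. a k * e k x)) < \<epsilon>" using F(3) c by simp
    then show "\<exists>F a. finite F \<and> F \<subseteq> K \<and> l2norm N (\<lambda>x. f x - (\<Sum>k\<in>F. a k * e k x)) < \<epsilon>"
      using F(1,2) by blast
  qed
qed

section \<open>Riesz bases are unconditional Schauder bases\<close>

text \<open>
  Approximate \<open>f\<close> by finite combinations with coefficient sequences \<open>d k\<close>. By the lower estimate these
  are Cauchy in \<open>\<ell>\<^sup>2\<close>; let \<open>c\<close> be their coordinatewise limit. The lower estimate passes to the
  limit on every initial segment, and the upper estimate then turns the bound on \<open>d k - c\<close> into a bound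
  on the difference of the partial sums. Uniqueness is the lower estimate applied to the
  difference of two expansions.
\<close>

lemma riesz_basis_expansion:
  fixes e :: "nat \<Rightarrow> 'a \<Rightarrow> complex"
  assumes R: "riesz_basis M e UNIV" and f: "f \<in> sqint M"
  shows "\<exists>!c. (\<lambda>N. l2norm M (\<lambda>x. f x - (\<Sum>n<N. c n * e n x))) \<longlonglongrightarrow> 0"
proof -
  define s where "s c N = (\<lambda>x. \<Sum>n<N. c n * e n x)" for c N
  have es: "e n \<in> sqint M" for n using riesz_basisD(1)[OF R] by simp
  have ss: "s c N \<in> sqint M" for c N
    unfolding s_def by (intro sqint_sum sqint_mult_left es)
  have sd: "(\<lambda>x. s c N x - s d N x) = s (\<lambda>n. c n - d n) N" for c d N
    by (rule ext) (simp add: s_def left_diff_distrib sum_subtractf)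
  obtain A where A: "A > 0" "A * (\<Sum>n<N. (norm (c n))\<^sup>2) \<le> (l2norm M (s c N))\<^sup>2" for c N
    using riesz_basisD(2)[OF R] unfolding s_def by auto
  obtain B where B: "(l2norm M (s c N))\<^sup>2 \<le> B * (\<Sum>n<N. (norm (c n))\<^sup>2)" for c N
    using riesz_basisD(3)[OF R] unfolding s_def by auto
  have A1: "A * (norm (c n))\<^sup>2 \<le> (l2norm M (s c N))\<^sup>2" if "n < N" for c n N
  proof -
    have "(norm (c n))\<^sup>2 \<le> (\<Sum>n<N. (norm (c n))\<^sup>2)"
      using that by (intro member_le_sum) auto
    then show ?thesis using A(2)[of c N] A(1) by (meson order_trans mult_left_mono less_imp_le)
  qed
  define r where "r k = 1 / (real k + 1)" for k
  have r: "r k > 0" for k by (simp add: r_def)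
  have rlim: "r \<longlonglongrightarrow> 0"
    unfolding r_def using LIMSEQ_inverse_real_of_nat by (simp add: inverse_eq_divide add.commute)
  have "\<exists>d N. \<forall>n\<ge>N. l2norm M (\<lambda>x. f x - s d n x) < r k" for k
  proof -
    obtain F c where F: "finite F" "l2norm M (\<lambda>x. f x - (\<Sum>n\<in>F. c n * e n x)) < r k"
      using riesz_basisD(4)[OF R f r] by blast
    define d where "d n = (if n \<in> F then c n else 0)" for n
    obtain N where N: "F \<subseteq> {..<N}" using F(1) finite_nat_iff_bounded by blast
    have "s d n = (\<lambda>x. \<Sum>n\<in>F. c n * e n x)" if "n \<ge> N" for n
    proof
      fix x
      have "F \<subseteq> {..<n}" using N that by auto
      then show "s d n x = (\<Sum>n\<in>F. c n * e n x)"
        unfolding s_def by (intro sum.mono_neutral_cong_right) (auto simp: d_def)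
    qed
    then show ?thesis using F(2) by (intro exI[of _ d] exI[of _ N]) simp
  qed
  then obtain d N0 where d: "l2norm M (\<lambda>x. f x - s (d k) n x) < r k" if "n \<ge> N0 k" for k n
    by metis
  have close: "l2norm M (s (\<lambda>n. d k n - d l n) N) \<le> r k + r l" if "N \<ge> N0 k" "N \<ge> N0 l" for k l N
  proof -
    have "l2norm M (\<lambda>x. s (d k) N x - s (d l) N x)
        \<le> l2norm M (\<lambda>x. s (d k) N x - f x) + l2norm M (\<lambda>x. f x - s (d l) N x)"
      by (rule l2norm_triangle_mid[OF ss f ss])
    also have "l2norm M (\<lambda>x. s (d k) N x - f x) = l2norm M (\<lambda>x. f x - s (d k) N x)"
      by (rule l2norm_diff_commute)
    finally show ?thesis unfolding sd using d[OF that(1)] d[OF that(2)] by linarith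
  qed
  have close2: "A * (\<Sum>n<N. (norm (d k n - d l n))\<^sup>2) \<le> (r k + r l)\<^sup>2" for k l N
  proof -
    define N' where "N' = max N (max (N0 k) (N0 l))"
    have "(\<Sum>n<N. (norm (d k n - d l n))\<^sup>2) \<le> (\<Sum>n<N'. (norm (d k n - d l n))\<^sup>2)"
      by (rule sum_mono2) (auto simp: N'_def)
    then have "A * (\<Sum>n<N. (norm (d k n - d l n))\<^sup>2) \<le> A * (\<Sum>n<N'. (norm (d k n - d l n))\<^sup>2)"
      using A(1) by simp
    also have "\<dots> \<le> (l2norm M (s (\<lambda>n. d k n - d l n) N'))\<^sup>2" by (rule A(2))
    also have "\<dots> \<le> (r k + r l)\<^sup>2"
      by (rule power_mono[OF close]) (auto simp: N'_def)
    finally show ?thesis .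
  qed
  have "Cauchy (\<lambda>k. d k n)" for n
  proof (rule metric_CauchyI)
    fix \<epsilon> :: real assume \<epsilon>: "\<epsilon> > 0"
    have "(\<lambda>k. r k) \<longlonglongrightarrow> 0" by (rule rlim)
    then have "eventually (\<lambda>k. r k < sqrt A * \<epsilon> / 2) sequentially"
      using A(1) \<epsilon> by (intro order_tendstoD(2)) auto
    then obtain k0 where k0: "r k < sqrt A * \<epsilon> / 2" if "k \<ge> k0" for k
      by (auto simp: eventually_sequentially)
    show "\<exists>m. \<forall>k\<ge>m. \<forall>l\<ge>m. dist (d k n) (d l n) < \<epsilon>"
    proof (intro exI allI impI)
      fix k l assume kl: "k \<ge> k0" "l \<ge> k0"
      have "(norm (d k n - d l n))\<^sup>2 \<le> (\<Sum>n<Suc n. (norm (d k n - d l n))\<^sup>2)"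
        by (intro member_le_sum) auto
      then have "A * (norm (d k n - d l n))\<^sup>2 \<le> (r k + r l)\<^sup>2"
        using close2[where k=k and l=l and N="Suc n"] A(1) by (meson order_trans mult_left_mono less_imp_le)
      also have "\<dots> < (sqrt A * \<epsilon>)\<^sup>2"
        using k0[OF kl(1)] k0[OF kl(2)] r[of k] r[of l] by (intro power_strict_mono) linarith+
      also have "\<dots> = A * \<epsilon>\<^sup>2" using A(1) by (simp add: power_mult_distrib)
      finally have "(norm (d k n - d l n))\<^sup>2 < \<epsilon>\<^sup>2" using A(1) by simp
      then show "dist (d k n) (d l n) < \<epsilon>"
        unfolding dist_norm using \<epsilon> by (meson less_imp_le power_less_imp_less_base)
    qed
  qed
  then have "\<forall>n. \<exists>L. (\<lambda>k. d k n) \<longlonglongrightarrow> L"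
    by (simp add: Cauchy_convergent_iff convergent_def)
  then obtain c where c: "(\<lambda>k. d k n) \<longlonglongrightarrow> c n" for n
    unfolding choice_iff by blast
  have cd: "A * (\<Sum>n<N. (norm (d k n - c n))\<^sup>2) \<le> (r k)\<^sup>2" for k N
  proof (rule LIMSEQ_le)
    show "(\<lambda>l. A * (\<Sum>n<N. (norm (d k n - d l n))\<^sup>2)) \<longlonglongrightarrow> A * (\<Sum>n<N. (norm (d k n - c n))\<^sup>2)"
      by (intro tendsto_intros c)
    show "(\<lambda>l. (r k + r l)\<^sup>2) \<longlonglongrightarrow> (r k)\<^sup>2"
      using tendsto_power[OF tendsto_add[OF tendsto_const rlim, of "r k"], of 2] by simp
  qed (use close2 in auto)
  define C where "C = 1 + sqrt (\<bar>B\<bar> / A)"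
  have C: "C > 0" unfolding C_def using A(1) by (simp add: add_pos_nonneg)
  have est: "l2norm M (\<lambda>x. f x - s c N x) \<le> C * r k" if "N \<ge> N0 k" for k N
  proof -
    have "(l2norm M (s (\<lambda>n. d k n - c n) N))\<^sup>2 \<le> B * (\<Sum>n<N. (norm (d k n - c n))\<^sup>2)" by (rule B)
    also have "\<dots> \<le> \<bar>B\<bar> * ((r k)\<^sup>2 / A)"
      using cd[where k=k and N=N] A(1) by (intro mult_mono) (auto simp: sum_nonneg field_simps)
    also have "\<dots> = (sqrt (\<bar>B\<bar> / A) * r k)\<^sup>2"
      using A(1) by (simp add: power_mult_distrib)
    finally have "l2norm M (s (\<lambda>n. d k n - c n) N) \<le> sqrt (\<bar>B\<bar> / A) * r k"
      using A(1) r[of k] by (auto intro: power2_le_imp_le)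
    moreover have "l2norm M (\<lambda>x. f x - s c N x)
        \<le> l2norm M (\<lambda>x. f x - s (d k) N x) + l2norm M (\<lambda>x. s (d k) N x - s c N x)"
      by (rule l2norm_triangle_mid[OF f ss ss])
    ultimately show ?thesis unfolding sd C_def using d[OF that] by (simp add: algebra_simps)
  qed
  have ex: "(\<lambda>N. l2norm M (\<lambda>x. f x - s c N x)) \<longlonglongrightarrow> 0"
  proof (rule LIMSEQ_I)
    fix \<epsilon> :: real assume \<epsilon>: "\<epsilon> > 0"
    have "eventually (\<lambda>k. r k < \<epsilon> / C) sequentially"
      using C \<epsilon> by (intro order_tendstoD(2)[OF rlim]) auto
    then obtain k where k: "r k < \<epsilon> / C" by (auto simp: eventually_sequentially)
    then have "C * r k < \<epsilon>" using C by (simp add: field_simps)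
    then have "norm (l2norm M (\<lambda>x. f x - s c N x) - 0) < \<epsilon>" if "N \<ge> N0 k" for N
      using est[OF that] by simp
    then show "\<exists>no. \<forall>N\<ge>no. norm (l2norm M (\<lambda>x. f x - s c N x) - 0) < \<epsilon>" by blast
  qed
  have uniq: "c1 = c2"
    if c1: "(\<lambda>N. l2norm M (\<lambda>x. f x - s c1 N x)) \<longlonglongrightarrow> 0"
      and c2: "(\<lambda>N. l2norm M (\<lambda>x. f x - s c2 N x)) \<longlonglongrightarrow> 0" for c1 c2
  proof
    fix n
    define t where "t N = l2norm M (\<lambda>x. f x - s c1 N x) + l2norm M (\<lambda>x. f x - s c2 N x)" for N
    have t: "t \<longlonglongrightarrow> 0" unfolding t_def using tendsto_add[OF c1 c2] by simp
    have bnd: "A * (norm (c1 n - c2 n))\<^sup>2 \<le> (t N)\<^sup>2" if "N \<ge> Suc n" for N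
    proof -
      have "A * (norm (c1 n - c2 n))\<^sup>2 \<le> (l2norm M (s (\<lambda>n. c1 n - c2 n) N))\<^sup>2"
        using A1[of n N "\<lambda>n. c1 n - c2 n"] that by simp
      also have "\<dots> \<le> (t N)\<^sup>2"
      proof (rule power_mono)
        show "l2norm M (s (\<lambda>n. c1 n - c2 n) N) \<le> t N"
          using l2norm_triangle_mid[OF ss[of c1 N] f ss[of c2 N]]
          unfolding sd t_def by (simp only: l2norm_diff_commute[of M "s c1 N" f])
      qed simp
      finally show ?thesis .
    qed
    have "A * (norm (c1 n - c2 n))\<^sup>2 \<le> 0\<^sup>2"
      by (rule LIMSEQ_le_const[OF tendsto_power[OF t]]) (use bnd in blast)
    then show "c1 n = c2 n" using A(1) by (simp add: mult_le_0_iff)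
  qed
  show ?thesis
    using ex uniq unfolding s_def by (intro ex1I[of _ c]) auto
qed

lemma riesz_basis_imp_unconditional_basis:
  fixes e :: "'i \<Rightarrow> real \<Rightarrow> complex"
  assumes R: "riesz_basis (lebesgue_on D) e UNIV" and inj: "inj e"
    and count: "\<exists>g :: nat \<Rightarrow> 'i. bij g"
  shows "unconditional_basis_L2 D (range e)"
  unfolding unconditional_basis_L2_def
proof (intro conjI allI impI)
  obtain g :: "nat \<Rightarrow> 'i" where g: "bij g" using count by blast
  have "bij_betw (e \<circ> g) UNIV (range e)"
    by (rule bij_betw_trans[OF g]) (simp add: inj bij_betw_def)
  then show "\<exists>h :: nat \<Rightarrow> real \<Rightarrow> complex. bij_betw h UNIV (range e)" by blast
next
  fix h :: "nat \<Rightarrow> real \<Rightarrow> complex" assume h: "bij_betw h UNIV (range e)"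
  \<comment> \<open>an enumeration of the set is one of the index set, since the family is injective\<close>
  define g where "g = inv e \<circ> h"
  have "bij_betw (inv e) (range e) UNIV"
    using inj by (simp add: bij_betw_def inj_on_inv_into image_comp comp_def)
  then have g: "bij_betw g UNIV UNIV"
    unfolding g_def using h bij_betw_trans by blast
  have hg: "e (g n) = h n" for n
  proof -
    have "h n \<in> range e" using bij_betw_imp_surj_on[OF h] by blast
    then show ?thesis by (simp add: g_def f_inv_into_f)
  qed
  have R': "riesz_basis (lebesgue_on D) h UNIV"
    by (rule riesz_basis_reindex[OF R g]) (simp add: hg)
  show "schauder_basis_L2 D h"
    unfolding schauder_basis_L2_def L2_sums_def
    using riesz_basisD(1)[OF R'] riesz_basis_expansion[OF R']
    by (simp add: L2_space_def L2_nrm_def sqint_def l2norm_def)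
qed

section \<open>Density by contraction, and perturbation of orthonormal bases\<close>

text \<open>
  Approximation arguments below end with an error that is a multiple of an arbitrary \<open>\<epsilon>\<close>; this
  removes it.
\<close>

lemma le_if_le_add_mult_eps:
  fixes a b C :: real
  assumes "\<And>\<epsilon>. \<epsilon> > 0 \<Longrightarrow> a \<le> b + C * \<epsilon>"
  shows "a \<le> b"
proof (rule tendsto_le[of "at_right (0::real)"])
  show "((\<lambda>\<epsilon>. b + C * \<epsilon>) \<longlongrightarrow> b) (at_right 0)"
    by (auto intro!: tendsto_eq_intros)
  show "eventually (\<lambda>\<epsilon>. a \<le> b + C * \<epsilon>) (at_right 0)"
    using assms by (auto simp: eventually_at_right_less intro: eventually_mono[OF eventually_at_right_less])
qed auto

lemma lincomb_add:
  fixes e :: "'i \<Rightarrow> 'a \<Rightarrow> complex"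
  assumes "finite F" "finite G"
  shows "(\<Sum>k\<in>F. c k * e k x) + (\<Sum>k\<in>G. d k * e k x)
    = (\<Sum>k\<in>F \<union> G. ((if k \<in> F then c k else 0) + (if k \<in> G then d k else 0)) * e k x)"
proof -
  have "(\<Sum>k\<in>F. c k * e k x) = (\<Sum>k\<in>F \<union> G. (if k \<in> F then c k else 0) * e k x)"
    using assms by (intro sum.mono_neutral_cong_left) auto
  moreover have "(\<Sum>k\<in>G. d k * e k x) = (\<Sum>k\<in>F \<union> G. (if k \<in> G then d k else 0) * e k x)"
    using assms by (intro sum.mono_neutral_cong_left) auto
  ultimately show ?thesis by (simp add: distrib_right sum.distrib)
qed

text \<open>
  If one step can always shrink the norm of the remainder by a fixed factor \<open>q < 1\<close>, up to an
  arbitrarily small error, then repeating the step on the remainder drives it to zero.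
\<close>

lemma dense_by_contraction:
  assumes e: "\<And>k. k \<in> K \<Longrightarrow> e k \<in> sqint M" and q: "0 \<le> q" "q < 1"
    and contr: "\<And>f \<epsilon>. f \<in> sqint M \<Longrightarrow> \<epsilon> > 0 \<Longrightarrow> \<exists>F c. finite F \<and> F \<subseteq> K \<and>
        l2norm M (\<lambda>x. f x - (\<Sum>k\<in>F. c k * e k x)) \<le> q * l2norm M f + \<epsilon>"
    and f: "f \<in> sqint M" and \<epsilon>: "\<epsilon> > 0"
  shows "\<exists>F c. finite F \<and> F \<subseteq> K \<and> l2norm M (\<lambda>x. f x - (\<Sum>k\<in>F. c k * e k x)) < \<epsilon>"
proof -
  have it: "\<exists>F c. finite F \<and> F \<subseteq> K \<and>
      l2norm M (\<lambda>x. f x - (\<Sum>k\<in>F. c k * e k x)) \<le> q ^ n * l2norm M f + \<epsilon>" if "\<epsilon> > 0" for n and \<epsilon> :: real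
    using that
  proof (induction n arbitrary: \<epsilon>)
    case 0
    then show ?case by (intro exI[of _ "{}"]) simp
  next
    case (Suc n)
    obtain F c where F: "finite F" "F \<subseteq> K"
      "l2norm M (\<lambda>x. f x - (\<Sum>k\<in>F. c k * e k x)) \<le> q ^ n * l2norm M f + \<epsilon> / 2"
      using Suc.IH[of "\<epsilon> / 2"] Suc.prems by auto
    define g where "g = (\<lambda>x. f x - (\<Sum>k\<in>F. c k * e k x))"
    have g: "g \<in> sqint M" unfolding g_def using F(2) e by (intro sqint_diff f sqint_sum sqint_mult_left) auto
    obtain G d where G: "finite G" "G \<subseteq> K"
      "l2norm M (\<lambda>x. g x - (\<Sum>k\<in>G. d k * e k x)) \<le> q * l2norm M g + \<epsilon> / 2"
      using contr[OF g, of "\<epsilon> / 2"] Suc.prems by auto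
    have eq: "g x - (\<Sum>k\<in>G. d k * e k x)
        = f x - (\<Sum>k\<in>F \<union> G. ((if k \<in> F then c k else 0) + (if k \<in> G then d k else 0)) * e k x)" for x
      unfolding g_def lincomb_add[OF F(1) G(1), symmetric] by simp
    have "q * l2norm M g \<le> q * (q ^ n * l2norm M f + \<epsilon> / 2)"
      using F(3) q(1) unfolding g_def by (rule mult_left_mono)
    moreover have "q * (\<epsilon> / 2) \<le> \<epsilon> / 2" using q Suc.prems by (simp add: mult_left_le_one_le)
    ultimately have "l2norm M (\<lambda>x. f x - (\<Sum>k\<in>F \<union> G. ((if k \<in> F then c k else 0) + (if k \<in> G then d k else 0)) * e k x))
        \<le> q ^ Suc n * l2norm M f + \<epsilon>"
      using G(3) unfolding eq by (simp add: algebra_simps)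
    then show ?case using F G
      by (intro exI[of _ "F \<union> G"] exI[of _ "\<lambda>k. (if k \<in> F then c k else 0) + (if k \<in> G then d k else 0)"]) auto
  qed
  have "(\<lambda>n. q ^ n * l2norm M f) \<longlonglongrightarrow> 0"
    using tendsto_mult_left_zero[OF LIMSEQ_power_zero[of q]] q by simp
  then have "eventually (\<lambda>n. q ^ n * l2norm M f < \<epsilon> / 2) sequentially"
    using \<epsilon> by (intro order_tendstoD(2)) auto
  then obtain n where n: "q ^ n * l2norm M f < \<epsilon> / 2" by (auto simp: eventually_sequentially)
  obtain F c where F: "finite F" "F \<subseteq> K"
      "l2norm M (\<lambda>x. f x - (\<Sum>k\<in>F. c k * e k x)) \<le> q ^ n * l2norm M f + \<epsilon> / 4"
    using it[of "\<epsilon> / 4" n] \<epsilon> by auto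
  then have "l2norm M (\<lambda>x. f x - (\<Sum>k\<in>F. c k * e k x)) < \<epsilon>"
    using n \<epsilon> by linarith
  then show ?thesis using F(1,2) by (intro exI[of _ F] exI[of _ c]) simp
qed

text \<open>
  The Paley--Wiener criterion. By the triangle inequality the estimates hold with the constants
  \<open>(1 - q)\<^sup>2\<close> and \<open>(1 + q)\<^sup>2\<close>. For density, expand \<open>f\<close> in the orthonormal
  system and replace each \<open>e k\<close> by \<open>e' k\<close>: this costs at most \<open>q\<close> times the norm of \<open>f\<close>.
\<close>

lemma riesz_basis_perturbation:
  fixes e e' :: "'i \<Rightarrow> 'a \<Rightarrow> complex"
  assumes e: "\<And>k. k \<in> K \<Longrightarrow> e k \<in> sqint M" and e': "\<And>k. k \<in> K \<Longrightarrow> e' k \<in> sqint M"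
    and parseval: "\<And>F c. finite F \<Longrightarrow> F \<subseteq> K \<Longrightarrow>
      (l2norm M (\<lambda>x. \<Sum>k\<in>F. c k * e k x))\<^sup>2 = (\<Sum>k\<in>F. (norm (c k))\<^sup>2)"
    and dense: "\<And>f \<epsilon>. f \<in> sqint M \<Longrightarrow> \<epsilon> > 0 \<Longrightarrow> \<exists>F c. finite F \<and> F \<subseteq> K \<and>
        l2norm M (\<lambda>x. f x - (\<Sum>k\<in>F. c k * e k x)) < \<epsilon>"
    and q: "0 \<le> q" "q < 1"
    and pert: "\<And>F c. finite F \<Longrightarrow> F \<subseteq> K \<Longrightarrow>
      l2norm M (\<lambda>x. \<Sum>k\<in>F. c k * (e k x - e' k x)) \<le> q * sqrt (\<Sum>k\<in>F. (norm (c k))\<^sup>2)"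
  shows "riesz_basis M e' K"
proof -
  define l where "l F c = (\<lambda>x. \<Sum>k\<in>F. c k * e k x)" for F and c :: "'i \<Rightarrow> complex"
  define l' where "l' F c = (\<lambda>x. \<Sum>k\<in>F. c k * e' k x)" for F and c :: "'i \<Rightarrow> complex"
  have ls: "l F c \<in> sqint M" "l' F c \<in> sqint M" if "F \<subseteq> K" for F c
    unfolding l_def l'_def using that e e' by (auto intro!: sqint_sum sqint_mult_left)
  have ln: "l2norm M (l F c) = sqrt (\<Sum>k\<in>F. (norm (c k))\<^sup>2)" if "finite F" "F \<subseteq> K" for F c
  proof -
    have "sqrt ((l2norm M (l F c))\<^sup>2) = l2norm M (l F c)" by simp
    then show ?thesis using parseval[OF that, of c] unfolding l_def by simp
  qed
  have d: "l2norm M (\<lambda>x. l F c x - l' F c x) \<le> q * l2norm M (l F c)" if "finite F" "F \<subseteq> K" for F c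
    using pert[OF that, of c] unfolding ln[OF that] by (simp add: l_def l'_def right_diff_distrib sum_subtractf)
  have lower: "(1 - q) * l2norm M (l F c) \<le> l2norm M (l' F c)" if F: "finite F" "F \<subseteq> K" for F c
    using l2norm_triangle[OF sqint_diff[OF ls(1)[OF F(2), of c] ls(2)[OF F(2), of c]] ls(2)[OF F(2), of c]] d[OF F, of c]
    by (simp add: algebra_simps)
  have upper: "l2norm M (l' F c) \<le> (1 + q) * l2norm M (l F c)" if F: "finite F" "F \<subseteq> K" for F c
    using l2norm_triangle_diff[OF ls(1)[OF F(2), of c] sqint_diff[OF ls(1)[OF F(2), of c] ls(2)[OF F(2), of c]]] d[OF F, of c]
    by (simp add: algebra_simps)
  have lp: "(\<Sum>k\<in>F. (norm (c k))\<^sup>2) = (l2norm M (l F c))\<^sup>2" if "finite F" "F \<subseteq> K" for F c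
    unfolding l_def by (rule parseval[OF that, symmetric])
  show ?thesis
  proof (rule riesz_basisI)
    show "e' k \<in> sqint M" if "k \<in> K" for k by (rule e'[OF that])
    show "(1 - q)\<^sup>2 > 0" using q by simp
    show "(1 - q)\<^sup>2 * (\<Sum>k\<in>F. (norm (c k))\<^sup>2) \<le> (l2norm M (\<lambda>x. \<Sum>k\<in>F. c k * e' k x))\<^sup>2"
      if F: "finite F" "F \<subseteq> K" for F c
      unfolding lp[OF F] power_mult_distrib[symmetric] l'_def[symmetric]
      using q by (intro power_mono lower[OF F]) auto
    show "(l2norm M (\<lambda>x. \<Sum>k\<in>F. c k * e' k x))\<^sup>2 \<le> (1 + q)\<^sup>2 * (\<Sum>k\<in>F. (norm (c k))\<^sup>2)"
      if F: "finite F" "F \<subseteq> K" for F c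
      unfolding lp[OF F] power_mult_distrib[symmetric] l'_def[symmetric]
      by (intro power_mono upper[OF F]) auto
    fix f and \<epsilon> :: real assume f: "f \<in> sqint M" and \<epsilon>: "\<epsilon> > 0"
    show "\<exists>F c. finite F \<and> F \<subseteq> K \<and> l2norm M (\<lambda>x. f x - (\<Sum>k\<in>F. c k * e' k x)) < \<epsilon>"
    proof (rule dense_by_contraction[OF e' q _ f \<epsilon>])
      fix h and \<epsilon> :: real assume h: "h \<in> sqint M" and \<epsilon>: "\<epsilon> > 0"
      then have "\<epsilon> / 2 > 0" by simp
      from dense[OF h this] obtain F c where F: "finite F" "F \<subseteq> K" "l2norm M (\<lambda>x. h x - l F c x) < \<epsilon> / 2"
        unfolding l_def by meson
      have hl: "(\<lambda>x. h x - l F c x) \<in> sqint M" by (intro sqint_diff h ls F)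
      have "l2norm M (l F c) \<le> l2norm M h + \<epsilon> / 2"
        using l2norm_triangle_diff[OF h hl] F(3) by simp
      then have "q * l2norm M (l F c) \<le> q * (l2norm M h + \<epsilon> / 2)"
        using q(1) by (rule mult_left_mono)
      moreover have "q * (\<epsilon> / 2) \<le> \<epsilon> / 2" using q \<epsilon> by (simp add: mult_left_le_one_le)
      moreover have "l2norm M (\<lambda>x. h x - l' F c x)
          \<le> l2norm M (\<lambda>x. h x - l F c x) + l2norm M (\<lambda>x. l F c x - l' F c x)"
        by (intro l2norm_triangle_mid h ls F)
      ultimately have "l2norm M (\<lambda>x. h x - l' F c x) \<le> q * l2norm M h + \<epsilon>"
        using d[OF F(1,2), of c] F(3) unfolding distrib_left by linarith
      then show "\<exists>F c. finite F \<and> F \<subseteq> K \<and> l2norm M (\<lambda>x. h x - (\<Sum>k\<in>F. c k * e' k x)) \<le> q * l2norm M h + \<epsilon>"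
        unfolding l'_def using F(1,2) by blast
    qed
  qed
qed

section \<open>Complementary subsets of an orthogonal basis\<close>

lemma l2inner_lincomb:
  assumes e: "\<And>k. k \<in> K \<Longrightarrow> e k \<in> sqint M"
    and o: "\<And>j k. j \<in> K \<Longrightarrow> k \<in> K \<Longrightarrow> l2inner M (e j) (e k) = (if j = k then of_real \<kappa> else 0)"
    and F: "finite F" "F \<subseteq> K" and G: "finite G" "G \<subseteq> K"
  shows "l2inner M (\<lambda>x. \<Sum>k\<in>F. c k * e k x) (\<lambda>x. \<Sum>k\<in>G. d k * e k x)
    = of_real \<kappa> * (\<Sum>k\<in>F \<inter> G. c k * cnj (d k))"
proof -
  have eF: "e k \<in> sqint M" if "k \<in> F" for k using F that e by auto
  have eG: "e k \<in> sqint M" if "k \<in> G" for k using G that e by auto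
  have "l2inner M (\<lambda>x. \<Sum>k\<in>F. c k * e k x) (\<lambda>x. \<Sum>k\<in>G. d k * e k x)
      = (\<Sum>j\<in>F. \<Sum>k\<in>G. c j * (cnj (d k) * l2inner M (e j) (e k)))"
    by (simp add: l2inner_sum_left l2inner_sum_right sqint_sum sqint_mult_left eF eG
        l2inner_mult_left l2inner_mult_right)
      (simp add: sum_distrib_left)
  also have "\<dots> = (\<Sum>j\<in>F. \<Sum>k\<in>G. if j = k then c j * (cnj (d k) * of_real \<kappa>) else 0)"
    using F G by (intro sum.cong refl) (auto simp: o subset_iff)
  also have "\<dots> = (\<Sum>j\<in>F. if j \<in> G then c j * (cnj (d j) * of_real \<kappa>) else 0)"
    using G(1) by (simp add: sum.delta)
  also have "\<dots> = (\<Sum>j\<in>F \<inter> G. c j * (cnj (d j) * of_real \<kappa>))"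
    using F(1) by (simp add: sum.inter_restrict)
  also have "\<dots> = of_real \<kappa> * (\<Sum>k\<in>F \<inter> G. c k * cnj (d k))"
    by (simp add: sum_distrib_left mult_ac)
  finally show ?thesis .
qed

lemma l2norm_lincomb_orthogonal:
  assumes "\<And>k. k \<in> K \<Longrightarrow> e k \<in> sqint M"
    and "\<And>j k. j \<in> K \<Longrightarrow> k \<in> K \<Longrightarrow> l2inner M (e j) (e k) = (if j = k then of_real \<kappa> else 0)"
    and "finite F" "F \<subseteq> K"
  shows "(l2norm M (\<lambda>x. \<Sum>k\<in>F. c k * e k x))\<^sup>2 = \<kappa> * (\<Sum>k\<in>F. (norm (c k))\<^sup>2)"
proof -
  have "complex_of_real ((l2norm M (\<lambda>x. \<Sum>k\<in>F. c k * e k x))\<^sup>2) = of_real \<kappa> * (\<Sum>k\<in>F. c k * cnj (c k))"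
    unfolding l2inner_self[symmetric] using l2inner_lincomb[OF assms assms(3,4), of c c] by simp
  also have "\<dots> = of_real (\<kappa> * (\<Sum>k\<in>F. (norm (c k))\<^sup>2))"
    unfolding of_real_mult of_real_sum complex_norm_square ..
  finally show ?thesis by (simp only: of_real_eq_iff)
qed

lemma sqint_restrict_space:
  assumes "f \<in> sqint M" "S \<in> sets M"
  shows "f \<in> sqint (restrict_space M S)"
  using assms unfolding sqint_def
  using integrable_mult_indicator[of S M "\<lambda>x. (norm (f x))\<^sup>2"]
  by (auto intro: measurable_restrict_space1 simp: integrable_restrict_space sets.Int_space_eq2)

lemma l2inner_split:
  assumes f: "f \<in> sqint M" and g: "g \<in> sqint M" and S: "S \<in> sets M"
  shows "l2inner M f g = l2inner (restrict_space M S) f g + l2inner (restrict_space M (space M - S)) f g"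
proof -
  have I: "integrable M (\<lambda>x. f x * cnj (g x))" by (rule l2inner_integrable[OF f g])
  have S': "space M - S \<in> sets M" using S by auto
  have "l2inner (restrict_space M S) f g + l2inner (restrict_space M (space M - S)) f g
     = (\<integral>x. indicator S x *\<^sub>R (f x * cnj (g x)) \<partial>M) + (\<integral>x. indicator (space M - S) x *\<^sub>R (f x * cnj (g x)) \<partial>M)"
    unfolding l2inner_def using S S' by (simp add: integral_restrict_space sets.Int_space_eq2)
  also have "\<dots> = (\<integral>x. indicator S x *\<^sub>R (f x * cnj (g x)) + indicator (space M - S) x *\<^sub>R (f x * cnj (g x)) \<partial>M)"
    by (intro Bochner_Integration.integral_add[symmetric] integrable_mult_indicator S S' I)
  also have "\<dots> = l2inner M f g"
    unfolding l2inner_def by (rule Bochner_Integration.integral_cong) (auto simp: indicator_def)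
  finally show ?thesis by simp
qed

lemma l2norm_split:
  assumes f: "f \<in> sqint M" and S: "S \<in> sets M"
  shows "(l2norm M f)\<^sup>2 = (l2norm (restrict_space M S) f)\<^sup>2 + (l2norm (restrict_space M (space M - S)) f)\<^sup>2"
  using l2inner_split[OF f f S] unfolding l2inner_self by (simp only: of_real_add[symmetric] of_real_eq_iff)

text \<open>
  Write \<open>\<parallel>\<cdot>\<parallel>\<^sub>1\<close> and \<open>\<parallel>\<cdot>\<parallel>\<^sub>2\<close> for the norms over \<open>S\<close> and over its complement, and
  \<open>\<parallel>\<cdot>\<parallel>\<close> for the norm over the whole space.

  Lower estimate: let \<open>f\<close> be a combination of members of \<open>\<Lambda>\<close>. On the complement of \<open>S\<close> it is
  nearly equal to a combination \<open>g\<close> of the other members, and \<open>\<parallel>g\<parallel>\<close> is controlled by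
  \<open>\<parallel>g\<parallel>\<^sub>2\<close>. As \<open>f\<close> and \<open>g\<close> are orthogonal over the whole space, the inner product over the
  complement, which is nearly \<open>\<parallel>f\<parallel>\<^sub>2\<^sup>2\<close>, equals minus the one over \<open>S\<close>. Hence
  \<open>\<parallel>f\<parallel>\<^sub>2\<close> is bounded by a multiple of \<open>\<parallel>f\<parallel>\<^sub>1\<close>.

  Density: extend \<open>h\<close> on \<open>S\<close> by zero and approximate it by \<open>p + g\<close> with \<open>p\<close> in the span of \<open>\<Lambda>\<close>
  and \<open>g\<close> in the span of the others. Over \<open>S\<close> the error of \<open>p\<close> is about \<open>\<parallel>g\<parallel>\<^sub>1\<close>, and
  since \<open>\<parallel>g\<parallel>\<^sub>2\<close> is at least a fixed part of \<open>\<parallel>g\<parallel>\<close>, one gets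
  \<open>\<parallel>g\<parallel>\<^sub>1 \<le> q \<parallel>g\<parallel>\<close> with \<open>q < 1\<close>, where \<open>\<parallel>g\<parallel>\<close> is at most about
  \<open>\<parallel>h\<parallel>\<^sub>1\<close>. This is the contraction required by \<open>dense_by_contraction\<close>.
\<close>

theorem riesz_basis_complement:
  assumes e: "\<And>k. k \<in> K \<Longrightarrow> e k \<in> sqint M"
    and o: "\<And>j k. j \<in> K \<Longrightarrow> k \<in> K \<Longrightarrow> l2inner M (e j) (e k) = (if j = k then of_real \<kappa> else 0)"
    and \<kappa>: "\<kappa> > 0"
    and dense: "\<And>f \<epsilon>. f \<in> sqint M \<Longrightarrow> \<epsilon> > 0 \<Longrightarrow> \<exists>F c. finite F \<and> F \<subseteq> K \<and>
        l2norm M (\<lambda>x. f x - (\<Sum>k\<in>F. c k * e k x)) < \<epsilon>"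
    and S: "S \<in> sets M" and \<Lambda>: "\<Lambda> \<subseteq> K"
    and R: "riesz_basis (restrict_space M (space M - S)) e (K - \<Lambda>)"
  shows "riesz_basis (restrict_space M S) e \<Lambda>"
proof -
  define M1 where "M1 = restrict_space M S"
  define M2 where "M2 = restrict_space M (space M - S)"
  define lc where "lc F c = (\<lambda>x. \<Sum>k\<in>F. c k * e k x)" for F and c :: "_ \<Rightarrow> complex"
  have lc: "lc F c \<in> sqint M" if "F \<subseteq> K" for F c
    unfolding lc_def using that e by (intro sqint_sum sqint_mult_left) auto
  have S': "space M - S \<in> sets M" using S by auto
  have r1: "f \<in> sqint M1" and r2: "f \<in> sqint M2" if "f \<in> sqint M" for f
    using sqint_restrict_space[OF that S] sqint_restrict_space[OF that S'] by (auto simp: M1_def M2_def)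
  have split: "(l2norm M f)\<^sup>2 = (l2norm M1 f)\<^sup>2 + (l2norm M2 f)\<^sup>2" if "f \<in> sqint M" for f
    unfolding M1_def M2_def by (rule l2norm_split[OF that S])
  have le1: "l2norm M1 f \<le> l2norm M f" and le2: "l2norm M2 f \<le> l2norm M f" if "f \<in> sqint M" for f
    by (rule power2_le_imp_le, simp add: split[OF that], simp)+
  have parseval: "(l2norm M (lc F c))\<^sup>2 = \<kappa> * (\<Sum>k\<in>F. (norm (c k))\<^sup>2)" if "finite F" "F \<subseteq> K" for F c
    unfolding lc_def by (rule l2norm_lincomb_orthogonal[OF e o that])
  obtain A where A: "A > 0" and A2: "\<And>F c. finite F \<Longrightarrow> F \<subseteq> K - \<Lambda> \<Longrightarrow>
      A * (\<Sum>k\<in>F. (norm (c k))\<^sup>2) \<le> (l2norm M2 (lc F c))\<^sup>2"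
    using riesz_basisD(2)[OF R] unfolding M2_def lc_def by auto
  define Q where "Q = \<kappa> / A"
  have Q: "Q > 0" using A \<kappa> by (simp add: Q_def)
  have gQ: "(l2norm M (lc G d))\<^sup>2 \<le> Q * (l2norm M2 (lc G d))\<^sup>2" if "finite G" "G \<subseteq> K - \<Lambda>" for G d
  proof -
    have "G \<subseteq> K" using that by auto
    then show ?thesis
      using A2[OF that, of d] A \<kappa> by (simp add: parseval[OF that(1)] Q_def field_simps)
  qed
  have lower: "(l2norm M (lc F c))\<^sup>2 \<le> (1 + Q) * (l2norm M1 (lc F c))\<^sup>2" if F: "finite F" "F \<subseteq> \<Lambda>" for F c
  proof -
    define f where "f = lc F c"
    have FK: "F \<subseteq> K" using F \<Lambda> by auto
    have f: "f \<in> sqint M" unfolding f_def by (rule lc[OF FK])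
    have "(l2norm M2 f)\<^sup>2 \<le> l2norm M1 f * (sqrt Q * l2norm M2 f)
        + (l2norm M2 f + l2norm M1 f * sqrt Q) * \<epsilon>" if \<epsilon>: "\<epsilon> > 0" for \<epsilon>
    proof -
      obtain G d where G: "finite G" "G \<subseteq> K - \<Lambda>" "l2norm M2 (\<lambda>x. f x - lc G d x) < \<epsilon>"
        using riesz_basisD(4)[OF R[folded M2_def] r2[OF f] \<epsilon>] unfolding lc_def by auto
      define g where "g = lc G d"
      have GK: "G \<subseteq> K" using G by auto
      have g: "g \<in> sqint M" unfolding g_def by (rule lc[OF GK])
      have FG: "F \<inter> G = {}" using F G by auto
      have "l2inner M f g = of_real \<kappa> * (\<Sum>k\<in>F \<inter> G. c k * cnj (d k))"
        unfolding f_def g_def lc_def by (rule l2inner_lincomb[OF e o F(1) FK G(1) GK])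
      then have orth: "l2inner M1 f g = - l2inner M2 f g"
        using l2inner_split[OF f g S] by (simp add: FG M1_def M2_def add_eq_0_iff2 add.commute)
      have fg: "(\<lambda>x. f x - g x) \<in> sqint M" using f g by auto
      have "l2inner M2 f f = l2inner M2 f (\<lambda>x. (f x - g x) + g x)" by simp
      also have "\<dots> = l2inner M2 f (\<lambda>x. f x - g x) + l2inner M2 f g"
        by (intro l2inner_add_right r2 f g fg)
      finally have "l2inner M2 f f = l2inner M2 f (\<lambda>x. f x - g x) - l2inner M1 f g"
        by (simp add: orth)
      moreover have "norm (l2inner M2 f f) = (l2norm M2 f)\<^sup>2" by (simp add: l2inner_self norm_power)
      ultimately have n1: "(l2norm M2 f)\<^sup>2 \<le> norm (l2inner M2 f (\<lambda>x. f x - g x)) + norm (l2inner M1 f g)"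
        using norm_triangle_ineq4[of "l2inner M2 f (\<lambda>x. f x - g x)" "l2inner M1 f g"] by simp
      have n2: "norm (l2inner M2 f (\<lambda>x. f x - g x)) \<le> l2norm M2 f * l2norm M2 (\<lambda>x. f x - g x)"
        by (rule l2norm_cauchy_schwarz[OF r2[OF f] r2[OF fg]])
      have n3: "l2norm M2 f * l2norm M2 (\<lambda>x. f x - g x) \<le> l2norm M2 f * \<epsilon>"
        using G(3) by (intro mult_left_mono) (auto simp: g_def)
      have n4: "norm (l2inner M1 f g) \<le> l2norm M1 f * l2norm M1 g"
        by (rule l2norm_cauchy_schwarz[OF r1[OF f] r1[OF g]])
      have "l2norm M g \<le> sqrt Q * l2norm M2 g"
        using gQ[OF G(1,2), of d] Q unfolding g_def
        by - (rule power2_le_imp_le, auto simp: power_mult_distrib)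
      moreover have "l2norm M2 g \<le> l2norm M2 f + \<epsilon>"
        using l2norm_triangle_diff[OF r2[OF f] r2[OF fg]] G(3) by (simp add: g_def)
      then have "sqrt Q * l2norm M2 g \<le> sqrt Q * (l2norm M2 f + \<epsilon>)"
        using Q by (intro mult_left_mono) auto
      ultimately have "l2norm M1 g \<le> sqrt Q * (l2norm M2 f + \<epsilon>)"
        using le1[OF g] by linarith
      then have "l2norm M1 f * l2norm M1 g \<le> l2norm M1 f * (sqrt Q * (l2norm M2 f + \<epsilon>))"
        by (rule mult_left_mono) simp
      then show ?thesis using n1 n2 n3 n4 by (simp add: algebra_simps)
    qed
    then have "(l2norm M2 f)\<^sup>2 \<le> l2norm M1 f * (sqrt Q * l2norm M2 f)"
      by (rule le_if_le_add_mult_eps)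
    then have "l2norm M2 f * l2norm M2 f \<le> l2norm M2 f * (sqrt Q * l2norm M1 f)"
      by (simp add: power2_eq_square mult_ac)
    then have "l2norm M2 f \<le> sqrt Q * l2norm M1 f"
      using Q by (cases "l2norm M2 f = 0") (auto simp: mult_le_cancel_left not_le order.strict_iff_order)
    then have "(l2norm M2 f)\<^sup>2 \<le> (sqrt Q * l2norm M1 f)\<^sup>2"
      by (intro power_mono) auto
    then show ?thesis
      using split[OF f] Q unfolding f_def[symmetric] by (simp add: power_mult_distrib algebra_simps)
  qed
  show ?thesis unfolding M1_def[symmetric]
  proof (rule riesz_basisI)
    show e1: "e k \<in> sqint M1" if "k \<in> \<Lambda>" for k using that \<Lambda> e r1 by auto
    show "\<kappa> / (1 + Q) > 0" using \<kappa> Q by simp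
    show "\<kappa> / (1 + Q) * (\<Sum>k\<in>F. (norm (c k))\<^sup>2) \<le> (l2norm M1 (\<lambda>x. \<Sum>k\<in>F. c k * e k x))\<^sup>2"
      if F: "finite F" "F \<subseteq> \<Lambda>" for F c
    proof -
      have FK: "F \<subseteq> K" using F \<Lambda> by auto
      show ?thesis using lower[OF F, of c] Q parseval[OF F(1) FK, of c]
        unfolding lc_def[symmetric] by (simp add: field_simps)
    qed
    show "(l2norm M1 (\<lambda>x. \<Sum>k\<in>F. c k * e k x))\<^sup>2 \<le> \<kappa> * (\<Sum>k\<in>F. (norm (c k))\<^sup>2)"
      if F: "finite F" "F \<subseteq> \<Lambda>" for F c
    proof -
      have FK: "F \<subseteq> K" using F \<Lambda> by auto
      show ?thesis using power_mono[OF le1[OF lc[OF FK, of c]], of 2] parseval[OF F(1) FK, of c]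
        unfolding lc_def[symmetric] by simp
    qed
    define q where "q = sqrt (max 0 (1 - A / \<kappa>))"
    have q: "0 \<le> q" "q < 1" using A \<kappa> by (auto simp: q_def real_sqrt_lt_1_iff)
    fix f and \<epsilon> :: real assume f: "f \<in> sqint M1" and \<epsilon>: "\<epsilon> > 0"
    show "\<exists>F c. finite F \<and> F \<subseteq> \<Lambda> \<and> l2norm M1 (\<lambda>x. f x - (\<Sum>k\<in>F. c k * e k x)) < \<epsilon>"
    proof (rule dense_by_contraction[OF e1 q _ f \<epsilon>])
      fix h and \<epsilon> :: real assume h: "h \<in> sqint M1" and \<epsilon>: "\<epsilon> > 0"
      define h' where "h' x = indicator S x *\<^sub>R h x" for x
      have nh: "(norm (h' x))\<^sup>2 = indicator S x *\<^sub>R (norm (h x))\<^sup>2" for x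
        by (simp add: h'_def indicator_def)
      have SS: "S \<inter> space M \<in> sets M" using S by auto
      have "h' \<in> borel_measurable M"
        using sqint_measurable[OF h] unfolding M1_def borel_measurable_restrict_space_iff[OF SS] h'_def .
      moreover have "integrable M (\<lambda>x. (norm (h' x))\<^sup>2)"
        using h unfolding nh sqint_def M1_def by (simp add: integrable_restrict_space[OF SS])
      ultimately have h': "h' \<in> sqint M" by (simp add: sqint_def)
      have nh': "l2norm M h' = l2norm M1 h"
        unfolding l2norm_def nh M1_def by (simp add: integral_restrict_space[OF SS])
      have hh': "l2norm M1 (\<lambda>x. h x - g x) = l2norm M1 (\<lambda>x. h' x - g x)" for g
        unfolding l2norm_def M1_def
        by (intro arg_cong[where f = sqrt] Bochner_Integration.integral_cong)
          (auto simp: h'_def space_restrict_space)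
      have "\<epsilon> / 2 > 0" using \<epsilon> by simp
      from dense[OF h' this] obtain F c
        where F: "finite F" "F \<subseteq> K" "l2norm M (\<lambda>x. h' x - lc F c x) < \<epsilon> / 2"
        unfolding lc_def by meson
      define p where "p = lc (F \<inter> \<Lambda>) c"
      define g where "g = lc (F - \<Lambda>) c"
      have pg: "lc F c x = p x + g x" for x
        unfolding p_def g_def lc_def by (rule sum.Int_Diff[OF F(1)])
      have FK: "F \<inter> \<Lambda> \<subseteq> K" "F - \<Lambda> \<subseteq> K" "F - \<Lambda> \<subseteq> K - \<Lambda>" using F(2) by auto
      have pgs: "p \<in> sqint M" "g \<in> sqint M" unfolding p_def g_def by (intro lc FK)+
      have g1: "l2norm M1 g \<le> q * l2norm M g"
      proof (rule power2_le_imp_le)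
        have fin: "finite (F - \<Lambda>)" using F(1) by simp
        have "A / \<kappa> * (l2norm M g)\<^sup>2 \<le> (l2norm M2 g)\<^sup>2"
          using A2[OF fin FK(3), of c] parseval[OF fin FK(2), of c] \<kappa>
          unfolding g_def by (simp add: field_simps)
        then have "(l2norm M1 g)\<^sup>2 \<le> (1 - A / \<kappa>) * (l2norm M g)\<^sup>2"
          using split[OF pgs(2)] by (simp add: algebra_simps)
        also have "\<dots> \<le> max 0 (1 - A / \<kappa>) * (l2norm M g)\<^sup>2"
          by (intro mult_right_mono) auto
        finally show "(l2norm M1 g)\<^sup>2 \<le> (q * l2norm M g)\<^sup>2"
          by (simp add: q_def power_mult_distrib)
      qed (use q in simp)
      have g2: "l2norm M g \<le> l2norm M (lc F c)"
      proof (rule power2_le_imp_le)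
        have "(\<Sum>k\<in>F - \<Lambda>. (norm (c k))\<^sup>2) \<le> (\<Sum>k\<in>F. (norm (c k))\<^sup>2)"
          using F(1) by (intro sum_mono2) auto
        then show "(l2norm M g)\<^sup>2 \<le> (l2norm M (lc F c))\<^sup>2"
          using \<kappa> parseval[OF F(1,2), of c] parseval[OF finite_Diff[OF F(1)] FK(2), of c]
          unfolding g_def by simp
      qed simp
      have hl: "(\<lambda>x. h' x - lc F c x) \<in> sqint M" using h' lc[OF F(2)] by auto
      have g3: "l2norm M (lc F c) \<le> l2norm M h' + \<epsilon> / 2"
        using l2norm_triangle_diff[OF h' hl] F(3) by simp
      have n1: "l2norm M1 (\<lambda>x. h' x - p x) \<le> l2norm M1 (\<lambda>x. h' x - lc F c x) + l2norm M1 g"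
        using l2norm_triangle[OF r1[OF hl] r1[OF pgs(2)]] by (simp add: pg)
      have n2: "l2norm M1 (\<lambda>x. h' x - lc F c x) \<le> \<epsilon> / 2"
        using le1[OF hl] F(3) by linarith
      have n3: "q * l2norm M g \<le> q * (l2norm M1 h + \<epsilon> / 2)"
        using g2 g3 nh' q(1) by (intro mult_left_mono) auto
      have n4: "q * (\<epsilon> / 2) \<le> \<epsilon> / 2"
        using q \<epsilon> by (simp add: mult_left_le_one_le)
      have "l2norm M1 (\<lambda>x. h x - p x) \<le> q * l2norm M1 h + \<epsilon>"
        unfolding hh' using n1 n2 n3 n4 g1 unfolding distrib_left by linarith
      then show "\<exists>F c. finite F \<and> F \<subseteq> \<Lambda> \<and>
          l2norm M1 (\<lambda>x. h x - (\<Sum>k\<in>F. c k * e k x)) \<le> q * l2norm M1 h + \<epsilon>"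
        unfolding p_def lc_def using F(1) by blast
    qed
  qed
qed

section \<open>The Fourier basis of the unit interval\<close>

abbreviation unit_measure :: "real measure" where
  "unit_measure \<equiv> lebesgue_on {0..<1}"

lemma finite_measure_unit: "finite_measure unit_measure"
  by (rule finite_measure_lebesgue_on) (simp add: fmeasurable_def)

lemma measure_unit: "measure unit_measure {0..<1} = 1"
  by (simp add: measure_restrict_space)

lemma l2norm_unit_le:
  assumes "f \<in> borel_measurable unit_measure" "0 \<le> C" "\<And>x. x \<in> {0..<1} \<Longrightarrow> norm (f x) \<le> C"
  shows "l2norm unit_measure f \<le> C"
proof -
  have "l2norm unit_measure f \<le> C * l2norm unit_measure (\<lambda>_. 1)"
    using assms sqint_bounded[OF finite_measure_unit, of "\<lambda>_. 1" 1]
    by (intro l2norm_le_mult) (auto simp: space_restrict_space)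
  also have "l2norm unit_measure (\<lambda>_. 1) = 1"
    using measure_unit by (simp add: l2norm_def space_restrict_space)
  finally show ?thesis by simp
qed

lemma continuous_measurable_lebesgue_on:
  fixes f :: "real \<Rightarrow> 'b::euclidean_space"
  assumes "continuous_on UNIV f" shows "f \<in> borel_measurable (lebesgue_on S)"
proof -
  have "f \<in> borel_measurable lborel"
    using borel_measurable_continuous_onI[OF assms] by simp
  then have "f \<in> borel_measurable lebesgue" by (rule measurable_completion)
  then show ?thesis by (rule measurable_restrict_space1)
qed

lemma sqint_unit_continuous:
  assumes f: "continuous_on UNIV f" shows "f \<in> sqint unit_measure"
proof -
  have "bounded (f ` {0..1})"
    by (intro compact_imp_bounded compact_continuous_image continuous_on_subset[OF f]) auto
  then obtain C where "\<And>x. x \<in> {0..1} \<Longrightarrow> norm (f x) \<le> C" unfolding bounded_iff by blast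
  then show ?thesis
    by (intro sqint_bounded[OF finite_measure_unit continuous_measurable_lebesgue_on[OF f], of C])
      (auto simp: space_restrict_space)
qed

lemma integral_unit_measure:
  fixes f :: "real \<Rightarrow> 'b::euclidean_space"
  assumes f: "continuous_on UNIV f" and I: "(f has_integral I) {0..1}"
  shows "(\<integral>x. f x \<partial>unit_measure) = I"
proof -
  have "bounded (f ` {0..1})"
    by (intro compact_imp_bounded compact_continuous_image continuous_on_subset[OF f]) auto
  then obtain C where C: "norm (f x) \<le> C" if "x \<in> {0..1}" for x
    unfolding bounded_iff by blast
  have int: "integrable unit_measure f"
  proof (rule finite_measure.integrable_const_bound[OF finite_measure_unit])
    show "AE x in unit_measure. norm (f x) \<le> C"
      by (rule AE_I2) (use C in \<open>auto simp: space_restrict_space\<close>)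
  qed (rule continuous_measurable_lebesgue_on[OF f])
  have "(f has_integral (\<integral>x. f x \<partial>unit_measure)) {0..<1}"
    by (rule has_integral_integral_lebesgue_on[OF int]) simp
  moreover have "(f has_integral I) {0..<1}"
    using I by (rule iffD1[OF has_integral_spike_set_eq, rotated -1]; intro negligible_subset[OF negligible_sing[of 1]]) auto
  ultimately show ?thesis by (rule has_integral_unique)
qed

lemma has_integral_exp_unit:
  fixes c :: complex
  assumes "c \<noteq> 0"
  shows "((\<lambda>x. exp (c * of_real x)) has_integral (exp c - 1) / c) {0..1}"
proof -
  have "((\<lambda>x. exp (c * of_real x)) has_integral (exp (c * of_real 1) / c - exp (c * of_real 0) / c)) {0..1}"
  proof (rule fundamental_theorem_of_calculus)
    fix x :: real
    have "((\<lambda>z. exp (c * z) / c) has_field_derivative exp (c * of_real x)) (at (of_real x))"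
      using assms by (auto intro!: derivative_eq_intros)
    then have "((\<lambda>x. exp (c * of_real x) / c) has_vector_derivative exp (c * of_real x)) (at x)"
      by (rule has_vector_derivative_real_field)
    then show "((\<lambda>x. exp (c * of_real x) / c) has_vector_derivative exp (c * of_real x)) (at x within {0..1})"
      by (rule has_vector_derivative_at_within)
  qed simp
  then show ?thesis by (simp add: diff_divide_distrib)
qed

lemma expfun_add: "expfun (a + b) x = expfun a x * expfun b x"
  by (simp add: expfun_def distrib_left distrib_right flip: exp_add)

lemma expfun_0 [simp]: "expfun 0 x = 1"
  by (simp add: expfun_def)

lemma cnj_expfun: "cnj (expfun a x) = expfun (- a) x"
  by (simp add: expfun_def exp_cnj)

lemma norm_expfun [simp]: "norm (expfun a x) = 1"
proof -
  have "expfun a x = cis (2 * pi * (a * x))"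
    by (simp add: expfun_def cis_conv_exp mult_ac)
  then show ?thesis by simp
qed

lemma continuous_on_expfun [continuous_intros]: "continuous_on S (expfun a)"
  unfolding expfun_def by (intro continuous_intros)

lemma expfun_of_int_1: "expfun (of_int k) 1 = 1"
  using exp_integer_2pi[of "of_int k"] by (simp add: expfun_def mult_ac)

lemma expfun_measurable [measurable]: "expfun a \<in> borel_measurable (lebesgue_on S)"
  by (rule continuous_measurable_lebesgue_on) (rule continuous_on_expfun)

lemma expfun_sqint: "expfun a \<in> sqint unit_measure"
  by (rule sqint_bounded[OF finite_measure_unit, of _ 1]) auto

lemma l2inner_expfun_unit:
  "l2inner unit_measure (expfun (of_int j)) (expfun (of_int k)) = (if j = k then of_real 1 else 0)"
proof -
  define c where "c = 2 * of_real pi * \<i> * complex_of_int (j - k)"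
  have eq: "expfun (of_int j) x * cnj (expfun (of_int k) x) = exp (c * of_real x)" for x
  proof -
    have "expfun (of_int j) x * cnj (expfun (of_int k) x) = expfun (of_int j + - of_int k) x"
      by (simp only: expfun_add cnj_expfun)
    then show ?thesis by (simp add: expfun_def c_def mult_ac)
  qed
  have "((\<lambda>x. exp (c * of_real x)) has_integral (if j = k then of_real 1 else 0)) {0..1}"
  proof (cases "j = k")
    case True
    then show ?thesis using has_integral_const_real[of "1::complex" 0 1] by (simp add: c_def)
  next
    case False
    then have "c \<noteq> 0" by (simp add: c_def)
    moreover have "exp c = 1"
      using exp_integer_2pi[of "of_int (j - k)"] by (simp add: c_def mult_ac)
    ultimately show ?thesis using has_integral_exp_unit[of c] False by simp
  qed
  then show ?thesis unfolding l2inner_def eq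
    by (intro integral_unit_measure) (auto intro!: continuous_intros)
qed

definition trig_polys :: "(real \<Rightarrow> complex) set" where
  "trig_polys = {f. \<exists>F c. finite F \<and> f = (\<lambda>x. \<Sum>k\<in>F. c k * expfun (of_int k) x)}"

lemma trig_polys_add:
  assumes "f \<in> trig_polys" "g \<in> trig_polys" shows "(\<lambda>x. f x + g x) \<in> trig_polys"
proof -
  obtain F c G d where "finite F" "f = (\<lambda>x. \<Sum>k\<in>F. c k * expfun (of_int k) x)"
    "finite G" "g = (\<lambda>x. \<Sum>k\<in>G. d k * expfun (of_int k) x)"
    using assms unfolding trig_polys_def by blast
  then have "(\<lambda>x. f x + g x) = (\<lambda>x. \<Sum>k\<in>F \<union> G.
      ((if k \<in> F then c k else 0) + (if k \<in> G then d k else 0)) * expfun (of_int k) x)" "finite (F \<union> G)"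
    using lincomb_add[of F G c "\<lambda>k. expfun (of_int k)" _ d] by auto
  then show ?thesis unfolding trig_polys_def mem_Collect_eq
    by (intro exI[of _ "F \<union> G"] exI[of _ "\<lambda>k. (if k \<in> F then c k else 0) + (if k \<in> G then d k else 0)"]) simp
qed

lemma trig_polys_single: "(\<lambda>x. c * expfun (of_int k) x) \<in> trig_polys"
  unfolding trig_polys_def mem_Collect_eq by (intro exI[of _ "{k}"] exI[of _ "\<lambda>_. c"]) simp

lemma trig_polys_const: "(\<lambda>x. c) \<in> trig_polys"
  using trig_polys_single[of c 0] by simp

lemma trig_polys_sum:
  assumes "\<And>i. i \<in> F \<Longrightarrow> f i \<in> trig_polys" shows "(\<lambda>x. \<Sum>i\<in>F. f i x) \<in> trig_polys"
  using assms by (induction F rule: infinite_finite_induct) (auto intro: trig_polys_add trig_polys_const)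

lemma trig_polys_mult:
  assumes "f \<in> trig_polys" "g \<in> trig_polys" shows "(\<lambda>x. f x * g x) \<in> trig_polys"
proof -
  obtain F c G d where fg: "finite F" "f = (\<lambda>x. \<Sum>k\<in>F. c k * expfun (of_int k) x)"
    "finite G" "g = (\<lambda>x. \<Sum>k\<in>G. d k * expfun (of_int k) x)"
    using assms unfolding trig_polys_def by blast
  have "f x * g x = (\<Sum>j\<in>F. \<Sum>k\<in>G. (c j * d k) * expfun (of_int (j + k)) x)" for x
    unfolding fg by (simp add: sum_product expfun_add mult_ac)
  then show ?thesis by (simp only:) (intro trig_polys_sum trig_polys_single)
qed

text \<open>
  On the unit circle a real linear form is a combination of \<open>z\<close> and \<open>cnj z\<close>, that is, of the
  exponentials with frequencies 1 and -1; products of exponentials are exponentials.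
\<close>

lemma real_polynomial_trig:
  assumes "real_polynomial_function p"
  shows "(\<lambda>y. complex_of_real (p (expfun 1 y))) \<in> trig_polys"
  using assms
proof induction
  case (linear f)
  then interpret bounded_linear f .
  have f: "complex_of_real (f z) = (of_real (f 1) / 2 - \<i> * of_real (f \<i>) / 2) * z
      + (of_real (f 1) / 2 + \<i> * of_real (f \<i>) / 2) * cnj z" for z
  proof -
    have "f z = f (Re z *\<^sub>R 1 + Im z *\<^sub>R \<i>)"
      by (rule arg_cong[where f = f]) (simp add: complex_eq_iff)
    also have "\<dots> = Re z * f 1 + Im z * f \<i>" by (simp add: add scaleR)
    finally show ?thesis by (simp add: complex_eq_iff algebra_simps)
  qed
  have "(\<lambda>y. complex_of_real (f (expfun 1 y)))
     = (\<lambda>y. (of_real (f 1) / 2 - \<i> * of_real (f \<i>) / 2) * expfun (of_int 1) y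
      + (of_real (f 1) / 2 + \<i> * of_real (f \<i>) / 2) * expfun (of_int (-1)) y)"
    by (rule ext, subst f) (simp add: cnj_expfun)
  then show ?case by (simp only:) (intro trig_polys_add trig_polys_single)
next
  case (const c) show ?case by (rule trig_polys_const)
next
  case (add f g) then show ?case using trig_polys_add by fastforce
next
  case (mult f g) then show ?case using trig_polys_mult by fastforce
qed

lemma polynomial_trig:
  fixes g :: "complex \<Rightarrow> complex"
  assumes "polynomial_function g" shows "(\<lambda>y. g (expfun 1 y)) \<in> trig_polys"
proof -
  have "real_polynomial_function (Re \<circ> g)" "real_polynomial_function (Im \<circ> g)"
    using assms unfolding polynomial_function_def by (auto intro: bounded_linear_Re bounded_linear_Im)
  then have "(\<lambda>y. of_real ((Re \<circ> g) (expfun 1 y)) + \<i> * of_real ((Im \<circ> g) (expfun 1 y))) \<in> trig_polys"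
    by (intro trig_polys_add trig_polys_mult trig_polys_const real_polynomial_trig)
  then show ?thesis by (simp add: complex_eq[symmetric])
qed

text \<open>
  A continuous function with equal values at 0 and 1 is a continuous function on the unit circle, to
  which the Stone--Weierstrass theorem applies.
\<close>

lemma periodic_uniform_approx:
  fixes \<phi> :: "real \<Rightarrow> complex"
  assumes \<phi>: "continuous_on {0..1} \<phi>" "\<phi> 0 = \<phi> 1" and \<epsilon>: "\<epsilon> > 0"
  shows "\<exists>p\<in>trig_polys. \<forall>x\<in>{0..<1}. norm (\<phi> x - p x) < \<epsilon>"
proof -
  define \<Phi> where "\<Phi> z = \<phi> (Arg2pi z / (2 * pi))" for z
  have ef: "expfun 1 y = exp (\<i> * of_real (2 * pi * y))" for y
    by (simp add: expfun_def mult_ac)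
  have \<Phi>e: "\<Phi> (expfun 1 y) = \<phi> y" if "y \<in> {0..<1}" for y
  proof -
    have "Arg2pi (expfun 1 y) = 2 * pi * y"
      using that by (intro Arg2pi_unique[of 1]) (auto simp: ef)
    then show ?thesis by (simp add: \<Phi>_def)
  qed
  have \<Phi>1: "\<Phi> (expfun 1 1) = \<phi> 1"
    using \<Phi>e[of 0] \<phi>(2) expfun_of_int_1[of 1] by (simp add: expfun_def)
  have \<Phi>e': "\<Phi> (expfun 1 y) = \<phi> y" if "y \<in> {0..1}" for y
    using \<Phi>e[of y] \<Phi>1 that by (cases "y = 1") auto
  have onto: "z \<in> expfun 1 ` {0..1}" if "z \<in> sphere 0 1" for z
  proof
    show "z = expfun 1 (Arg2pi z / (2 * pi))"
      using that Arg2pi_eq[of z] by (simp add: ef)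
    show "Arg2pi z / (2 * pi) \<in> {0..1}"
      using Arg2pi[of z] by (simp add: field_simps)
  qed
  have "continuous_on (sphere 0 1) \<Phi>"
    unfolding continuous_on_closed_vimage[OF closed_sphere]
  proof (intro allI impI)
    \<comment> \<open>the circle carries the quotient topology of the interval\<close>
    fix B :: "complex set" assume B: "closed B"
    have "\<Phi> -` B \<inter> sphere 0 1 = expfun 1 ` (\<phi> -` B \<inter> {0..1})"
      using onto \<Phi>e' by fastforce
    moreover have "closed (\<phi> -` B \<inter> {0..1})"
      using \<phi>(1) B continuous_on_closed_vimage[OF closed_real_atLeastAtMost] by blast
    then have "compact (\<phi> -` B \<inter> {0..1})"
      by (metis Int_commute closed_Int_compact compact_Icc inf.right_idem)
    then have "compact (expfun 1 ` (\<phi> -` B \<inter> {0..1}))"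
      by (intro compact_continuous_image continuous_on_expfun)
    ultimately show "closed (\<Phi> -` B \<inter> sphere 0 1)"
      by (simp add: compact_imp_closed)
  qed
  then obtain g where g: "polynomial_function g" "\<And>z. z \<in> sphere 0 1 \<Longrightarrow> norm (\<Phi> z - g z) < \<epsilon>"
    using Stone_Weierstrass_polynomial_function[OF compact_sphere _ \<epsilon>, of 0 1 \<Phi>] by auto
  then have "norm (\<phi> x - g (expfun 1 x)) < \<epsilon>" if "x \<in> {0..<1}" for x
    using g(2)[of "expfun 1 x"] \<Phi>e[OF that] by simp
  then show ?thesis using polynomial_trig[OF g(1)] by (intro bexI) auto
qed

text \<open>
  The radial retraction onto the disc of radius \<open>R\<close>, used to truncate functions continuously.
\<close>

definition clip :: "real \<Rightarrow> complex \<Rightarrow> complex" where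
  "clip R z = of_real (R / max R (norm z)) * z"

lemma norm_clip: assumes "R > 0" shows "norm (clip R z) \<le> R" "norm (z - clip R z) \<le> norm z"
proof -
  have m: "max R (norm z) > 0" "R / max R (norm z) \<le> 1" "0 \<le> R / max R (norm z)" using assms by auto
  have "norm (clip R z) = R * norm z / max R (norm z)"
    using assms by (simp add: clip_def norm_mult norm_divide)
  also have "\<dots> \<le> R" using assms m by (simp add: field_simps)
  finally show "norm (clip R z) \<le> R" .
  have "z - clip R z = of_real (1 - R / max R (norm z)) * z" by (simp add: clip_def algebra_simps)
  then have "norm (z - clip R z) = (1 - R / max R (norm z)) * norm z"
    using m by (simp only: norm_mult norm_of_real)
  also have "\<dots> \<le> 1 * norm z" using m by (intro mult_right_mono) auto
  finally show "norm (z - clip R z) \<le> norm z" by simp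
qed

lemma clip_id: "norm z \<le> R \<Longrightarrow> R > 0 \<Longrightarrow> clip R z = z"
  by (simp add: clip_def max_def)

lemma continuous_on_clip: assumes "R > 0" shows "continuous_on UNIV (clip R)"
proof -
  have "max R (norm z) \<noteq> 0" for z :: complex using assms by (auto simp: max_def)
  then show ?thesis unfolding clip_def by (intro continuous_intros) auto
qed

lemma l2norm_tendsto_0:
  assumes f: "f \<in> borel_measurable M" and s: "\<And>n::nat. s n \<in> borel_measurable M"
    and lim: "AE x in M. (\<lambda>n. s n x) \<longlonglongrightarrow> f x"
    and w: "w \<in> sqint M" and bnd: "\<And>n. AE x in M. norm (f x - s n x) \<le> norm (w x)"
  shows "(\<lambda>n. l2norm M (\<lambda>x. f x - s n x)) \<longlonglongrightarrow> 0"
proof -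
  have "(\<lambda>n. \<integral>x. (norm (f x - s n x))\<^sup>2 \<partial>M) \<longlonglongrightarrow> (\<integral>x. 0 \<partial>M)"
  proof (rule integral_dominated_convergence[where w = "\<lambda>x. (norm (w x))\<^sup>2"])
    show "(\<lambda>x. (norm (f x - s n x))\<^sup>2) \<in> borel_measurable M" for n using f s[of n] by measurable
    show "integrable M (\<lambda>x. (norm (w x))\<^sup>2)" using w by (simp add: sqint_def)
    show "AE x in M. (\<lambda>n. (norm (f x - s n x))\<^sup>2) \<longlonglongrightarrow> 0"
      using lim
    proof eventually_elim
      case (elim x)
      have "(\<lambda>n. (norm (f x - s n x))\<^sup>2) \<longlonglongrightarrow> (norm (f x - f x))\<^sup>2"
        by (intro tendsto_intros elim)
      then show ?case by simp
    qed
    show "AE x in M. norm ((norm (f x - s n x))\<^sup>2) \<le> (norm (w x))\<^sup>2" for n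
      using bnd[of n] by eventually_elim (simp add: power_mono)
  qed simp
  then have "(\<lambda>n. sqrt (\<integral>x. (norm (f x - s n x))\<^sup>2 \<partial>M)) \<longlonglongrightarrow> sqrt 0"
    by (intro tendsto_real_sqrt) simp
  then show ?thesis by (simp add: l2norm_def)
qed

text \<open>
  Truncate \<open>f\<close> to a bounded function; approximate this almost everywhere by continuous functions,
  clipped to the same bound and multiplied by a cutoff that vanishes at 0 and 1; and approximate
  these uniformly by trigonometric polynomials. The first two steps converge in \<open>L\<^sup>2\<close> by dominated
  convergence.
\<close>

lemma trig_polys_dense_L2:
  assumes f: "f \<in> sqint unit_measure" and \<epsilon>: "\<epsilon> > 0"
  shows "\<exists>p\<in>trig_polys. l2norm unit_measure (\<lambda>x. f x - p x) < \<epsilon>"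
proof -
  have fm: "f \<in> borel_measurable unit_measure" by (rule sqint_measurable[OF f])
  have cm: "(\<lambda>x. clip R (f x)) \<in> borel_measurable unit_measure" if "R > 0" for R
    using measurable_compose[OF fm borel_measurable_continuous_onI[OF continuous_on_clip[OF that]]] .
  have "(\<lambda>n. l2norm unit_measure (\<lambda>x. f x - clip (real (Suc n)) (f x))) \<longlonglongrightarrow> 0"
  proof (rule l2norm_tendsto_0[OF fm cm _ f])
    show "AE x in unit_measure. (\<lambda>n. clip (real (Suc n)) (f x)) \<longlonglongrightarrow> f x"
    proof (rule AE_I2, rule tendsto_eventually)
      fix x
      obtain N where "norm (f x) \<le> real N" using real_arch_simple by blast
      then have "clip (real (Suc n)) (f x) = f x" if "n \<ge> N" for n
        using that by (intro clip_id) auto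
      then show "eventually (\<lambda>n. clip (real (Suc n)) (f x) = f x) sequentially"
        unfolding eventually_sequentially by blast
    qed
    show "AE x in unit_measure. norm (f x - clip (real (Suc n)) (f x)) \<le> norm (f x)" for n
      by (rule AE_I2, rule norm_clip) simp
  qed simp
  then have "eventually (\<lambda>n. l2norm unit_measure (\<lambda>x. f x - clip (real (Suc n)) (f x)) < \<epsilon> / 3) sequentially"
    using \<epsilon> by (intro order_tendstoD(2)) auto
  then obtain n where n: "l2norm unit_measure (\<lambda>x. f x - clip (real (Suc n)) (f x)) < \<epsilon> / 3"
    by (auto simp: eventually_sequentially)
  define R where "R = real (Suc n)"
  have R: "R > 0" by (simp add: R_def)
  define f1 where "f1 x = clip R (f x)" for x
  have f1m: "f1 \<in> borel_measurable unit_measure" unfolding f1_def by (rule cm[OF R])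
  have f1b: "norm (f1 x) \<le> R" for x unfolding f1_def by (rule norm_clip[OF R])
  have f1s: "f1 \<in> sqint unit_measure" by (rule sqint_bounded[OF finite_measure_unit f1m f1b])
  have e1: "l2norm unit_measure (\<lambda>x. f x - f1 x) < \<epsilon> / 3" using n by (simp add: f1_def R_def)
  have "(\<lambda>x. if x \<in> {0..<1} then f x else 0) \<in> borel_measurable lebesgue"
    by (rule borel_measurable_if_I[OF fm]) simp
  from lebesgue_measurable_imp_measurable_on[OF this, of "{0..<1}"]
  obtain N g where N: "negligible N" and g: "\<And>n. continuous_on UNIV (g n)"
    and lim: "\<And>x. x \<notin> N \<Longrightarrow> x \<in> {0..<1} \<Longrightarrow> (\<lambda>n. g n x) \<longlonglongrightarrow> f x"
    unfolding measurable_on_def by fastforce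
  define \<phi> where "\<phi> n x = of_real (min 1 (real n * max 0 (x * (1 - x)))) * clip R (g n x)" for n x
  have \<phi>c: "continuous_on UNIV (\<phi> n)" for n
  proof -
    have "continuous_on UNIV (clip R \<circ> g n)"
      by (rule continuous_on_compose[OF g]) (rule continuous_on_subset[OF continuous_on_clip[OF R]], simp)
    then have "continuous_on UNIV (\<lambda>x. clip R (g n x))" by (simp add: comp_def)
    then show ?thesis unfolding \<phi>_def by (intro continuous_intros)
  qed
  have \<phi>b: "norm (\<phi> n x) \<le> R" for n x
  proof -
    have "norm (\<phi> n x) \<le> 1 * norm (clip R (g n x))"
      unfolding \<phi>_def norm_mult by (intro mult_right_mono) auto
    then show ?thesis using norm_clip(1)[OF R, of "g n x"] by simp
  qed
  have "(\<lambda>n. l2norm unit_measure (\<lambda>x. f1 x - \<phi> n x)) \<longlonglongrightarrow> 0"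
  proof (rule l2norm_tendsto_0[OF f1m, where w = "\<lambda>_. of_real (2 * R)"])
    show "\<phi> n \<in> borel_measurable unit_measure" for n
      by (rule continuous_measurable_lebesgue_on[OF \<phi>c])
    show "(\<lambda>_. complex_of_real (2 * R)) \<in> sqint unit_measure"
      by (rule sqint_bounded[OF finite_measure_unit, of _ "2 * R"]) (use R in auto)
    show "AE x in unit_measure. norm (f1 x - \<phi> n x) \<le> norm (complex_of_real (2 * R))" for n
    proof (rule AE_I2)
      fix x
      have "norm (f1 x - \<phi> n x) \<le> R + R"
        using norm_triangle_ineq4[of "f1 x" "\<phi> n x"] f1b[of x] \<phi>b[of n x] by linarith
      then show "norm (f1 x - \<phi> n x) \<le> norm (complex_of_real (2 * R))"
        using R by (simp only: norm_of_real)
    qed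
    have "N \<union> {0} \<in> null_sets lebesgue" using N by (simp add: negligible_iff_null_sets[symmetric])
    then have "AE x in lebesgue. x \<notin> N \<union> {0}" by (rule AE_not_in)
    then have "AE x in unit_measure. x \<notin> N \<union> {0}" by (subst AE_restrict_space_iff) auto
    then show "AE x in unit_measure. (\<lambda>n. \<phi> n x) \<longlonglongrightarrow> f1 x"
    proof (rule AE_mp, intro AE_I2 impI)
      fix x assume "x \<in> space unit_measure" and xN: "x \<notin> N \<union> {0}"
      then have x: "0 < x" "x < 1" by (auto simp: space_restrict_space)
      have "isCont (clip R) (f x)" using continuous_on_clip[OF R] by (simp add: continuous_on_eq_continuous_at)
      moreover have "(\<lambda>n. g n x) \<longlonglongrightarrow> f x" using lim[of x] xN x by simp
      ultimately have lim2: "(\<lambda>n. clip R (g n x)) \<longlonglongrightarrow> f1 x"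
        unfolding f1_def by (rule isCont_tendsto_compose)
      moreover have lim1: "(\<lambda>n. complex_of_real (min 1 (real n * max 0 (x * (1 - x))))) \<longlonglongrightarrow> 1"
      proof (rule tendsto_eventually)
        obtain m where m: "1 / (x * (1 - x)) \<le> real m" using real_arch_simple by blast
        have pos: "x * (1 - x) > 0" using x by simp
        have "min 1 (real n * max 0 (x * (1 - x))) = 1" if "n \<ge> m" for n
        proof -
          have "1 / (x * (1 - x)) \<le> real n" using m that by linarith
          then have "1 \<le> real n * (x * (1 - x))" using pos by (simp add: divide_le_eq)
          then show ?thesis using pos by (simp add: max_def)
        qed
        then show "eventually (\<lambda>n. complex_of_real (min 1 (real n * max 0 (x * (1 - x)))) = 1) sequentially"
          unfolding eventually_sequentially by (metis of_real_1)
      qed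
      ultimately show "(\<lambda>n. \<phi> n x) \<longlonglongrightarrow> f1 x"
        unfolding \<phi>_def using tendsto_mult[OF lim1 lim2] by simp
    qed
  qed
  then have "eventually (\<lambda>n. l2norm unit_measure (\<lambda>x. f1 x - \<phi> n x) < \<epsilon> / 3) sequentially"
    using \<epsilon> by (intro order_tendstoD(2)) auto
  then obtain n where e2: "l2norm unit_measure (\<lambda>x. f1 x - \<phi> n x) < \<epsilon> / 3"
    by (auto simp: eventually_sequentially)
  have \<phi>s: "\<phi> n \<in> sqint unit_measure"
    by (rule sqint_bounded[OF finite_measure_unit continuous_measurable_lebesgue_on[OF \<phi>c] \<phi>b])
  obtain p where p: "p \<in> trig_polys" "\<And>x. x \<in> {0..<1} \<Longrightarrow> norm (\<phi> n x - p x) < \<epsilon> / 3"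
    using periodic_uniform_approx[of "\<phi> n" "\<epsilon> / 3"] continuous_on_subset[OF \<phi>c] \<epsilon> by (auto simp: \<phi>_def)
  have ps: "p \<in> sqint unit_measure"
    using p(1) unfolding trig_polys_def by (auto intro!: sqint_sum sqint_mult_left expfun_sqint)
  have e3: "l2norm unit_measure (\<lambda>x. \<phi> n x - p x) \<le> \<epsilon> / 3"
    using p(2) \<epsilon> sqint_measurable[OF sqint_diff[OF \<phi>s ps]] by (intro l2norm_unit_le) (auto intro: less_imp_le)
  have "l2norm unit_measure (\<lambda>x. f x - p x) < \<epsilon>"
    using l2norm_triangle_mid[OF f f1s ps] l2norm_triangle_mid[OF f1s \<phi>s ps] e1 e2 e3 by linarith
  with p(1) show ?thesis by blast
qed

corollary fourier_dense:
  assumes "f \<in> sqint unit_measure" "\<epsilon> > 0"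
  shows "\<exists>F c. finite F \<and> F \<subseteq> (UNIV :: int set) \<and>
    l2norm unit_measure (\<lambda>x. f x - (\<Sum>k\<in>F. c k * expfun (of_int k) x)) < \<epsilon>"
  using trig_polys_dense_L2[OF assms] unfolding trig_polys_def by auto

section \<open>A uniformly convergent cosine series\<close>

text \<open>
  Orthogonality to all exponentials makes \<open>h\<close> orthogonal to trigonometric polynomials close to \<open>h\<close>, so
  its norm is zero, and a continuous function with zero norm vanishes.
\<close>

lemma fourier_unique:
  assumes h: "continuous_on UNIV h"
    and ortho: "\<And>k::int. l2inner unit_measure h (expfun (of_int k)) = 0"
    and y: "y \<in> {0..1}"
  shows "h y = 0"
proof -
  have hs: "h \<in> sqint unit_measure" by (rule sqint_unit_continuous[OF h])
  have "(l2norm unit_measure h)\<^sup>2 \<le> 0 + l2norm unit_measure h * \<epsilon>" if \<epsilon>: "\<epsilon> > 0" for \<epsilon>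
  proof -
    obtain F :: "int set" and c where F: "finite F"
      "l2norm unit_measure (\<lambda>x. h x - (\<Sum>k\<in>F. c k * expfun (of_int k) x)) < \<epsilon>"
      using fourier_dense[OF hs \<epsilon>] by auto
    define p where "p x = (\<Sum>k\<in>F. c k * expfun (of_int k) x)" for x
    have p: "p \<in> sqint unit_measure" unfolding p_def by (intro sqint_sum sqint_mult_left expfun_sqint)
    have "l2inner unit_measure h p = 0"
      unfolding p_def
      by (subst l2inner_sum_right) (auto simp: l2inner_mult_right ortho hs intro!: sqint_mult_left expfun_sqint)
    moreover have "l2inner unit_measure h (\<lambda>x. (h x - p x) + p x)
        = l2inner unit_measure h (\<lambda>x. h x - p x) + l2inner unit_measure h p"
      by (intro l2inner_add_right sqint_diff hs p)
    ultimately have "l2inner unit_measure h h = l2inner unit_measure h (\<lambda>x. h x - p x)" by simp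
    moreover have "norm (l2inner unit_measure h h) = (l2norm unit_measure h)\<^sup>2"
      by (simp add: l2inner_self norm_power)
    ultimately have "(l2norm unit_measure h)\<^sup>2 = norm (l2inner unit_measure h (\<lambda>x. h x - p x))"
      by simp
    also have "\<dots> \<le> l2norm unit_measure h * l2norm unit_measure (\<lambda>x. h x - p x)"
      by (rule l2norm_cauchy_schwarz[OF hs sqint_diff[OF hs p]])
    also have "\<dots> \<le> l2norm unit_measure h * \<epsilon>"
      using F(2) unfolding p_def by (intro mult_left_mono) auto
    finally show ?thesis by simp
  qed
  then have "(l2norm unit_measure h)\<^sup>2 \<le> 0" by (rule le_if_le_add_mult_eps)
  then have z: "(\<integral>x. (norm (h x))\<^sup>2 \<partial>unit_measure) = 0"
    unfolding l2norm_power2 by (simp add: antisym)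
  have hc: "continuous_on UNIV (\<lambda>x. (norm (h x))\<^sup>2)" using h by (intro continuous_intros)
  have int: "(\<lambda>x. (norm (h x))\<^sup>2) integrable_on {0..1}"
    by (intro integrable_continuous_interval continuous_on_subset[OF hc]) simp
  have "(\<integral>x. (norm (h x))\<^sup>2 \<partial>unit_measure) = integral {0..1} (\<lambda>x. (norm (h x))\<^sup>2)"
    by (rule integral_unit_measure[OF hc integrable_integral[OF int]])
  then have "integral {0..1} (\<lambda>x. (norm (h x))\<^sup>2) = 0" using z by simp
  then have "\<forall>x\<in>{0..1}. (norm (h x))\<^sup>2 = 0"
    by (subst (asm) integral_eq_0_iff) (auto intro: continuous_on_subset[OF hc])
  then show ?thesis using y by auto
qed

text \<open>
  The Fourier coefficients of \<open>cos (\<gamma> \<pi> (1 - 2 y))\<close> on the unit interval, for \<open>0 < \<gamma> < 1\<close>.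
\<close>

definition cos_coef :: "real \<Rightarrow> int \<Rightarrow> real" where
  "cos_coef \<gamma> k = \<gamma> * sin (pi * \<gamma>) / (pi * (\<gamma>\<^sup>2 - (of_int k)\<^sup>2))"

lemma l2inner_cos_expfun:
  fixes \<gamma> :: real and k :: int
  assumes \<gamma>: "0 < \<gamma>" "\<gamma> < 1"
  shows "l2inner unit_measure (\<lambda>y. of_real (cos (\<gamma> * pi * (1 - 2 * y)))) (expfun (of_int k))
    = of_real (cos_coef \<gamma> k)"
proof -
  define v where "v = \<i> * of_real (\<gamma> * pi)"
  define E where "E = exp v"
  define c1 where "c1 = - (2 * of_real pi * \<i> * of_real (\<gamma> + of_int k))"
  define c2 where "c2 = 2 * of_real pi * \<i> * of_real (\<gamma> - of_int k)"
  have gk: "\<gamma> \<noteq> of_int k" for k :: int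
  proof
    assume "\<gamma> = of_int k"
    with \<gamma> have "0 < k" "k < 1" by simp_all
    then show False by simp
  qed
  have nz: "\<gamma> + of_int k \<noteq> 0" "\<gamma> - of_int k \<noteq> 0" using gk[of k] gk[of "- k"] by auto
  have c: "c1 \<noteq> 0" "c2 \<noteq> 0"
    using nz unfolding c1_def c2_def by (simp_all only: neg_equal_0_iff_equal mult_eq_0_iff of_real_eq_0_iff) auto
  have E0: "E \<noteq> 0" by (simp add: E_def)
  have per: "exp (- (2 * of_real pi * \<i> * of_int k)) = 1" for k :: int
    using exp_integer_2pi[of "of_int (- k)"] by (simp add: mult_ac)
  have ex1: "exp c1 = 1 / E\<^sup>2"
  proof -
    have "c1 = - (v + v) + (- (2 * of_real pi * \<i> * of_int k))"
      by (simp add: v_def c1_def algebra_simps)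
    then have "exp c1 = exp (- (v + v))"
      by (simp only: exp_add[of _ "- (2 * of_real pi * \<i> * of_int k)"] per mult_1_right)
    then show ?thesis by (simp add: E_def exp_minus exp_double inverse_eq_divide flip: mult_2)
  qed
  have ex2: "exp c2 = E\<^sup>2"
  proof -
    have "c2 = (v + v) + (- (2 * of_real pi * \<i> * of_int k))"
      by (simp add: v_def c2_def algebra_simps)
    then have "exp c2 = exp (v + v)"
      by (simp only: exp_add[of _ "- (2 * of_real pi * \<i> * of_int k)"] per mult_1_right)
    then show ?thesis by (simp add: E_def exp_double flip: mult_2)
  qed
  have sinE: "E - 1 / E = 2 * \<i> * of_real (sin (pi * \<gamma>))"
  proof -
    have "1 / E = exp (- v)" by (simp add: E_def exp_minus inverse_eq_divide)
    then show ?thesis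
      by (simp add: E_def v_def sin_of_real[symmetric] sin_exp_eq mult_ac flip: of_real_mult)
  qed
  have eq: "of_real (cos (\<gamma> * pi * (1 - 2 * y))) * cnj (expfun (of_int k) y)
      = E / 2 * exp (c1 * of_real y) + 1 / (2 * E) * exp (c2 * of_real y)" for y
  proof -
    define t where "t = \<gamma> * pi * (1 - 2 * y)"
    define w where "w = - (2 * of_real pi * \<i> * of_real (of_int k * y))"
    have "cnj (expfun (of_int k) y) = exp w" unfolding cnj_expfun by (simp add: expfun_def w_def)
    moreover have "of_real (cos t) = (exp (\<i> * of_real t) + exp (- (\<i> * of_real t))) / 2"
      by (simp add: cos_of_real[symmetric] cos_exp_eq)
    ultimately have "of_real (cos t) * cnj (expfun (of_int k) y)
        = (exp (\<i> * of_real t + w) + exp (- (\<i> * of_real t) + w)) / 2"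
      by (simp only: exp_add distrib_right times_divide_eq_left)
    moreover have "\<i> * of_real t + w = v + c1 * of_real y"
      by (simp add: t_def w_def v_def c1_def algebra_simps)
    moreover have "- (\<i> * of_real t) + w = - (v) + c2 * of_real y"
      by (simp add: t_def w_def v_def c2_def algebra_simps)
    ultimately show ?thesis
      unfolding t_def[symmetric] by (simp only: exp_add exp_minus E_def[symmetric])
        (simp add: inverse_eq_divide add_divide_distrib)
  qed
  have "((\<lambda>y. E / 2 * exp (c1 * of_real y) + 1 / (2 * E) * exp (c2 * of_real y)) has_integral
      (E / 2 * ((exp c1 - 1) / c1) + 1 / (2 * E) * ((exp c2 - 1) / c2))) {0..1}"
    by (intro has_integral_add has_integral_mult_right has_integral_exp_unit c)
  then have "l2inner unit_measure (\<lambda>y. of_real (cos (\<gamma> * pi * (1 - 2 * y)))) (expfun (of_int k))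
     = E / 2 * ((exp c1 - 1) / c1) + 1 / (2 * E) * ((exp c2 - 1) / c2)"
    unfolding l2inner_def eq by (intro integral_unit_measure) (auto intro!: continuous_intros simp: E0)
  also have "\<dots> = (E - 1 / E) / 2 * (1 / c2 - 1 / c1)"
  proof -
    have h: "E / 2 * (1 / E\<^sup>2 - 1) = - ((E - 1 / E) / 2)" "1 / (2 * E) * (E\<^sup>2 - 1) = (E - 1 / E) / 2"
      using E0 by (simp_all add: right_diff_distrib power2_eq_square diff_divide_distrib)
    show ?thesis
      unfolding ex1 ex2 times_divide_eq_right[of "E / 2"] times_divide_eq_right[of "1 / (2 * E)"] h
      by (simp add: right_diff_distrib)
  qed
  also have "\<dots> = of_real (cos_coef \<gamma> k)"
  proof -
    define p where "p = 2 * complex_of_real pi * \<i>"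
    define u where "u = complex_of_real (\<gamma> - of_int k)"
    define w where "w = complex_of_real (\<gamma> + of_int k)"
    have uw: "u \<noteq> 0" "w \<noteq> 0" using nz unfolding u_def w_def of_real_eq_0_iff by auto
    have "1 / c2 - 1 / c1 = 1 / (p * u) - 1 / (- (p * w))"
      by (simp only: c1_def c2_def p_def u_def w_def)
    also have "\<dots> = (1 / p) * (1 / u + 1 / w)" by (simp add: distrib_left)
    also have "1 / u + 1 / w = (u + w) / (u * w)" using uw by (simp add: add_frac_eq add.commute)
    also have "u + w = 2 * of_real \<gamma>" by (simp add: u_def w_def)
    also have "u * w = of_real (\<gamma>\<^sup>2 - (of_int k)\<^sup>2)"
      by (simp add: u_def w_def algebra_simps power2_eq_square)
    finally have "1 / c2 - 1 / c1 = 1 / p * (2 * of_real \<gamma> / of_real (\<gamma>\<^sup>2 - (of_int k)\<^sup>2))" .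
    then show ?thesis unfolding sinE cos_coef_def p_def by simp
  qed
  finally show ?thesis .
qed

lemma cos_coef_summable:
  assumes "0 < \<gamma>" "\<gamma> < 1"
  shows "summable (\<lambda>j. \<bar>cos_coef \<gamma> (int j)\<bar>)"
proof (rule summable_comparison_test_ev)
  define K where "K = 1 / (pi * (1 - \<gamma>\<^sup>2))"
  have g2: "\<gamma>\<^sup>2 < 1" using assms by (simp add: power_less_one_iff abs_square_less_1)
  show "eventually (\<lambda>j. norm \<bar>cos_coef \<gamma> (int j)\<bar> \<le> K * inverse (real j ^ 2)) sequentially"
    unfolding eventually_sequentially
  proof (intro exI[of _ 1] allI impI)
    fix j :: nat assume "1 \<le> j"
    then have j: "1 \<le> (real j)\<^sup>2" by simp
    have "\<gamma>\<^sup>2 * 1 \<le> \<gamma>\<^sup>2 * (real j)\<^sup>2" using j by (intro mult_left_mono) auto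
    then have le: "(1 - \<gamma>\<^sup>2) * (real j)\<^sup>2 \<le> (real j)\<^sup>2 - \<gamma>\<^sup>2" by (simp add: algebra_simps)
    have pos: "0 < (1 - \<gamma>\<^sup>2) * (real j)\<^sup>2" using g2 j by (intro mult_pos_pos) linarith+
    have "\<bar>\<gamma>\<^sup>2 - (real j)\<^sup>2\<bar> = (real j)\<^sup>2 - \<gamma>\<^sup>2" using le pos by linarith
    then have "\<bar>cos_coef \<gamma> (int j)\<bar> = \<gamma> * \<bar>sin (pi * \<gamma>)\<bar> / (pi * ((real j)\<^sup>2 - \<gamma>\<^sup>2))"
      using assms by (simp add: cos_coef_def abs_mult)
    also have "\<dots> \<le> 1 / (pi * ((1 - \<gamma>\<^sup>2) * (real j)\<^sup>2))"
      using assms le pos by (intro frac_le mult_mono mult_le_one) auto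
    also have "\<dots> = K * inverse (real j ^ 2)" by (simp add: K_def field_simps)
    finally show "norm \<bar>cos_coef \<gamma> (int j)\<bar> \<le> K * inverse (real j ^ 2)" by simp
  qed
  show "summable (\<lambda>j. K * inverse (real j ^ 2))"
    by (intro summable_mult inverse_power_summable) simp
qed

text \<open>
  The coefficients are absolutely summable, so the series converges uniformly to a continuous function.
  This function and the cosine \<open>cos (\<gamma> \<pi> (1 - 2 y))\<close> have the same Fourier coefficients, hence agree.
\<close>

lemma cos_fourier:
  assumes \<gamma>: "0 < \<gamma>" "\<gamma> < 1" and y: "y \<in> {0..1}"
  shows "(\<lambda>j. (if j = 0 then 1 else 2) * cos_coef \<gamma> (int j) * cos (2 * pi * real j * y))
    sums cos (\<gamma> * pi * (1 - 2 * y))"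
proof -
  define c where "c j = (if j = 0 then 1 else 2) * cos_coef \<gamma> (int j)" for j :: nat
  define S where "S N y = (\<Sum>j<N. complex_of_real (c j * cos (2 * pi * real j * y)))" for N y
  define G where "G y = (\<Sum>j. complex_of_real (c j * cos (2 * pi * real j * y)))" for y
  define D where "D y = complex_of_real (cos (\<gamma> * pi * (1 - 2 * y)))" for y
  have cs: "summable (\<lambda>j. \<bar>c j\<bar>)"
    by (rule summable_comparison_test[OF _ summable_mult[OF cos_coef_summable[OF \<gamma>], of 2]])
      (auto simp: c_def abs_mult)
  have bnd: "norm (complex_of_real (c j * cos (2 * pi * real j * y))) \<le> \<bar>c j\<bar>" for j y
    by (simp add: abs_mult mult_left_le norm_mult del: of_real_mult flip: of_real_mult)
  have ul: "uniform_limit UNIV S G sequentially"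
    unfolding S_def G_def by (rule Weierstrass_m_test[OF bnd cs])
  have Sc: "continuous_on UNIV (S N)" for N unfolding S_def by (intro continuous_intros)
  have Gc: "continuous_on UNIV G"
    by (rule uniform_limit_theorem[OF always_eventually ul]) (simp_all add: Sc)
  have Dc: "continuous_on UNIV D" unfolding D_def by (intro continuous_intros)
  have SN: "l2inner unit_measure (S N) (expfun (of_int k)) = of_real (cos_coef \<gamma> k)" if N: "nat \<bar>k\<bar> < N" for N k
  proof -
    have cosE: "complex_of_real (c j * cos (2 * pi * real j * y))
        = (of_real (c j) / 2) * expfun (of_int (int j)) y + (of_real (c j) / 2) * expfun (of_int (- int j)) y" for j y
    proof -
      have "complex_of_real (cos (2 * pi * real j * y))
          = (exp (\<i> * of_real (2 * pi * real j * y)) + exp (- (\<i> * of_real (2 * pi * real j * y)))) / 2"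
        by (simp only: cos_of_real[symmetric] cos_exp_eq)
      then show ?thesis by (simp add: expfun_def algebra_simps add_divide_distrib)
    qed
    have "l2inner unit_measure (S N) (expfun (of_int k))
        = (\<Sum>j<N. l2inner unit_measure (\<lambda>y. (of_real (c j) / 2) * expfun (of_int (int j)) y
            + (of_real (c j) / 2) * expfun (of_int (- int j)) y) (expfun (of_int k)))"
      unfolding S_def cosE by (intro l2inner_sum_left sqint_add sqint_mult_left expfun_sqint)
    also have "\<dots> = (\<Sum>j<N. (of_real (c j) / 2) * (if int j = k then 1 else 0)
            + (of_real (c j) / 2) * (if - int j = k then 1 else 0))"
      by (intro sum.cong refl)
        (simp only: l2inner_add_left[OF sqint_mult_left[OF expfun_sqint] sqint_mult_left[OF expfun_sqint] expfun_sqint]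
          l2inner_mult_left l2inner_expfun_unit of_real_1)
    also have "\<dots> = (\<Sum>j<N. if j = nat \<bar>k\<bar> then of_real (cos_coef \<gamma> k) else 0)"
    proof (intro sum.cong refl)
      fix j :: nat
      have "cos_coef \<gamma> (- k) = cos_coef \<gamma> k" by (simp add: cos_coef_def)
      then show "(of_real (c j) / 2) * (if int j = k then 1 else 0) + (of_real (c j) / 2) * (if - int j = k then 1 else 0)
          = (if j = nat \<bar>k\<bar> then complex_of_real (cos_coef \<gamma> k) else 0)"
        by (cases "k = 0"; cases "k > 0") (auto simp: c_def)
    qed
    also have "\<dots> = of_real (cos_coef \<gamma> k)" using N by simp
    finally show ?thesis .
  qed
  have ortho: "l2inner unit_measure (\<lambda>y. D y - G y) (expfun (of_int k)) = 0" for k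
  proof -
    have "norm (l2inner unit_measure (\<lambda>y. D y - G y) (expfun (of_int k))) \<le> 0 + 1 * \<epsilon>" if \<epsilon>: "\<epsilon> > 0" for \<epsilon>
    proof -
      have "eventually (\<lambda>N. \<forall>y\<in>UNIV. dist (S N y) (G y) < \<epsilon>) sequentially"
        using ul \<epsilon> by (rule uniform_limitD)
      then have "eventually (\<lambda>N. (\<forall>y\<in>UNIV. dist (S N y) (G y) < \<epsilon>) \<and> nat \<bar>k\<bar> < N) sequentially"
        using eventually_gt_at_top[of "nat \<bar>k\<bar>"] by eventually_elim auto
      then obtain N where N: "\<And>y. dist (S N y) (G y) < \<epsilon>" "nat \<bar>k\<bar> < N"
        unfolding eventually_sequentially by blast
      have "l2inner unit_measure D (expfun (of_int k))
          = l2inner unit_measure (\<lambda>y. (D y - G y) + (G y - S N y) + S N y) (expfun (of_int k))" by simp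
      also have "\<dots> = l2inner unit_measure (\<lambda>y. D y - G y) (expfun (of_int k))
          + l2inner unit_measure (\<lambda>y. G y - S N y) (expfun (of_int k)) + l2inner unit_measure (S N) (expfun (of_int k))"
        by (subst l2inner_add_left, (intro sqint_add sqint_diff sqint_unit_continuous Dc Gc Sc expfun_sqint)+)
          (subst l2inner_add_left, (intro sqint_add sqint_diff sqint_unit_continuous Dc Gc Sc expfun_sqint refl)+)
      finally have "l2inner unit_measure (\<lambda>y. D y - G y) (expfun (of_int k))
          = - l2inner unit_measure (\<lambda>y. G y - S N y) (expfun (of_int k))"
        unfolding SN[OF N(2)] l2inner_cos_expfun[OF \<gamma>, of k, folded D_def] by (simp add: eq_neg_iff_add_eq_0)
      then have "norm (l2inner unit_measure (\<lambda>y. D y - G y) (expfun (of_int k)))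
          = norm (l2inner unit_measure (\<lambda>y. G y - S N y) (expfun (of_int k)))" by simp
      also have "\<dots> \<le> l2norm unit_measure (\<lambda>y. G y - S N y) * l2norm unit_measure (expfun (of_int k))"
        by (intro l2norm_cauchy_schwarz sqint_diff sqint_unit_continuous Gc Sc expfun_sqint)
      also have "\<dots> \<le> \<epsilon> * 1"
      proof (intro mult_mono)
        show "l2norm unit_measure (\<lambda>y. G y - S N y) \<le> \<epsilon>"
          using N(1) \<epsilon> sqint_measurable[OF sqint_diff[OF sqint_unit_continuous[OF Gc] sqint_unit_continuous[OF Sc[of N]]]]
          by (intro l2norm_unit_le) (auto simp: dist_norm norm_minus_commute intro: less_imp_le)
        show "l2norm unit_measure (expfun (of_int k)) \<le> 1"
          by (intro l2norm_unit_le) auto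
      qed (use \<epsilon> in auto)
      finally show ?thesis by simp
    qed
    then have "norm (l2inner unit_measure (\<lambda>y. D y - G y) (expfun (of_int k))) \<le> 0"
      by (rule le_if_le_add_mult_eps)
    then show ?thesis by simp
  qed
  have "D y - G y = 0"
    by (rule fourier_unique[OF _ ortho y]) (intro continuous_intros Dc Gc)
  moreover have "(\<lambda>j. complex_of_real (c j * cos (2 * pi * real j * y))) sums G y"
    unfolding G_def by (intro summable_sums summable_norm_cancel[OF summable_comparison_test[OF _ cs]])
      (use bnd in auto)
  ultimately have "(\<lambda>j. complex_of_real (c j * cos (2 * pi * real j * y))) sums D y" by simp
  then show ?thesis unfolding D_def c_def sums_of_real_iff .
qed

section \<open>Kadec's quarter theorem\<close>

text \<open>
  Coefficients in the expansion of \<open>1 - cos (\<pi> \<delta> (1 - 2 y))\<close> in the functions \<open>cos (2 \<pi> j y)\<close>.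
  The value at \<open>\<delta> = 0\<close> has to be set to zero separately because \<open>sin 0 / 0\<close> evaluates to 0 rather
  than to the limit 1.
\<close>

definition kadec_cos_coef :: "nat \<Rightarrow> real \<Rightarrow> real" where
  "kadec_cos_coef j \<delta> = (if \<delta> = 0 then 0 else if j = 0 then 1 - sin (pi * \<delta>) / (pi * \<delta>)
     else 2 * \<delta> * sin (pi * \<delta>) / (pi * ((real j)\<^sup>2 - \<delta>\<^sup>2)))"

text \<open>
  Coefficients in the expansion of \<open>sin (\<pi> \<delta> (1 - 2 y))\<close> in the functions \<open>cos (\<pi> (2 j + 1) y)\<close>,
  which up to sign are the half-integer sines \<open>sin ((j + 1/2) x)\<close> in the variable \<open>x = \<pi> (1 - 2 y)\<close>.
\<close>

definition kadec_sin_coef :: "nat \<Rightarrow> real \<Rightarrow> real" where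
  "kadec_sin_coef j \<delta> = 8 * \<delta> * cos (pi * \<delta>) / (pi * ((2 * real j + 1)\<^sup>2 - 4 * \<delta>\<^sup>2))"

lemma kadec_cos_coef_minus: "kadec_cos_coef j (- \<delta>) = kadec_cos_coef j \<delta>"
  by (simp add: kadec_cos_coef_def)

lemma kadec_sin_coef_minus: "kadec_sin_coef j (- \<delta>) = - kadec_sin_coef j \<delta>"
  by (simp add: kadec_sin_coef_def)

lemma kadec_cos_coef_sums:
  assumes \<delta>: "\<bar>\<delta>\<bar> < 1" and y: "y \<in> {0..1}"
  shows "(\<lambda>j. kadec_cos_coef j \<delta> * cos (2 * pi * real j * y)) sums (1 - cos (pi * \<delta> * (1 - 2 * y)))"
proof -
  have pos: "(\<lambda>j. kadec_cos_coef j \<delta> * cos (2 * pi * real j * y)) sums (1 - cos (pi * \<delta> * (1 - 2 * y)))"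
    if \<delta>: "0 < \<delta>" "\<delta> < 1" for \<delta>
  proof -
    have "(\<lambda>j. (if j = 0 then 1 else 0) - (if j = 0 then 1 else 2) * cos_coef \<delta> (int j) * cos (2 * pi * real j * y))
        sums (1 - cos (\<delta> * pi * (1 - 2 * y)))"
      by (intro sums_diff cos_fourier \<delta> y sums_single)
    moreover have "(if j = 0 then 1 else 0) - (if j = 0 then 1 else 2) * cos_coef \<delta> (int j) * cos (2 * pi * real j * y)
        = kadec_cos_coef j \<delta> * cos (2 * pi * real j * y)" for j
    proof (cases "j = 0")
      case True
      then show ?thesis using \<delta> by (simp add: kadec_cos_coef_def cos_coef_def power2_eq_square)
    next
      case False
      have "pi * ((real j)\<^sup>2 - \<delta>\<^sup>2) = - (pi * (\<delta>\<^sup>2 - (real j)\<^sup>2))" by (simp add: algebra_simps)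
      with False show ?thesis using \<delta> by (simp add: kadec_cos_coef_def cos_coef_def)
    qed
    ultimately show ?thesis by (simp add: mult.commute)
  qed
  consider "\<delta> = 0" | "\<delta> > 0" | "- \<delta> > 0" by linarith
  then show ?thesis
  proof cases
    case 1 then show ?thesis by (simp add: kadec_cos_coef_def)
  next
    case 2 then show ?thesis using pos[of \<delta>] \<delta> by simp
  next
    case 3 then show ?thesis using pos[of "- \<delta>"] \<delta> unfolding kadec_cos_coef_minus by simp
  qed
qed

text \<open>
  From \<open>cos A - cos B\<close> with \<open>A = 2 \<pi> \<delta> (1 - s)\<close> and \<open>B = 2 \<pi> \<delta> s\<close>: the sum formula makes this
  difference \<open>- 2 sin (\<pi> \<delta>) sin (\<pi> \<delta> (1 - 2 s))\<close>, while each cosine is an instance of the series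
  \<open>cos_fourier\<close> with \<open>\<gamma> = 2 \<delta>\<close>, and in the difference of the two series the terms with even index
  cancel.
\<close>

lemma kadec_sin_coef_sums:
  assumes \<delta>: "\<bar>\<delta>\<bar> < 1 / 2" and s: "s \<in> {0..1}"
  shows "(\<lambda>j. kadec_sin_coef j \<delta> * cos (pi * (2 * real j + 1) * s)) sums sin (pi * \<delta> * (1 - 2 * s))"
proof -
  have pos: "(\<lambda>j. kadec_sin_coef j \<delta> * cos (pi * (2 * real j + 1) * s)) sums sin (pi * \<delta> * (1 - 2 * s))"
    if \<delta>: "0 < \<delta>" "\<delta> < 1 / 2" for \<delta>
  proof -
    define c where "c j = (if j = 0 then 1 else 2) * cos_coef (2 * \<delta>) (int j)" for j :: nat
    have g: "0 < 2 * \<delta>" "2 * \<delta> < 1" using \<delta> by auto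
    have y: "s / 2 \<in> {0..1}" "(1 - s) / 2 \<in> {0..1}" using s by auto
    have sp: "sin (pi * \<delta>) > 0" using \<delta> by (intro sin_gt_zero) auto
    define f where "f j = c j * cos (2 * pi * real j * (s / 2)) - c j * cos (2 * pi * real j * ((1 - s) / 2))" for j :: nat
    have "f sums (cos (2 * \<delta> * pi * (1 - 2 * (s / 2))) - cos (2 * \<delta> * pi * (1 - 2 * ((1 - s) / 2))))"
      unfolding f_def c_def by (intro sums_diff cos_fourier g y)
    also have "cos (2 * \<delta> * pi * (1 - 2 * (s / 2))) - cos (2 * \<delta> * pi * (1 - 2 * ((1 - s) / 2)))
        = cos (pi * \<delta> + pi * \<delta> * (1 - 2 * s)) - cos (pi * \<delta> - pi * \<delta> * (1 - 2 * s))"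
      by (intro arg_cong2[where f = "\<lambda>a b. cos a - cos b"]) (simp_all add: field_simps)
    also have "\<dots> = - 2 * sin (pi * \<delta>) * sin (pi * \<delta> * (1 - 2 * s))"
      by (simp add: cos_add cos_diff)
    finally have fs: "f sums (- 2 * sin (pi * \<delta>) * sin (pi * \<delta> * (1 - 2 * s)))" .
    have feq: "f j = (1 - (-1) ^ j) * c j * cos (pi * real j * s)" for j
    proof -
      have "cos (2 * pi * real j * ((1 - s) / 2)) = cos (pi * real j - pi * real j * s)"
        by (intro arg_cong[where f = cos]) (simp add: field_simps)
      also have "\<dots> = (-1) ^ j * cos (pi * real j * s)"
        by (simp add: cos_diff cos_npi2 sin_npi2)
      finally show ?thesis by (simp add: f_def algebra_simps)
    qed
    have "(\<lambda>j. f (2 * j + 1)) sums (- 2 * sin (pi * \<delta>) * sin (pi * \<delta> * (1 - 2 * s)))"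
    proof (subst sums_mono_reindex)
      show "strict_mono (\<lambda>j::nat. 2 * j + 1)" by (simp add: strict_mono_def)
      show "f n = 0" if "n \<notin> range (\<lambda>j. 2 * j + 1)" for n
      proof -
        have "even n" using that by (metis oddE rangeI)
        then show ?thesis by (simp add: feq)
      qed
    qed (rule fs)
    then have "(\<lambda>j. f (2 * j + 1) / (- 2 * sin (pi * \<delta>))) sums
        (- 2 * sin (pi * \<delta>) * sin (pi * \<delta> * (1 - 2 * s)) / (- 2 * sin (pi * \<delta>)))"
      by (rule sums_divide)
    moreover have "f (2 * j + 1) / (- 2 * sin (pi * \<delta>)) = kadec_sin_coef j \<delta> * cos (pi * (2 * real j + 1) * s)" for j
    proof -
      define D where "D = pi * ((2 * real j + 1)\<^sup>2 - 4 * \<delta>\<^sup>2)"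
      have "c (2 * j + 1) = - 4 * \<delta> * sin (pi * (2 * \<delta>)) / D"
      proof -
        have "pi * ((2 * \<delta>)\<^sup>2 - (real_of_int (int (2 * j + 1)))\<^sup>2) = - D"
          by (simp add: D_def algebra_simps)
        then show ?thesis unfolding c_def cos_coef_def by (simp only:) simp
      qed
      also have "sin (pi * (2 * \<delta>)) = 2 * sin (pi * \<delta>) * cos (pi * \<delta>)"
        using sin_double[of "pi * \<delta>"] by (simp add: mult_ac)
      finally have cj: "c (2 * j + 1) = - 4 * \<delta> * (2 * sin (pi * \<delta>) * cos (pi * \<delta>)) / D" .
      have r: "real (2 * j + 1) = 2 * real j + 1" by simp
      have "f (2 * j + 1) = - (2 * sin (pi * \<delta>)) * (kadec_sin_coef j \<delta> * cos (pi * (2 * real j + 1) * s))"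
        unfolding feq cj r kadec_sin_coef_def D_def[symmetric] by simp
      then show ?thesis using sp by simp
    qed
    ultimately show ?thesis using sp by simp
  qed
  consider "\<delta> = 0" | "\<delta> > 0" | "- \<delta> > 0" by linarith
  then show ?thesis
  proof cases
    case 1 then show ?thesis by (simp add: kadec_sin_coef_def)
  next
    case 2 then show ?thesis using pos[of \<delta>] \<delta> by simp
  next
    case 3 then show ?thesis using sums_minus[OF pos[of "- \<delta>"]] \<delta> unfolding kadec_sin_coef_minus by simp
  qed
qed

lemma sinc_antimono:
  assumes "0 < x" "x \<le> z" "z \<le> pi"
  shows "sin z / z \<le> sin x / (x::real)"
proof -
  have le: "t * cos t \<le> sin t" if "0 \<le> t" "t \<le> pi" for t :: real
  proof -
    have "sin 0 - 0 * cos 0 \<le> sin t - t * cos (t::real)"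
    proof (rule DERIV_nonneg_imp_nondecreasing[of 0 t "\<lambda>t. sin t - t * cos t"])
      fix u assume u: "0 \<le> u" "u \<le> t"
      have "((\<lambda>t. sin t - t * cos t) has_real_derivative u * sin u) (at u)"
        by (auto intro!: derivative_eq_intros)
      moreover have "0 \<le> u * sin u" using u that by (intro mult_nonneg_nonneg sin_ge_zero) auto
      ultimately show "\<exists>y. ((\<lambda>t. sin t - t * cos t) has_real_derivative y) (at u) \<and> 0 \<le> y" by blast
    qed fact
    then show ?thesis by simp
  qed
  show ?thesis
  proof (rule DERIV_nonpos_imp_nonincreasing[of x z "\<lambda>t. sin t / t"])
    fix u assume u: "x \<le> u" "u \<le> z"
    have "((\<lambda>t. sin t / t) has_real_derivative (cos u * u - sin u) / (u * u)) (at u)"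
      using u assms by (auto intro!: derivative_eq_intros)
    moreover have "(cos u * u - sin u) / (u * u) \<le> 0"
      using le[of u] u assms by (intro divide_nonpos_nonneg) (auto simp: mult.commute)
    ultimately show "\<exists>y. ((\<lambda>t. sin t / t) has_real_derivative y) (at u) \<and> y \<le> 0" by blast
  qed fact
qed

lemma x_cos_mono:
  assumes "0 \<le> x" "x \<le> z" "z \<le> pi / 4"
  shows "x * cos x \<le> z * cos (z::real)"
proof (rule DERIV_nonneg_imp_nondecreasing[of x z "\<lambda>t. t * cos t"])
  fix u assume u: "x \<le> u" "u \<le> z"
  have "((\<lambda>t. t * cos t) has_real_derivative cos u - u * sin u) (at u)"
    by (auto intro!: derivative_eq_intros)
  moreover have "0 \<le> cos u - u * sin u"
  proof -
    \<comment> \<open>as \<open>u \<le> \<pi>/4 < 1\<close> and the sine is below the cosine there\<close>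
    have "u \<le> 1" using u assms pi_less_4 by linarith
    moreover have s0: "0 \<le> sin u" using u assms by (intro sin_ge_zero) auto
    ultimately have "u * sin u \<le> sin u" using u assms by (simp add: mult_left_le_one_le)
    also have "sin u = cos (pi / 2 - u)" by (simp add: cos_diff)
    also have "\<dots> \<le> cos u" using u assms by (intro cos_monotone_0_pi_le) auto
    finally show ?thesis by simp
  qed
  ultimately show "\<exists>y. ((\<lambda>t. t * cos t) has_real_derivative y) (at u) \<and> 0 \<le> y" by blast
qed fact

text \<open>
  For \<open>j = 0\<close> this is the monotonicity of \<open>sin x / x\<close>; for \<open>j > 0\<close> the denominator decreases and
  the numerator increases with \<open>\<bar>\<delta>\<bar>\<close>. The supremum of each coefficient is thus attained at \<open>L\<close>, and the suprema can be summed by evaluating the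
  expansion for \<open>L\<close> at \<open>y = 0\<close>, where all cosines equal 1.
\<close>

lemma abs_kadec_cos_coef_le:
  assumes \<delta>: "\<bar>\<delta>\<bar> \<le> L" and L: "L \<le> 1 / 4"
  shows "\<bar>kadec_cos_coef j \<delta>\<bar> \<le> kadec_cos_coef j L"
proof -
  have main: "0 \<le> kadec_cos_coef j \<delta> \<and> kadec_cos_coef j \<delta> \<le> kadec_cos_coef j L" if \<delta>: "0 < \<delta>" "\<delta> \<le> L" for \<delta>
  proof (cases "j = 0")
    case True
    have "pi * L \<le> pi * 1" using L by (intro mult_left_mono) auto
    then have "sin (pi * L) / (pi * L) \<le> sin (pi * \<delta>) / (pi * \<delta>)"
      using \<delta> by (intro sinc_antimono) auto
    moreover have "sin (pi * \<delta>) / (pi * \<delta>) \<le> 1"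
      using sin_x_le_x[of "pi * \<delta>"] \<delta> by simp
    ultimately show ?thesis using True \<delta> by (simp add: kadec_cos_coef_def)
  next
    case False
    then have j: "1 \<le> (real j)\<^sup>2" by simp
    have sq: "\<delta>\<^sup>2 \<le> L\<^sup>2" using \<delta> by (intro power_mono) auto
    have "L\<^sup>2 \<le> (1 / 4)\<^sup>2" using \<delta> L by (intro power_mono) auto
    then have L2: "L\<^sup>2 < 1" by (simp add: power2_eq_square)
    have pd: "0 \<le> pi * \<delta>" "pi * \<delta> \<le> pi * L" "pi * L \<le> pi * (1 / 4)"
      using \<delta> L by (auto intro!: mult_left_mono)
    have sm: "sin (pi * \<delta>) \<le> sin (pi * L)"
      using pd pi_gt_zero by (intro sin_monotone_2pi_le) linarith+
    have s0: "0 \<le> sin (pi * \<delta>)" using \<delta> L by (intro sin_ge_zero) (auto simp: mult_left_le)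
    have "2 * \<delta> * sin (pi * \<delta>) / (pi * ((real j)\<^sup>2 - \<delta>\<^sup>2)) \<le> 2 * L * sin (pi * L) / (pi * ((real j)\<^sup>2 - L\<^sup>2))"
    proof (rule frac_le)
      show "2 * \<delta> * sin (pi * \<delta>) \<le> 2 * L * sin (pi * L)"
        using \<delta> sm s0 by (intro mult_mono) auto
      show "0 \<le> 2 * L * sin (pi * L)" using \<delta> sm s0 by (intro mult_nonneg_nonneg) auto
      show "0 < pi * ((real j)\<^sup>2 - L\<^sup>2)" using L2 j by (intro mult_pos_pos) auto
      show "pi * ((real j)\<^sup>2 - L\<^sup>2) \<le> pi * ((real j)\<^sup>2 - \<delta>\<^sup>2)" using sq by (intro mult_left_mono) auto
    qed
    moreover have "0 \<le> 2 * \<delta> * sin (pi * \<delta>) / (pi * ((real j)\<^sup>2 - \<delta>\<^sup>2))"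
    proof (rule divide_nonneg_nonneg)
      show "0 \<le> pi * ((real j)\<^sup>2 - \<delta>\<^sup>2)"
        using sq L2 j by (intro mult_nonneg_nonneg pi_ge_zero) linarith
    qed (use \<delta> s0 in auto)
    ultimately show ?thesis using False \<delta> by (simp add: kadec_cos_coef_def)
  qed
  consider "\<delta> = 0" | "\<delta> > 0" | "- \<delta> > 0" by linarith
  then show ?thesis
  proof cases
    case 1
    show ?thesis
    proof (cases "L = 0")
      case True
      with 1 show ?thesis by (simp add: kadec_cos_coef_def)
    next
      case False
      then show ?thesis using 1 main[of L] \<delta> by (simp add: kadec_cos_coef_def[of j 0])
    qed
  next
    case 2 then show ?thesis using main[of \<delta>] \<delta> by simp
  next
    case 3 then show ?thesis using main[of "- \<delta>"] \<delta> unfolding kadec_cos_coef_minus by simp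
  qed
qed

lemma abs_kadec_sin_coef_le:
  assumes \<delta>: "\<bar>\<delta>\<bar> \<le> L" and L: "L \<le> 1 / 4"
  shows "\<bar>kadec_sin_coef j \<delta>\<bar> \<le> kadec_sin_coef j L"
proof -
  have main: "0 \<le> kadec_sin_coef j \<delta> \<and> kadec_sin_coef j \<delta> \<le> kadec_sin_coef j L" if \<delta>: "0 \<le> \<delta>" "\<delta> \<le> L" for \<delta>
  proof -
    have j: "1 \<le> (2 * real j + 1)\<^sup>2" by (simp add: one_le_power)
    have sq: "\<delta>\<^sup>2 \<le> L\<^sup>2" using \<delta> by (intro power_mono) auto
    have "L\<^sup>2 \<le> (1 / 4)\<^sup>2" using \<delta> L by (intro power_mono) auto
    then have L2: "4 * L\<^sup>2 < 1" by (simp add: power2_eq_square)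
    have "pi * \<delta> * cos (pi * \<delta>) \<le> pi * L * cos (pi * L)"
      using \<delta> L by (intro x_cos_mono) (auto simp: mult_left_mono)
    then have m: "\<delta> * cos (pi * \<delta>) \<le> L * cos (pi * L)" by simp
    have c0: "0 \<le> \<delta> * cos (pi * \<delta>)"
    proof -
      have "pi * \<delta> \<le> pi * (1 / 4)" using \<delta> L by (intro mult_left_mono) auto
      moreover have "0 \<le> pi * \<delta>" using \<delta> by simp
      ultimately have "0 \<le> cos (pi * \<delta>)" using pi_gt_zero by (intro cos_ge_zero) linarith+
      then show ?thesis using \<delta> by simp
    qed
    have "8 * \<delta> * cos (pi * \<delta>) / (pi * ((2 * real j + 1)\<^sup>2 - 4 * \<delta>\<^sup>2))
        \<le> 8 * L * cos (pi * L) / (pi * ((2 * real j + 1)\<^sup>2 - 4 * L\<^sup>2))"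
    proof (rule frac_le)
      show "0 < pi * ((2 * real j + 1)\<^sup>2 - 4 * L\<^sup>2)" using L2 j by (intro mult_pos_pos pi_gt_zero) linarith
      show "pi * ((2 * real j + 1)\<^sup>2 - 4 * L\<^sup>2) \<le> pi * ((2 * real j + 1)\<^sup>2 - 4 * \<delta>\<^sup>2)"
        using sq by (intro mult_left_mono) auto
    qed (use m c0 in auto)
    moreover have "0 \<le> 8 * \<delta> * cos (pi * \<delta>) / (pi * ((2 * real j + 1)\<^sup>2 - 4 * \<delta>\<^sup>2))"
    proof (rule divide_nonneg_nonneg)
      show "0 \<le> pi * ((2 * real j + 1)\<^sup>2 - 4 * \<delta>\<^sup>2)"
        using sq L2 j by (intro mult_nonneg_nonneg pi_ge_zero) linarith
    qed (use c0 in auto)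
    ultimately show ?thesis by (simp add: kadec_sin_coef_def)
  qed
  show ?thesis
  proof (cases "\<delta> \<ge> 0")
    case True then show ?thesis using main[of \<delta>] \<delta> by simp
  next
    case False then show ?thesis using main[of "- \<delta>"] \<delta> unfolding kadec_sin_coef_minus by simp
  qed
qed

text \<open>
  Multiplying each coefficient \<open>c n\<close> by \<open>\<alpha> j n\<close> changes the norm by a factor of at most \<open>A j\<close> by
  Parseval's identity, and multiplying the resulting function by \<open>g j\<close> does not increase it. Summing
  over \<open>j\<close> bounds the multiplier \<open>\<kappa>\<close>, which depends on both \<open>n\<close> and the variable, by the sum
  of the \<open>A j\<close>.
\<close>

lemma multiplier_bound:
  fixes c :: "int \<Rightarrow> complex" and \<alpha> :: "nat \<Rightarrow> int \<Rightarrow> real" and g :: "nat \<Rightarrow> real \<Rightarrow> real"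
  assumes F: "finite F"
    and \<alpha>: "\<And>j n. n \<in> F \<Longrightarrow> \<bar>\<alpha> j n\<bar> \<le> A j" and A: "A sums q" "\<And>j. 0 \<le> A j"
    and g: "\<And>j. continuous_on UNIV (g j)" "\<And>j y. \<bar>g j y\<bar> \<le> 1"
    and \<kappa>: "\<And>n. continuous_on UNIV (\<kappa> n)"
    and s: "\<And>n y. n \<in> F \<Longrightarrow> y \<in> {0..<1} \<Longrightarrow> (\<lambda>j. \<alpha> j n * g j y) sums \<kappa> n y"
  shows "l2norm unit_measure (\<lambda>y. \<Sum>n\<in>F. c n * of_real (\<kappa> n y) * expfun (of_int n) y)
    \<le> q * sqrt (\<Sum>n\<in>F. (norm (c n))\<^sup>2)"
proof -
  define C where "C = sqrt (\<Sum>n\<in>F. (norm (c n))\<^sup>2)"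
  have C0: "0 \<le> C" by (simp add: C_def sum_nonneg)
  define f where "f = (\<lambda>y. \<Sum>n\<in>F. c n * of_real (\<kappa> n y) * expfun (of_int n) y)"
  define h where "h j = (\<lambda>y. of_real (g j y) * (\<Sum>n\<in>F. (of_real (\<alpha> j n) * c n) * expfun (of_int n) y))" for j
  have lin: "(\<lambda>y. \<Sum>n\<in>F. b n * expfun (of_int n) y) \<in> sqint unit_measure" for b
    by (intro sqint_sum sqint_mult_left expfun_sqint)
  have gm: "(\<lambda>y. complex_of_real (g j y)) \<in> borel_measurable unit_measure" for j
    by (rule continuous_measurable_lebesgue_on) (intro continuous_intros g)
  have hm: "h j \<in> borel_measurable unit_measure" for j
    unfolding h_def by (intro borel_measurable_times gm sqint_measurable[OF lin])
  have hb: "norm (h j y) \<le> 1 * norm (\<Sum>n\<in>F. (of_real (\<alpha> j n) * c n) * expfun (of_int n) y)" for j y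
    unfolding h_def norm_mult using g(2)[of j y] by (intro mult_right_mono) auto
  have hs: "h j \<in> sqint unit_measure" for j
    by (rule sqint_bound[OF lin hm hb])
  have hn: "l2norm unit_measure (h j) \<le> A j * C" for j
  proof -
    have "l2norm unit_measure (h j) \<le> 1 * l2norm unit_measure (\<lambda>y. \<Sum>n\<in>F. (of_real (\<alpha> j n) * c n) * expfun (of_int n) y)"
      by (rule l2norm_le_mult[OF lin hm _ hb]) simp
    also have "\<dots> \<le> A j * C"
    proof (rule power2_le_imp_le)
      have "(1 * l2norm unit_measure (\<lambda>y. \<Sum>n\<in>F. (of_real (\<alpha> j n) * c n) * expfun (of_int n) y))\<^sup>2
          = 1 * (\<Sum>n\<in>F. (norm (of_real (\<alpha> j n) * c n))\<^sup>2)"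
        unfolding mult_1 by (subst l2norm_lincomb_orthogonal[of UNIV "\<lambda>n. expfun (of_int n)" unit_measure 1])
          (auto simp: expfun_sqint l2inner_expfun_unit F)
      also have "\<dots> \<le> (\<Sum>n\<in>F. (A j)\<^sup>2 * (norm (c n))\<^sup>2)"
        unfolding mult_1
      proof (rule sum_mono)
        fix n assume "n \<in> F"
        from power_mono[OF \<alpha>[OF this, of j], where n = 2] have "(\<alpha> j n)\<^sup>2 \<le> (A j)\<^sup>2" by simp
        then show "(norm (of_real (\<alpha> j n) * c n))\<^sup>2 \<le> (A j)\<^sup>2 * (norm (c n))\<^sup>2"
          by (simp add: norm_mult power_mult_distrib mult_right_mono)
      qed
      also have "\<dots> = (A j * C)\<^sup>2"
        by (simp add: C_def power_mult_distrib sum_nonneg sum_distrib_left)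
      finally show "(1 * l2norm unit_measure (\<lambda>y. \<Sum>n\<in>F. (of_real (\<alpha> j n) * c n) * expfun (of_int n) y))\<^sup>2 \<le> (A j * C)\<^sup>2" .
    qed (use A C0 in simp)
    finally show ?thesis .
  qed
  have fc: "f \<in> borel_measurable unit_measure"
    unfolding f_def by (rule continuous_measurable_lebesgue_on) (intro continuous_intros \<kappa>)
  define D where "D = (\<Sum>n\<in>F. norm (c n))"
  have Asum: "summable A" "suminf A = q" using A(1) by (auto simp: sums_iff)
  have est: "l2norm unit_measure f \<le> (q - (\<Sum>j<N. A j)) * D + q * C" for N
  proof -
    \<comment> \<open>the first \<open>N\<close> terms are bounded one by one, the tail pointwise by what is left of the sum\<close>
    define T where "T = q - (\<Sum>j<N. A j)"
    have T0: "0 \<le> T" unfolding T_def using sum_le_suminf[OF Asum(1), of "{..<N}"] A(2) Asum(2) by simp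
    have pt: "norm (f y - (\<Sum>j<N. h j y)) \<le> T * D" if y: "y \<in> {0..<1}" for y
    proof -
      have tail: "\<bar>\<kappa> n y - (\<Sum>j<N. \<alpha> j n * g j y)\<bar> \<le> T" if n: "n \<in> F" for n
      proof -
        have t1: "(\<lambda>j. \<alpha> (j + N) n * g (j + N) y) sums (\<kappa> n y - (\<Sum>j<N. \<alpha> j n * g j y))"
          using sums_split_initial_segment[OF s[OF n y], of N] by simp
        have t2: "(\<lambda>j. A (j + N)) sums T"
          unfolding T_def by (rule sums_split_initial_segment[OF A(1)])
        have le: "norm (\<alpha> (j + N) n * g (j + N) y) \<le> A (j + N)" for j
        proof -
          have "\<bar>\<alpha> (j + N) n\<bar> * \<bar>g (j + N) y\<bar> \<le> A (j + N) * 1"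
            by (intro mult_mono \<alpha>[OF n] g(2)) (use A(2) in auto)
          then show ?thesis by (simp add: abs_mult)
        qed
        have "norm (\<Sum>j. \<alpha> (j + N) n * g (j + N) y) \<le> (\<Sum>j. A (j + N))"
          by (rule norm_suminf_le[OF le sums_summable[OF t2]])
        then show ?thesis using sums_unique[OF t1] sums_unique[OF t2] by simp
      qed
      have "f y - (\<Sum>j<N. h j y) = (\<Sum>n\<in>F. c n * of_real (\<kappa> n y - (\<Sum>j<N. \<alpha> j n * g j y)) * expfun (of_int n) y)"
      proof -
        have "(\<Sum>j<N. h j y) = (\<Sum>n\<in>F. c n * of_real (\<Sum>j<N. \<alpha> j n * g j y) * expfun (of_int n) y)"
          unfolding h_def sum_distrib_left of_real_sum sum_distrib_right
          by (subst sum.swap) (simp add: mult_ac)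
        then show ?thesis unfolding f_def by (simp add: sum_subtractf[symmetric] algebra_simps)
      qed
      also have "norm \<dots> \<le> (\<Sum>n\<in>F. norm (c n) * T)"
      proof (rule sum_norm_le)
        fix n assume "n \<in> F"
        from tail[OF this] show "norm (c n * of_real (\<kappa> n y - (\<Sum>j<N. \<alpha> j n * g j y)) * expfun (of_int n) y) \<le> norm (c n) * T"
          unfolding norm_mult norm_of_real norm_expfun by (simp add: mult_left_mono)
      qed
      also have "\<dots> = T * D" by (simp add: D_def sum_distrib_left mult.commute)
      finally show ?thesis .
    qed
    have hsum: "(\<lambda>y. \<Sum>j<N. h j y) \<in> sqint unit_measure" by (intro sqint_sum hs)
    have "l2norm unit_measure (\<lambda>y. f y - (\<Sum>j<N. h j y)) \<le> T * D"
      using T0 pt fc sqint_measurable[OF hsum] by (intro l2norm_unit_le) (auto simp: D_def sum_nonneg)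
    moreover have "l2norm unit_measure (\<lambda>y. \<Sum>j<N. h j y) \<le> q * C"
    proof -
      have "l2norm unit_measure (\<lambda>y. \<Sum>j<N. h j y) \<le> (\<Sum>j<N. l2norm unit_measure (h j))"
        by (rule l2norm_sum_le) (rule hs)
      also have "\<dots> \<le> (\<Sum>j<N. A j * C)" by (intro sum_mono hn)
      also have "\<dots> \<le> q * C"
        using T0 C0 unfolding T_def sum_distrib_right[symmetric] by (intro mult_right_mono) auto
      finally show ?thesis .
    qed
    moreover have "l2norm unit_measure f \<le> l2norm unit_measure (\<lambda>y. f y - (\<Sum>j<N. h j y)) + l2norm unit_measure (\<lambda>y. \<Sum>j<N. h j y)"
    proof -
      have "(\<lambda>y. f y - (\<Sum>j<N. h j y)) \<in> sqint unit_measure"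
        using fc sqint_measurable[OF hsum] pt
        by (intro sqint_bounded[OF finite_measure_unit, of _ "T * D"]) (auto simp: space_restrict_space)
      from l2norm_triangle[OF this hsum] show ?thesis by simp
    qed
    ultimately show ?thesis unfolding T_def by linarith
  qed
  have "(\<lambda>N. (q - (\<Sum>j<N. A j)) * D + q * C) \<longlonglongrightarrow> (q - q) * D + q * C"
    using A(1) unfolding sums_def by (intro tendsto_intros)
  then have "l2norm unit_measure f \<le> (q - q) * D + q * C"
    by (rule LIMSEQ_le_const) (use est in blast)
  then show ?thesis by (simp add: f_def C_def)
qed

text \<open>
  Here the factor \<open>exp(i \<pi> \<delta>\<^sub>n (2 y - 1))\<close> is centred at the midpoint of the interval, so that its
  argument stays within \<open>\<pi> L\<close>. The perturbation \<open>1 - exp(-i t)\<close> is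
  \<open>(1 - cos t) + i sin t\<close>, and the two parts are bounded by \<open>1 - cos (\<pi> L)\<close> and \<open>sin (\<pi> L)\<close>.
\<close>

lemma kadec_symmetric:
  fixes \<delta> :: "int \<Rightarrow> real"
  assumes \<delta>: "\<And>n. \<bar>\<delta> n\<bar> \<le> L" and L: "L < 1 / 4"
  shows "riesz_basis unit_measure
    (\<lambda>n y. exp (- (\<i> * of_real (pi * \<delta> n * (1 - 2 * y)))) * expfun (of_int n) y) UNIV"
proof (rule riesz_basis_perturbation[where e = "\<lambda>n. expfun (of_int n)" and q = "(1 - cos (pi * L)) + sin (pi * L)"])
  have L0: "0 \<le> L" using \<delta>[of 0] by linarith
  have pL: "0 \<le> pi * L" "pi * L < pi / 4" using L0 L by auto
  have s0: "0 \<le> sin (pi * L)" using pL by (intro sin_ge_zero) linarith+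
  show "0 \<le> (1 - cos (pi * L)) + sin (pi * L)" using s0 cos_le_one[of "pi * L"] by linarith
  have "sin (pi * L) = cos (pi / 2 - pi * L)" by (simp add: cos_diff)
  also have "\<dots> < cos (pi * L)" using pL by (intro cos_monotone_0_pi) linarith+
  finally show "(1 - cos (pi * L)) + sin (pi * L) < 1" by simp
  show "expfun (of_int n) \<in> sqint unit_measure" for n by (rule expfun_sqint)
  show "(\<lambda>y. exp (- (\<i> * of_real (pi * \<delta> n * (1 - 2 * y)))) * expfun (of_int n) y) \<in> sqint unit_measure" for n
    by (intro sqint_unit_continuous continuous_intros)
  show "(l2norm unit_measure (\<lambda>y. \<Sum>n\<in>F. c n * expfun (of_int n) y))\<^sup>2 = (\<Sum>n\<in>F. (norm (c n))\<^sup>2)"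
    if "finite F" for F and c :: "int \<Rightarrow> complex"
    using l2norm_lincomb_orthogonal[of UNIV "\<lambda>n. expfun (of_int n)" unit_measure 1 F c] that
    by (simp add: expfun_sqint l2inner_expfun_unit)
  show "\<exists>F c. finite F \<and> F \<subseteq> (UNIV :: int set) \<and> l2norm unit_measure (\<lambda>x. f x - (\<Sum>k\<in>F. c k * expfun (of_int k) x)) < \<epsilon>"
    if "f \<in> sqint unit_measure" "\<epsilon> > 0" for f \<epsilon> by (rule fourier_dense[OF that])
  fix F :: "int set" and c :: "int \<Rightarrow> complex" assume F: "finite F"
  define C where "C = sqrt (\<Sum>n\<in>F. (norm (c n))\<^sup>2)"
  define f where "f = (\<lambda>y. \<Sum>n\<in>F. c n * of_real (1 - cos (pi * \<delta> n * (1 - 2 * y))) * expfun (of_int n) y)"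
  define g where "g = (\<lambda>y. \<Sum>n\<in>F. (\<i> * c n) * of_real (sin (pi * \<delta> n * (1 - 2 * y))) * expfun (of_int n) y)"
  have L4: "L \<le> 1 / 4" using L by simp
  have f: "l2norm unit_measure f \<le> (1 - cos (pi * L)) * C"
    unfolding f_def C_def
  proof (rule multiplier_bound[OF F])
    show "\<bar>kadec_cos_coef j (\<delta> n)\<bar> \<le> kadec_cos_coef j L" for j n by (rule abs_kadec_cos_coef_le[OF \<delta> L4])
    show "(\<lambda>j. kadec_cos_coef j L) sums (1 - cos (pi * L))"
      using kadec_cos_coef_sums[of L 0] L0 L by simp
    show "0 \<le> kadec_cos_coef j L" for j using abs_kadec_cos_coef_le[of L L j] L0 L4 by simp
    show "\<bar>cos (2 * pi * real j * y)\<bar> \<le> 1" for j y by (rule abs_cos_le_one)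
    show "(\<lambda>j. kadec_cos_coef j (\<delta> n) * cos (2 * pi * real j * y)) sums (1 - cos (pi * \<delta> n * (1 - 2 * y)))"
      if "y \<in> {0..<1}" for n y using that \<delta>[of n] L by (intro kadec_cos_coef_sums) auto
  qed (intro continuous_intros)+
  have g: "l2norm unit_measure g \<le> sin (pi * L) * C"
  proof -
    have C': "C = sqrt (\<Sum>n\<in>F. (norm (\<i> * c n))\<^sup>2)" by (simp add: C_def norm_mult)
    show ?thesis unfolding g_def C'
    proof (rule multiplier_bound[OF F])
      show "\<bar>kadec_sin_coef j (\<delta> n)\<bar> \<le> kadec_sin_coef j L" for j n by (rule abs_kadec_sin_coef_le[OF \<delta> L4])
      show "(\<lambda>j. kadec_sin_coef j L) sums sin (pi * L)"
        using kadec_sin_coef_sums[of L 0] L0 L by simp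
      show "0 \<le> kadec_sin_coef j L" for j using abs_kadec_sin_coef_le[of L L j] L0 L4 by simp
      show "\<bar>cos (pi * (2 * real j + 1) * y)\<bar> \<le> 1" for j y by (rule abs_cos_le_one)
      show "(\<lambda>j. kadec_sin_coef j (\<delta> n) * cos (pi * (2 * real j + 1) * y)) sums sin (pi * \<delta> n * (1 - 2 * y))"
        if "y \<in> {0..<1}" for n y using that \<delta>[of n] L by (intro kadec_sin_coef_sums) auto
    qed (intro continuous_intros)+
  qed
  have sq: "f \<in> sqint unit_measure" "g \<in> sqint unit_measure"
    unfolding f_def g_def by (intro sqint_unit_continuous continuous_intros)+
  have split: "(\<Sum>n\<in>F. c n * (expfun (of_int n) y - exp (- (\<i> * of_real (pi * \<delta> n * (1 - 2 * y)))) * expfun (of_int n) y))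
      = f y + g y" for y
  proof -
    have "expfun (of_int n) y - exp (- (\<i> * of_real t)) * expfun (of_int n) y
        = (of_real (1 - cos t) + \<i> * of_real (sin t)) * expfun (of_int n) y" for n t
    proof -
      have "exp (- (\<i> * of_real t)) = of_real (cos t) - \<i> * of_real (sin t)"
        using cis_conv_exp[of "- t"] by (simp add: complex_eq_iff)
      then show ?thesis by (simp only:) (simp add: algebra_simps)
    qed
    then show ?thesis unfolding f_def g_def sum.distrib[symmetric]
      by (intro sum.cong refl) (simp only: distrib_left distrib_right mult_ac)
  qed
  show "l2norm unit_measure (\<lambda>y. \<Sum>n\<in>F. c n * (expfun (of_int n) y
        - exp (- (\<i> * of_real (pi * \<delta> n * (1 - 2 * y)))) * expfun (of_int n) y))
      \<le> ((1 - cos (pi * L)) + sin (pi * L)) * sqrt (\<Sum>n\<in>F. (norm (c n))\<^sup>2)"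
    unfolding split C_def[symmetric] using l2norm_triangle[OF sq] f g by (simp add: distrib_right)
qed

text \<open>
  Kadec's quarter theorem. The common shift \<open>s\<close> of the frequencies amounts to multiplication by
  a unimodular function.
\<close>

theorem kadec:
  fixes \<mu> :: "int \<Rightarrow> real"
  assumes \<mu>: "\<And>n. \<bar>\<mu> n - of_int n - s\<bar> \<le> L" and L: "L < 1 / 4"
  shows "riesz_basis unit_measure (\<lambda>n. expfun (\<mu> n)) UNIV"
proof -
  define \<delta> where "\<delta> n = \<mu> n - of_int n - s" for n
  have "riesz_basis unit_measure
    (\<lambda>n y. exp (\<i> * of_real (pi * \<delta> n)) * (expfun s y *
      (exp (- (\<i> * of_real (pi * \<delta> n * (1 - 2 * y)))) * expfun (of_int n) y))) UNIV"
    using \<mu> L by (intro riesz_basis_unimodular kadec_symmetric[of \<delta> L]) (auto simp: \<delta>_def)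
  moreover have "exp (\<i> * of_real (pi * \<delta> n)) * (expfun s y *
      (exp (- (\<i> * of_real (pi * \<delta> n * (1 - 2 * y)))) * expfun (of_int n) y)) = expfun (\<mu> n) y" for n y
  proof -
    have "\<mu> n = of_int n + s + \<delta> n" by (simp add: \<delta>_def)
    then show ?thesis
      by (simp add: expfun_def algebra_simps flip: exp_add)
  qed
  ultimately show ?thesis by simp
qed

section \<open>Nearest-integer sequences and their complements\<close>

definition nearest :: "real \<Rightarrow> int \<Rightarrow> int" where
  "nearest \<beta> n = \<lfloor>\<beta> * of_int n + 1 / 2\<rfloor>"

lemma delta_star_nearest:
  assumes "\<beta> > 0"
  shows "of_int n + delta_star \<beta> n = of_int (nearest \<beta> n) / \<beta>"
proof -
  have "nearest \<beta> n = (if frac (\<beta> * of_int n) \<ge> 1 / 2 then \<lfloor>\<beta> * of_int n\<rfloor> + 1 else \<lfloor>\<beta> * of_int n\<rfloor>)"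
    unfolding nearest_def frac_def by (auto simp: floor_eq_iff) linarith+
  then show ?thesis by (simp add: delta_star_def)
qed

lemma inj_nearest: assumes "\<beta> \<ge> 1" shows "inj (nearest \<beta>)"
proof -
  have "nearest \<beta> n < nearest \<beta> m" if "n < m" for n m
  proof -
    have "1 * 1 \<le> \<beta> * of_int (m - n)" using assms that by (intro mult_mono) auto
    then have "\<beta> * of_int n + 1 / 2 + 1 \<le> \<beta> * of_int m + 1 / 2" by (simp add: algebra_simps)
    then have "\<lfloor>\<beta> * of_int n + 1 / 2\<rfloor> + 1 \<le> \<lfloor>\<beta> * of_int m + 1 / 2\<rfloor>" by linarith
    then show ?thesis by (simp add: nearest_def)
  qed
  then have "strict_mono (nearest \<beta>)" by (simp add: strict_mono_def)
  then show ?thesis by (rule strict_mono_imp_inj_on)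
qed

text \<open>
  The integer nearest to \<open>(n - 1/2) / \<alpha>\<close>, halves rounded down. Rounding the other way
  than \<open>nearest\<close> is what makes the two sequences exactly complementary.
\<close>

definition conearest :: "real \<Rightarrow> int \<Rightarrow> int" where
  "conearest \<alpha> n = \<lceil>(of_int n - 1 / 2) / \<alpha> - 1 / 2\<rceil>"

text \<open>
  With \<open>\<alpha> = 1 / \<beta>\<close>, an integer \<open>k\<close> is a value of \<open>nearest \<beta>\<close> iff the half-open interval from
  \<open>\<alpha> (k - 1/2)\<close> to \<open>\<alpha> (k + 1/2)\<close> contains an integer. It contains none
  iff it lies strictly above some integer \<open>p\<close> and ends at \<open>p + 1\<close> at the latest. With
  \<open>p = k - n\<close> the latter says that \<open>k\<close> is the value of \<open>conearest (1 - \<alpha>)\<close> at \<open>n\<close>. This is a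
  form of Beatty's theorem.
\<close>

lemma bij_conearest:
  assumes \<beta>: "1 < \<beta>"
  shows "bij_betw (conearest (1 - 1 / \<beta>)) UNIV (UNIV - range (nearest \<beta>))"
proof -
  define \<alpha> where "\<alpha> = 1 / \<beta>"
  have \<alpha>: "0 < \<alpha>" "\<alpha> < 1" using \<beta> by (auto simp: \<alpha>_def)
  define \<alpha>' where "\<alpha>' = 1 - \<alpha>"
  have \<alpha>': "0 < \<alpha>'" "\<alpha>' < 1" using \<alpha> by (auto simp: \<alpha>'_def)
  have near: "nearest \<beta> n = k \<longleftrightarrow> \<alpha> * (of_int k - 1 / 2) \<le> of_int n \<and> of_int n < \<alpha> * (of_int k + 1 / 2)" for n k
  proof -
    have "nearest \<beta> n = k \<longleftrightarrow> of_int k \<le> \<beta> * of_int n + 1 / 2 \<and> \<beta> * of_int n + 1 / 2 < of_int k + 1"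
      unfolding nearest_def by (rule floor_eq_iff)
    also have "\<dots> \<longleftrightarrow> (of_int k - 1 / 2) / \<beta> \<le> of_int n \<and> of_int n < (of_int k + 1 / 2) / \<beta>"
      using \<beta> by (simp add: field_simps)
    finally show ?thesis by (simp add: \<alpha>_def)
  qed
  have conear: "conearest \<alpha>' n = k \<longleftrightarrow>
      of_int (k - n) < \<alpha> * (of_int k - 1 / 2) \<and> \<alpha> * (of_int k + 1 / 2) \<le> of_int (k - n) + 1" for n k
  proof -
    define z where "z = (real_of_int n - 1 / 2) / \<alpha>'"
    have z: "\<alpha>' * z = of_int n - 1 / 2" using \<alpha>' by (simp add: z_def)
    have "conearest \<alpha>' n = k \<longleftrightarrow> of_int k - 1 / 2 < z \<and> z \<le> of_int k + 1 / 2"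
      unfolding conearest_def z_def[symmetric] ceiling_eq_iff by (auto simp: algebra_simps)
    also have "\<dots> \<longleftrightarrow> \<alpha>' * (of_int k - 1 / 2) < \<alpha>' * z \<and> \<alpha>' * z \<le> \<alpha>' * (of_int k + 1 / 2)"
      using \<alpha>' by simp
    also have "\<dots> \<longleftrightarrow> of_int (k - n) < \<alpha> * (of_int k - 1 / 2) \<and> \<alpha> * (of_int k + 1 / 2) \<le> of_int (k - n) + 1"
    proof -
      have "\<alpha>' * (of_int k - 1 / 2) = of_int k - 1 / 2 - \<alpha> * (of_int k - 1 / 2)"
        "\<alpha>' * (of_int k + 1 / 2) = of_int k + 1 / 2 - \<alpha> * (of_int k + 1 / 2)"
        by (simp_all add: \<alpha>'_def left_diff_distrib)
      then show ?thesis unfolding z of_int_diff by (intro conj_cong; linarith)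
    qed
    finally show ?thesis .
  qed
  have disj: "conearest \<alpha>' n \<noteq> nearest \<beta> n'" for n n'
  proof
    assume "conearest \<alpha>' n = nearest \<beta> n'"
    then have c: "real_of_int (nearest \<beta> n' - n) < \<alpha> * (of_int (nearest \<beta> n') - 1 / 2)"
      "\<alpha> * (of_int (nearest \<beta> n') + 1 / 2) \<le> real_of_int (nearest \<beta> n' - n) + 1"
      using conear by blast+
    have d: "\<alpha> * (of_int (nearest \<beta> n') - 1 / 2) \<le> of_int n'" "of_int n' < \<alpha> * (of_int (nearest \<beta> n') + 1 / 2)"
      using near by blast+
    have "real_of_int (nearest \<beta> n' - n) < of_int n'" "real_of_int n' < of_int (nearest \<beta> n' - n + 1)"
      using c d by simp_all
    then show False unfolding of_int_less_iff by linarith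
  qed
  have cover: "\<exists>n. conearest \<alpha>' n = k" if k: "k \<notin> range (nearest \<beta>)" for k
  proof -
    define n where "n = \<lceil>\<alpha> * (of_int k - 1 / 2)\<rceil>"
    have n: "of_int n - 1 < \<alpha> * (of_int k - 1 / 2)" "\<alpha> * (of_int k - 1 / 2) \<le> of_int n"
      unfolding n_def by linarith+
    have "nearest \<beta> n \<noteq> k" using k by auto
    then have "\<alpha> * (of_int k + 1 / 2) \<le> of_int n" using n near by force
    then have "conearest \<alpha>' (k - n + 1) = k" using n unfolding conear by simp
    then show ?thesis by blast
  qed
  have "conearest \<alpha>' n < conearest \<alpha>' m" if "n < m" for n m
  proof -
    have "1 \<le> real_of_int (m - n)" using that by linarith
    then have "\<alpha>' * 1 \<le> real_of_int (m - n)" using \<alpha>' by linarith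
    then have "1 \<le> real_of_int (m - n) / \<alpha>'" using \<alpha>' by (simp add: field_simps)
    also have "\<dots> = (of_int m - 1 / 2) / \<alpha>' - (of_int n - 1 / 2) / \<alpha>'"
      by (simp add: diff_divide_distrib[symmetric])
    finally show ?thesis unfolding conearest_def by linarith
  qed
  then have "inj (conearest \<alpha>')" by (intro strict_mono_imp_inj_on) (simp add: strict_mono_def)
  moreover have "range (conearest \<alpha>') = UNIV - range (nearest \<beta>)"
    using disj cover by (auto simp: image_iff) metis
  ultimately show ?thesis unfolding bij_betw_def \<alpha>'_def \<alpha>_def by simp
qed

lemma conearest_close:
  assumes "0 < \<alpha>"
  shows "\<bar>\<alpha> * of_int (conearest \<alpha> n) - (of_int n - 1 / 2)\<bar> \<le> \<alpha> / 2"
proof -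
  define z where "z = (real_of_int n - 1 / 2) / \<alpha>"
  have z: "\<alpha> * z = of_int n - 1 / 2" using assms by (simp add: z_def)
  have "\<bar>of_int (conearest \<alpha> n) - z\<bar> \<le> 1 / 2"
    unfolding conearest_def z_def[symmetric] by linarith
  then have "\<alpha> * \<bar>of_int (conearest \<alpha> n) - z\<bar> \<le> \<alpha> * (1 / 2)"
    using assms by (intro mult_left_mono) auto
  moreover have "\<alpha> * of_int (conearest \<alpha> n) - (of_int n - 1 / 2) = \<alpha> * (of_int (conearest \<alpha> n) - z)"
    unfolding z[symmetric] by (simp only: right_diff_distrib)
  ultimately show ?thesis using assms by (simp add: abs_mult)
qed

lemma nearest_close: assumes "\<beta> > 0" shows "\<bar>of_int (nearest \<beta> n) / \<beta> - of_int n\<bar> \<le> 1 / (2 * \<beta>)"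
proof -
  have "\<bar>of_int (nearest \<beta> n) - \<beta> * of_int n\<bar> \<le> 1 / 2" unfolding nearest_def by linarith
  then have "\<bar>of_int (nearest \<beta> n) - \<beta> * of_int n\<bar> / \<beta> \<le> 1 / 2 / \<beta>"
    using assms by (intro divide_right_mono) auto
  moreover have "\<bar>of_int (nearest \<beta> n) / \<beta> - of_int n\<bar> = \<bar>of_int (nearest \<beta> n) - \<beta> * of_int n\<bar> / \<beta>"
    using assms by (simp add: field_simps abs_mult_pos)
  ultimately show ?thesis by (simp add: field_simps)
qed

section \<open>Rounded frequencies on the unit interval\<close>

lemma vimage_affine_lebesgue:
  fixes t c :: real
  assumes c: "c \<noteq> 0" and A: "A \<in> sets lebesgue"
  shows "(\<lambda>x. t + c * x) -` A \<in> sets lebesgue"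
    and "emeasure lebesgue A = ennreal \<bar>c\<bar> * emeasure lebesgue ((\<lambda>x. t + c * x) -` A)"
proof -
  have T: "(\<lambda>x. t + c * x) \<in> lebesgue \<rightarrow>\<^sub>M lebesgue"
    using lebesgue_affine_measurable[where c = "\<lambda>x::real. c" and t = t] c by simp
  show "(\<lambda>x. t + c * x) -` A \<in> sets lebesgue"
    using measurable_sets[OF T A] by simp
  have "emeasure lebesgue A = emeasure (density (distr lebesgue lebesgue (\<lambda>x. t + c * x)) (\<lambda>_. ennreal \<bar>c\<bar>)) A"
    using lebesgue_real_affine[OF c, of t] by simp
  also have "\<dots> = ennreal \<bar>c\<bar> * emeasure lebesgue ((\<lambda>x. t + c * x) -` A)"
    using A T by (simp add: emeasure_density_const emeasure_distr)
  finally show "emeasure lebesgue A = ennreal \<bar>c\<bar> * emeasure lebesgue ((\<lambda>x. t + c * x) -` A)" .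
qed

lemma affine_unit:
  fixes t c :: real
  assumes c: "c > 0"
  shows "(\<lambda>x. t + c * x) \<in> unit_measure \<rightarrow>\<^sub>M lebesgue_on {t..<t + c}" (is "?T \<in> _")
    and "distr unit_measure (lebesgue_on {t..<t + c}) (\<lambda>x. t + c * x)
      = density (lebesgue_on {t..<t + c}) (\<lambda>_. ennreal (1 / c))"
proof -
  have range: "t + c * x \<in> {t..<t + c} \<longleftrightarrow> x \<in> {0..<1}" for x
  proof -
    have "c * x < c \<longleftrightarrow> x < 1" using mult_less_cancel_left_pos[OF c, of x 1] by simp
    moreover have "0 \<le> c * x \<longleftrightarrow> 0 \<le> x" using c by (simp add: zero_le_mult_iff)
    ultimately show ?thesis by simp
  qed
  have pre: "?T -` A \<inter> space unit_measure = ?T -` A" if "A \<subseteq> {t..<t + c}" for A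
    using that range by (auto simp: space_restrict_space)
  have sets: "A \<subseteq> {t..<t + c} \<and> A \<in> sets lebesgue" if "A \<in> sets (lebesgue_on {t..<t + c})" for A
    using that by (simp add: sets_restrict_space_iff)
  show T: "?T \<in> unit_measure \<rightarrow>\<^sub>M lebesgue_on {t..<t + c}"
  proof (rule measurableI)
    show "t + c * x \<in> space (lebesgue_on {t..<t + c})" if "x \<in> space unit_measure" for x
      using that range by (simp add: space_restrict_space)
    fix A assume "A \<in> sets (lebesgue_on {t..<t + c})"
    note A = sets[OF this]
    have "?T -` A \<subseteq> {0..<1}" using A range by auto
    then show "?T -` A \<inter> space unit_measure \<in> sets unit_measure"
      using A vimage_affine_lebesgue(1)[of c A t] c pre[of A] by (simp add: sets_restrict_space_iff)
  qed
  show "distr unit_measure (lebesgue_on {t..<t + c}) ?T = density (lebesgue_on {t..<t + c}) (\<lambda>_. ennreal (1 / c))"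
  proof (rule measure_eqI)
    fix A assume "A \<in> sets (distr unit_measure (lebesgue_on {t..<t + c}) ?T)"
    then have A': "A \<in> sets (lebesgue_on {t..<t + c})" by simp
    note A = sets[OF A']
    have sub: "?T -` A \<subseteq> {0..<1}" using A range by auto
    have "emeasure (distr unit_measure (lebesgue_on {t..<t + c}) ?T) A = emeasure unit_measure (?T -` A)"
      using emeasure_distr[OF T A'] pre[of A] A by simp
    also have "\<dots> = emeasure lebesgue (?T -` A)"
      using sub by (intro emeasure_restrict_space) auto
    also have "\<dots> = ennreal (1 / c) * (ennreal c * emeasure lebesgue (?T -` A))"
      using c by (simp add: mult.assoc[symmetric] ennreal_mult[symmetric])
    also have "ennreal c * emeasure lebesgue (?T -` A) = emeasure lebesgue A"
      using vimage_affine_lebesgue(2)[of c A t] A c by simp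
    also have "emeasure lebesgue A = emeasure (lebesgue_on {t..<t + c}) A"
      using A by (intro emeasure_restrict_space[symmetric]) auto
    also have "ennreal (1 / c) * \<dots> = emeasure (density (lebesgue_on {t..<t + c}) (\<lambda>_. ennreal (1 / c))) A"
      using A' by (simp add: emeasure_density_const)
    finally show "emeasure (distr unit_measure (lebesgue_on {t..<t + c}) ?T) A
        = emeasure (density (lebesgue_on {t..<t + c}) (\<lambda>_. ennreal (1 / c))) A" .
  qed simp
qed

lemma expfun_mult_arg: "expfun a (t + c * x) = expfun a t * expfun (a * c) x"
  by (simp add: expfun_def algebra_simps flip: exp_add)

text \<open>
  Rescaling \<open>[1,\<beta>)\<close> to unit length turns the frequency \<open>k / \<beta>\<close> into \<open>(1 - 1/\<beta>) k\<close>. For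
  \<open>k\<close> equal to \<open>conearest (1 - 1/\<beta>) n\<close> this is within \<open>(1 - 1/\<beta>) / 2 < 1/4\<close> of \<open>n - 1/2\<close>.
\<close>

lemma riesz_basis_complementary_interval:
  assumes \<beta>: "1 < \<beta>" "\<beta> < 2"
  shows "riesz_basis (lebesgue_on {1..<\<beta>}) (\<lambda>k. expfun (of_int k / \<beta>)) (UNIV - range (nearest \<beta>))"
proof -
  define \<alpha> where "\<alpha> = 1 - 1 / \<beta>"
  have \<alpha>: "0 < \<alpha>" "\<alpha> / 2 < 1 / 4" using \<beta> by (auto simp: \<alpha>_def field_simps)
  define s where "s = conearest \<alpha>"
  have bij: "bij_betw s UNIV (UNIV - range (nearest \<beta>))"
    unfolding s_def \<alpha>_def by (rule bij_conearest[OF \<beta>(1)])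
  have "riesz_basis unit_measure (\<lambda>n. expfun (\<alpha> * of_int (s n))) UNIV"
    by (rule kadec[where s = "- 1 / 2" and L = "\<alpha> / 2"])
      (use conearest_close[OF \<alpha>(1)] \<alpha>(2) in \<open>auto simp: s_def algebra_simps\<close>)
  then have "riesz_basis unit_measure
      (\<lambda>n y. expfun (of_int (s n) / \<beta>) 1 * (1 * expfun (\<alpha> * of_int (s n)) y)) UNIV"
    by (rule riesz_basis_unimodular) auto
  moreover have "expfun (of_int (s n) / \<beta>) 1 * (1 * expfun (\<alpha> * of_int (s n)) y)
      = expfun (of_int (s n) / \<beta>) (1 + (\<beta> - 1) * y)" for n y
  proof -
    have "\<alpha> * of_int (s n) = of_int (s n) / \<beta> * (\<beta> - 1)" using \<beta> by (simp add: \<alpha>_def field_simps)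
    then show ?thesis by (simp only: expfun_mult_arg mult_1_left)
  qed
  ultimately have "riesz_basis unit_measure (\<lambda>n y. expfun (of_int (s n) / \<beta>) (1 + (\<beta> - 1) * y)) UNIV"
    by simp
  then have "riesz_basis (lebesgue_on {1..<1 + (\<beta> - 1)}) (\<lambda>n. expfun (of_int (s n) / \<beta>)) UNIV"
    by (rule riesz_basis_transport[where c = "1 / (\<beta> - 1)"]) (use affine_unit[of "\<beta> - 1" 1] \<beta> in auto)
  then have R: "riesz_basis (lebesgue_on {1..<\<beta>}) (\<lambda>n. expfun (of_int (s n) / \<beta>)) UNIV" by simp
  have "bij_betw (inv s) (UNIV - range (nearest \<beta>)) UNIV" by (rule bij_betw_inv_into[OF bij])
  then show ?thesis
    by (rule riesz_basis_reindex[OF R]) (use bij in \<open>simp add: bij_betw_inv_into_right\<close>)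
qed

text \<open>
  The ambient orthogonal basis is that of \<open>[0,\<beta>)\<close>, obtained from the Fourier basis by dilation;
  its members have squared norm \<open>\<beta>\<close>.
\<close>

lemma riesz_basis_unit_nearest_between:
  assumes \<beta>: "1 < \<beta>" "\<beta> < 2"
  shows "riesz_basis unit_measure (\<lambda>n. expfun (of_int (nearest \<beta> n) / \<beta>)) UNIV"
proof -
  define M where "M = lebesgue_on {0..<\<beta>}"
  define e where "e = (\<lambda>k::int. expfun (of_int k / \<beta>))"
  have \<psi>: "(\<lambda>x. 0 + \<beta> * x) \<in> unit_measure \<rightarrow>\<^sub>M M"
    and d: "distr unit_measure M (\<lambda>x. 0 + \<beta> * x) = density M (\<lambda>_. ennreal (1 / \<beta>))"
    using affine_unit[of \<beta> 0] \<beta> unfolding M_def by auto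
  have e\<psi>: "e k (0 + \<beta> * x) = expfun (of_int k) x" for k x
    unfolding e_def expfun_mult_arg using \<beta> by (simp add: expfun_def)
  have em: "e k \<in> borel_measurable M" for k unfolding e_def M_def by simp
  \<comment> \<open>the Fourier basis itself, as the unperturbed case\<close>
  have unit: "riesz_basis unit_measure (\<lambda>k::int. expfun (of_int k)) UNIV"
    by (rule kadec[where s = 0 and L = 0]) auto
  have R: "riesz_basis M e UNIV"
    by (rule riesz_basis_transport[OF _ em \<psi> _ d]) (use unit \<beta> in \<open>simp_all only: e\<psi>, simp\<close>)
  have es: "e k \<in> sqint M" for k by (rule riesz_basisD(1)[OF R]) simp
  have ortho: "l2inner M (e j) (e k) = (if j = k then of_real \<beta> else 0)" for j k
  proof -
    have m: "(\<lambda>x. e j x * cnj (e k x)) \<in> borel_measurable M"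
      by (intro borel_measurable_times borel_measurable_cnj em)
    have "l2inner unit_measure (expfun (of_int j)) (expfun (of_int k))
        = (\<integral>x. e j (0 + \<beta> * x) * cnj (e k (0 + \<beta> * x)) \<partial>unit_measure)"
      unfolding l2inner_def e\<psi> ..
    also have "\<dots> = (\<integral>x. e j x * cnj (e k x) \<partial>distr unit_measure M (\<lambda>x. 0 + \<beta> * x))"
      by (rule integral_distr[OF \<psi> m, symmetric])
    also have "\<dots> = (\<integral>x. (1 / \<beta>) *\<^sub>R (e j x * cnj (e k x)) \<partial>M)"
      unfolding d using \<beta> m by (intro integral_density) auto
    also have "\<dots> = (1 / \<beta>) *\<^sub>R l2inner M (e j) (e k)"
      unfolding l2inner_def by (rule integral_scaleR_right)
    finally show ?thesis using \<beta> unfolding l2inner_expfun_unit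
      by (auto simp: scaleR_conv_of_real field_simps split: if_splits)
  qed
  have r1: "restrict_space M {0..<1} = unit_measure"
    unfolding M_def using \<beta> by (subst restrict_restrict_space) (auto intro!: arg_cong[where f = "restrict_space lebesgue"])
  have r2: "restrict_space M (space M - {0..<1}) = lebesgue_on {1..<\<beta>}"
    unfolding M_def space_restrict_space using \<beta>
    by (subst restrict_restrict_space) (auto intro!: arg_cong[where f = "restrict_space lebesgue"])
  have "riesz_basis (restrict_space M {0..<1}) e (range (nearest \<beta>))"
  proof (rule riesz_basis_complement[where K = UNIV and \<kappa> = \<beta>])
    show "{0..<1} \<in> sets M" unfolding M_def using \<beta> by (subst sets_restrict_space_iff) auto
    show "riesz_basis (restrict_space M (space M - {0..<1})) e (UNIV - range (nearest \<beta>))"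
      unfolding r2 e_def by (rule riesz_basis_complementary_interval[OF \<beta>])
  qed (use \<beta> es ortho riesz_basisD(4)[OF R] in auto)
  then have "riesz_basis unit_measure e (range (nearest \<beta>))" unfolding r1 .
  moreover have "bij_betw (nearest \<beta>) UNIV (range (nearest \<beta>))"
    using inj_nearest[of \<beta>] \<beta> by (simp add: bij_betw_def)
  ultimately show ?thesis unfolding e_def by (rule riesz_basis_reindex) simp
qed

theorem riesz_basis_unit_nearest:
  assumes "1 \<le> \<beta>"
  shows "riesz_basis unit_measure (\<lambda>n. expfun (of_int (nearest \<beta> n) / \<beta>)) UNIV"
proof -
  consider "\<beta> = 1" | "1 < \<beta>" "\<beta> < 2" | "\<beta> = 2" | "\<beta> > 2" using assms by linarith
  then show ?thesis
  proof cases
    case 1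
    then have "nearest \<beta> n = n" for n by (simp add: nearest_def floor_eq_iff)
    then show ?thesis using 1 by (intro kadec[where s = 0 and L = 0]) auto
  next
    case 2
    then show ?thesis by (rule riesz_basis_unit_nearest_between)
  next
    case 3
    then have "nearest \<beta> n = 2 * n" for n by (simp add: nearest_def floor_eq_iff)
    then show ?thesis using 3 by (intro kadec[where s = 0 and L = 0]) auto
  next
    case 4
    then have "1 / (2 * \<beta>) < 1 / 4" by (simp add: field_simps)
    then show ?thesis using 4 nearest_close[of \<beta>]
      by (intro kadec[where s = 0 and L = "1 / (2 * \<beta>)"]) auto
  qed
qed

section \<open>Unfolding the unit interval\<close>

lemma unit_partition_mono:
  assumes P: "unit_partition m a" and "i \<le> j" "enat j \<le> m"
  shows "a i \<le> a j"
  using assms(2,3)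
proof (induction j rule: dec_induct)
  case base
  then show ?case by simp
next
  case (step n)
  have "enat n < m" using step.prems by (simp add: Suc_ile_eq)
  then have "a n < a (Suc n)" using P by (simp add: unit_partition_def)
  moreover have "a i \<le> a n" using step.IH \<open>enat n < m\<close> by simp
  ultimately show ?case by simp
qed

lemma unit_partition_le_1:
  assumes P: "unit_partition m a" and "enat j \<le> m"
  shows "a j \<le> 1"
proof (cases m)
  case (enat k)
  then have "a j \<le> a k" using assms by (intro unit_partition_mono[OF P]) auto
  then show ?thesis using P enat by (simp add: unit_partition_def)
next
  case infinity
  then have "incseq a" using unit_partition_mono[OF P] by (simp add: incseq_def)
  then show ?thesis using P infinity by (auto simp: unit_partition_def intro: incseq_le)
qed

lemma unit_partition_ex:
  assumes P: "unit_partition m a" and y: "0 \<le> y" "y < 1"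
  shows "\<exists>j. enat j < m \<and> a j \<le> y \<and> y < a (Suc j)"
proof -
  have "\<exists>N. enat N \<le> m \<and> y < a N"
  proof (cases m)
    case (enat k)
    then show ?thesis using P y by (intro exI[of _ k]) (simp add: unit_partition_def)
  next
    case infinity
    then have "a \<longlonglongrightarrow> 1" using P by (simp add: unit_partition_def)
    then have "eventually (\<lambda>n. y < a n) sequentially" using y(2) by (rule order_tendstoD(1))
    then show ?thesis using infinity by (auto simp: eventually_sequentially)
  qed
  then obtain N where N: "enat N \<le> m" "y < a N" by blast
  define n where "n = (LEAST n. y < a n)"
  have n: "y < a n" "n \<le> N" unfolding n_def using N(2) by (auto intro: LeastI Least_le)
  have "n \<noteq> 0" using n(1) y P by (intro notI) (simp add: unit_partition_def)
  then obtain j where j: "n = Suc j" using not0_implies_Suc by blast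
  then have "a j \<le> y" using not_less_Least[of j "\<lambda>n. y < a n"] unfolding n_def[symmetric] by simp
  moreover have "enat j < m" using n(2) j N(1) by (metis Suc_ile_eq enat_ord_simps(1) order_trans)
  ultimately show ?thesis using n(1) j by blast
qed

text \<open>
  The map sends \<open>[a\<^sub>j, a\<^sub>j\<^sub>+\<^sub>1)\<close> to its translate by \<open>b\<^sub>j\<close>. It preserves measure because
  the translates are disjoint, the sequence \<open>b\<close> being increasing, and exhaust \<open>J\<close>.
\<close>

lemma unfold_measure:
  assumes P: "unit_partition m a" and Q: "shift_sequence m b"
  defines "J \<equiv> segment_union m a b"
  shows "\<exists>\<psi>. \<psi> \<in> unit_measure \<rightarrow>\<^sub>M lebesgue_on J \<and>
    distr unit_measure (lebesgue_on J) \<psi> = density (lebesgue_on J) (\<lambda>_. ennreal 1) \<and>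
    (\<forall>y. \<exists>j. enat j < m \<and> \<psi> y = y + b j)"
proof -
  have le1: "a (Suc j) \<le> 1" if "enat j < m" for j
    using that by (intro unit_partition_le_1[OF P]) (simp add: Suc_ile_eq)
  have ge0: "0 \<le> a j" if "enat j < m" for j
    using unit_partition_mono[OF P, of 0 j] that P by (simp add: unit_partition_def)
  have bmono: "b i \<le> b j" if "i \<le> j" "enat j < m" for i j
    using that
  proof (induction j rule: dec_induct)
    case (step n)
    have "enat n < m" using step.prems by (meson enat_ord_simps(2) lessI less_trans)
    then show ?case using step Q by (fastforce simp: shift_sequence_def)
  qed simp
  have amono: "a (Suc i) \<le> a j" if "i < j" "enat j < m" for i j
    using that by (intro unit_partition_mono[OF P]) auto
  define I where "I j = {a j..<a (Suc j)}" for j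
  define S where "S j = {a j + b j..<a (Suc j) + b j}" for j
  have Idisj: "I i \<inter> I j = {}" if "i < j" "enat j < m" for i j
    using amono[OF that] by (auto simp: I_def)
  have Sdisj: "S i \<inter> S j = {}" if "i < j" "enat j < m" for i j
    using amono[OF that] bmono[of i j] that by (auto simp: S_def)
  have Iuniq: "i = j" if "y \<in> I i" "y \<in> I j" "enat i < m" "enat j < m" for i j y
    using Idisj[of i j] Idisj[of j i] that by (cases i j rule: linorder_cases) auto
  have IS: "y \<in> I j \<longleftrightarrow> y + b j \<in> S j" for y j by (auto simp: I_def S_def)
  have m0: "enat 0 < m"
    using unit_partition_ex[OF P, of 0] by (auto simp: zero_enat_def[symmetric] intro: le_less_trans)
  \<comment> \<open>off the unit interval the shift is zero, so that the fold is by a term of the sequence everywhere\<close>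
  define idx where "idx y = (if y \<in> {0..<1} then SOME j. enat j < m \<and> y \<in> I j else 0)" for y
  have idx: "enat (idx y) < m" "y \<in> I (idx y)" if "y \<in> {0..<1}" for y
    using unit_partition_ex[OF P, of y] that someI_ex[of "\<lambda>j. enat j < m \<and> y \<in> I j"]
    by (auto simp: idx_def I_def)
  have idx_eq: "idx y = j" if "y \<in> I j" "enat j < m" for y j
  proof -
    have "y \<in> {0..<1}" using that le1[OF that(2)] ge0[OF that(2)] by (auto simp: I_def)
    then show ?thesis using idx[of y] that Iuniq by blast
  qed
  define \<psi> where "\<psi> y = y + b (idx y)" for y
  have JS: "J = (\<Union>j\<in>{j. enat j < m}. S j)" by (simp add: J_def segment_union_def S_def)
  have Jm: "J \<in> sets lebesgue"
    unfolding JS S_def by (intro sets.countable_UN') auto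
  have pre: "\<psi> -` A \<inter> {0..<1} = (\<Union>j\<in>{j. enat j < m}. (\<lambda>x. b j + 1 * x) -` (A \<inter> S j))" if "A \<subseteq> J" for A
  proof (intro equalityI subsetI)
    fix y assume "y \<in> \<psi> -` A \<inter> {0..<1}"
    then have y: "\<psi> y \<in> A" "y \<in> {0..<1}" by auto
    then show "y \<in> (\<Union>j\<in>{j. enat j < m}. (\<lambda>x. b j + 1 * x) -` (A \<inter> S j))"
      using idx[OF y(2)] IS[of y "idx y"] by (auto simp: \<psi>_def add.commute)
  next
    fix y assume "y \<in> (\<Union>j\<in>{j. enat j < m}. (\<lambda>x. b j + 1 * x) -` (A \<inter> S j))"
    then obtain j where j: "enat j < m" "y + b j \<in> A" "y + b j \<in> S j" by (auto simp: add.commute)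
    then have yI: "y \<in> I j" by (simp add: IS)
    then have "y \<in> {0..<1}" using le1[OF j(1)] ge0[OF j(1)] by (auto simp: I_def)
    then show "y \<in> \<psi> -` A \<inter> {0..<1}" using idx_eq[OF yI j(1)] j(2) by (simp add: \<psi>_def)
  qed
  have Sm: "S j \<in> sets lebesgue" for j by (simp add: S_def)
  have \<psi>m: "\<psi> \<in> unit_measure \<rightarrow>\<^sub>M lebesgue_on J"
  proof (rule measurableI)
    fix y assume "y \<in> space unit_measure"
    then have "y \<in> {0..<1}" by (simp add: space_restrict_space)
    then show "\<psi> y \<in> space (lebesgue_on J)"
      using idx[of y] IS[of y "idx y"] by (auto simp: \<psi>_def JS space_restrict_space)
  next
    fix A assume "A \<in> sets (lebesgue_on J)"
    then have A: "A \<subseteq> J" "A \<in> sets lebesgue" using Jm by (auto simp: sets_restrict_space_iff)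
    have "(\<Union>j\<in>{j. enat j < m}. (\<lambda>x. b j + 1 * x) -` (A \<inter> S j)) \<in> sets lebesgue"
      by (rule sets.countable_UN'[OF _ image_subsetI]; (intro vimage_affine_lebesgue(1) sets.Int A Sm)?; simp)
    then have "\<psi> -` A \<inter> {0..<1} \<in> sets lebesgue" unfolding pre[OF A(1)] .
    then show "\<psi> -` A \<inter> space unit_measure \<in> sets unit_measure"
      by (simp add: sets_restrict_space_iff space_restrict_space)
  qed
  have "distr unit_measure (lebesgue_on J) \<psi> = density (lebesgue_on J) (\<lambda>_. ennreal 1)"
  proof (rule measure_eqI)
    fix A assume "A \<in> sets (distr unit_measure (lebesgue_on J) \<psi>)"
    then have A': "A \<in> sets (lebesgue_on J)" by simp
    then have A: "A \<subseteq> J" "A \<in> sets lebesgue" using Jm by (auto simp: sets_restrict_space_iff)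
    \<comment> \<open>padded with empty sets, so that finite and infinite \<open>m\<close> are covered by one series\<close>
    define B where "B j = (if enat j < m then A \<inter> S j else {})" for j
    have Bm: "B j \<in> sets lebesgue" for j using A Sm by (simp add: B_def)
    have Bd: "B i \<inter> B j = {}" if "i \<noteq> j" for i j
      using that Sdisj[of i j] Sdisj[of j i] by (cases i j rule: linorder_cases) (auto simp: B_def)
    define C where "C j = (\<lambda>x. b j + 1 * x) -` B j" for j
    have Cm: "C j \<in> sets lebesgue" for j unfolding C_def by (intro vimage_affine_lebesgue(1) Bm) simp
    have CI: "C j \<subseteq> I j" for j using IS[of _ j] by (auto simp: C_def B_def add.commute split: if_splits)
    have Cd: "C i \<inter> C j = {}" if "i \<noteq> j" for i j
    proof (cases "enat i < m \<and> enat j < m")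
      case True
      then show ?thesis using CI Iuniq that by blast
    qed (auto simp: C_def B_def)
    have eqC: "emeasure lebesgue (C j) = emeasure lebesgue (B j)" for j
      unfolding C_def using vimage_affine_lebesgue(2)[of 1 "B j" "b j"] Bm by simp
    have UC: "\<psi> -` A \<inter> {0..<1} = (\<Union>j. C j)" unfolding pre[OF A(1)] by (auto simp: C_def B_def split: if_splits)
    have UB: "A = (\<Union>j. B j)" using A(1) unfolding JS by (auto simp: B_def split: if_splits)
    have "emeasure (distr unit_measure (lebesgue_on J) \<psi>) A = emeasure unit_measure (\<psi> -` A \<inter> {0..<1})"
      using emeasure_distr[OF \<psi>m A'] by (simp add: space_restrict_space)
    also have "\<dots> = emeasure lebesgue (\<psi> -` A \<inter> {0..<1})" by (intro emeasure_restrict_space) auto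
    also have "\<dots> = (\<Sum>j. emeasure lebesgue (C j))"
      unfolding UC using Cm Cd by (intro suminf_emeasure[symmetric]) (auto simp: disjoint_family_on_def)
    also have "\<dots> = (\<Sum>j. emeasure lebesgue (B j))" by (simp add: eqC)
    also have "\<dots> = emeasure lebesgue A"
      by (subst UB, intro suminf_emeasure) (use Bm Bd in \<open>auto simp: disjoint_family_on_def\<close>)
    also have "\<dots> = emeasure (lebesgue_on J) A"
      using A Jm by (intro emeasure_restrict_space[symmetric]) auto
    also have "\<dots> = emeasure (density (lebesgue_on J) (\<lambda>_. ennreal 1)) A"
      using A' by (simp add: emeasure_density_const)
    finally show "emeasure (distr unit_measure (lebesgue_on J) \<psi>) A
        = emeasure (density (lebesgue_on J) (\<lambda>_. ennreal 1)) A" .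
  qed simp
  moreover have "\<exists>j. enat j < m \<and> \<psi> y = y + b j" for y
    using idx(1)[of y] m0 by (cases "y \<in> {0..<1}") (auto simp: \<psi>_def idx_def)
  ultimately show ?thesis using \<psi>m by blast
qed

text \<open>
  Distinct frequencies give distinct functions, since the quotient of the two exponentials takes the
  value -1 at half its period. Hence enumerations of the set of functions are enumerations of the indices.
\<close>

lemma inj_expfun: "inj expfun"
proof (rule injI, rule ccontr)
  fix l \<mu> :: real assume eq: "expfun l = expfun \<mu>" and ne: "l \<noteq> \<mu>"
  \<comment> \<open>half the period of the quotient\<close>
  define x where "x = 1 / (2 * (l - \<mu>))"
  have "expfun (l + - \<mu>) x = expfun l x * cnj (expfun \<mu> x)" by (simp only: expfun_add cnj_expfun)
  also have "\<dots> = expfun \<mu> x * cnj (expfun \<mu> x)" by (simp add: eq)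
  also have "\<dots> = 1" by (simp add: complex_norm_square[symmetric])
  finally have "expfun (l - \<mu>) x = 1" by simp
  moreover have "(l - \<mu>) * x = 1 / 2" using ne by (simp add: x_def)
  then have "expfun (l - \<mu>) x = exp (2 * of_real pi * \<i> * of_real (1 / 2))" by (simp only: expfun_def)
  then have "expfun (l - \<mu>) x = -1" by simp
  ultimately show False by simp
qed

theorem theorem1p1:
  fixes m :: enat and a b :: "nat \<Rightarrow> real" and \<beta> :: real
  assumes "unit_partition m a"
    and "shift_sequence m b"
    and "\<beta> \<ge> 1"
    and "\<And>k. enat k < m \<Longrightarrow> b k / \<beta> \<in> \<int>"
  shows "exponential_basis (segment_union m a b)
           {expfun (of_int n + delta_star \<beta> n) |n :: int. True}"
proof -
  define J where "J = segment_union m a b"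
  define e where "e n = expfun (of_int (nearest \<beta> n) / \<beta>)" for n
  have \<beta>: "\<beta> > 0" using assms(3) by simp
  have set_eq: "{expfun (of_int n + delta_star \<beta> n) |n :: int. True} = range e"
    unfolding e_def delta_star_nearest[OF \<beta>] by auto
  obtain \<psi> where \<psi>: "\<psi> \<in> unit_measure \<rightarrow>\<^sub>M lebesgue_on J"
    "distr unit_measure (lebesgue_on J) \<psi> = density (lebesgue_on J) (\<lambda>_. ennreal 1)"
    "\<And>y. \<exists>j. enat j < m \<and> \<psi> y = y + b j"
    using unfold_measure[OF assms(1,2)] unfolding J_def by blast
  \<comment> \<open>the frequencies are multiples of the reciprocal of the period, so the fold is invisible to the exponentials\<close>
  have per: "e n (\<psi> y) = e n y" for n y
  proof -
    obtain j where j: "enat j < m" "\<psi> y = y + b j" using \<psi>(3)[of y] by blast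
    obtain k :: int where k: "b j / \<beta> = of_int k" using assms(4)[OF j(1)] by (auto elim: Ints_cases)
    have "e n (b j + 1 * y) = e n (b j) * e n y"
      unfolding e_def expfun_mult_arg by simp
    moreover have "e n (b j) = expfun (of_int (nearest \<beta> n * k)) 1"
      using k by (simp add: e_def expfun_def flip: k)
    ultimately show ?thesis using j(2) by (simp add: expfun_of_int_1 add.commute del: of_int_mult)
  qed
  have "riesz_basis unit_measure e UNIV"
    unfolding e_def by (rule riesz_basis_unit_nearest[OF assms(3)])
  then have "riesz_basis unit_measure (\<lambda>n y. e n (\<psi> y)) UNIV"
    by (simp add: per)
  then have "riesz_basis (lebesgue_on J) e UNIV"
    by (rule riesz_basis_transport[where c = 1, OF _ _ \<psi>(1) _ \<psi>(2)]) (auto simp: e_def)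
  moreover have "inj e"
  proof (rule injI)
    fix n n' assume "e n = e n'"
    then have "nearest \<beta> n = nearest \<beta> n'"
      using \<beta> injD[OF inj_expfun] unfolding e_def by fastforce
    then show "n = n'" using injD[OF inj_nearest[OF assms(3)]] by blast
  qed
  moreover have "\<exists>g :: nat \<Rightarrow> int. bij g"
    using bij_int_decode by blast
  ultimately have "unconditional_basis_L2 J (range e)"
    by (rule riesz_basis_imp_unconditional_basis)
  then show ?thesis
    unfolding exponential_basis_def set_eq J_def by (auto simp: e_def)
qed

end
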